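(* Let $N\ge2$ and fix a finite generating set of $\mathrm{SL}(N,\mathbb{Z})$. Consider all words of length $L$ in the generators, each counted equally. Then the proportion of such words $w$ for which the characteristic polynomial of $w^k$ is irreducible over $\mathbb{Z}$ for every $k\ge1$ tends to $1$ as $L\to\infty$. *)

theory Defs
  imports "Jordan_Normal_Form.Char_Poly" "HOL-Computational_Algebra.Polynomial_Factorial"
begin

definition SL_int :: "nat \<Rightarrow> int mat set" where
  "SL_int N = {A \<in> carrier_mat N N. det A = 1}"

definition gen_letters :: "nat \<Rightarrow> int mat set \<Rightarrow> int mat set" where
  "gen_letters N S = S \<union> {B \<in> carrier_mat N N. \<exists>A\<in>S. A * B = 1\<^sub>m N \<and> B * A = 1\<^sub>m N}"

definition word_prod :: "nat \<Rightarrow> int mat list \<Rightarrow> int mat" where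
  "word_prod N ws = foldr (*) ws (1\<^sub>m N)"

definition words :: "int mat set \<Rightarrow> nat \<Rightarrow> int mat list set" where
  "words T L = {ws. set ws \<subseteq> T \<and> length ws = L}"

definition generates_SL :: "nat \<Rightarrow> int mat set \<Rightarrow> bool" where
  "generates_SL N S \<longleftrightarrow> S \<subseteq> SL_int N \<and>
     SL_int N = word_prod N ` {ws. set ws \<subseteq> gen_letters N S}"

end

theory Submission
  imports Defs "Jordan_Normal_Form.Schur_Decomposition"
    "HOL-Number_Theory.Residue_Primitive_Roots" "HOL-Computational_Algebra.Squarefree"
begin

text \<open>
  Modulo a square-free odd \<open>m\<close>, the random word equidistributes in \<open>SL(N, \<int>/m)\<close>: elementary
  matrices generate this group and are squares in it, so there is no parity obstruction. By the Chinese
  remainder theorem the conditions modulo distinct primes become independent, so any event that has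
  proportion at least \<open>c > 0\<close> modulo every large prime occurs for some prime with limiting probability
  \<open>1\<close>.

  Finite fields of prime power order are avoided by replacing irreducibility modulo \<open>p\<close> with
  the events that there is no factor of degree \<open>d\<close> modulo \<open>p\<close> for \<open>0 < d < N\<close>. There are at most as many
  products \<open>g h\<close> with \<open>deg g = d\<close> and the right constant term as there are polynomials, and completely
  split polynomials, which have positive proportion, are hit more than once; so a positive proportion of
  polynomials is not hit at all. Conjugates of companion matrices transfer this to matrices.

  For the powers, fix \<open>K\<close> such that \<open>w\<^sup>K\<close> is trivial modulo \<open>15\<close> for all \<open>w\<close>. By a Minkowski type
  argument an integer matrix commuting with a power of \<open>w\<^sup>K\<close> commutes with \<open>w\<^sup>K\<close>, so eigenvalues with
  \<open>\<lambda>\<^sup>k = \<mu>\<^sup>k\<close> satisfy \<open>\<lambda>\<^sup>K = \<mu>\<^sup>K\<close>. That is excluded once the characteristic polynomial splits modulo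
  some prime with roots whose \<open>K\<close>-th powers are distinct.
\<close>

hide_const (open) UnivPoly.coeff UnivPoly.monom

subsection \<open>Matrices and polynomials modulo an integer\<close>

text \<open>Infinitely many powers are controlled by finitely many events. Once \<open>K\<close> is
  fixed, irreducibility of the characteristic polynomials of \<open>w\<close> and of its
  \<open>K\<close>-th power forces irreducibility for all powers. This leaves \<open>N\<close>
  events per word, one for each degree \<open>0 < d < N\<close> and one for splitting, and a union
  bound handles them. They may happen at different primes, so having a factor of degree
  \<open>d\<close> at one prime and splitting completely at another do no harm.

  The order of choices is \<open>K\<close>, then a density \<open>c\<close> that must not depend on
  the prime, then enough large primes, and \<open>L\<close> last. Equidistribution is thus applied
  to one fixed modulus at a time.

  The parity obstruction is real for even moduli: \<open>SL(2, \<int>/2)\<close> is the symmetric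
  group on three letters, where both elementary generators are transpositions, so the walk
  alternates between even and odd permutations. Modulo an odd number 2 is invertible, and an
  elementary matrix with entry \<open>t\<close> is the square of the one with entry
  \<open>t/2\<close>.\<close>

definition mat_mod :: "int \<Rightarrow> int mat \<Rightarrow> int mat" where
  "mat_mod m A = map_mat (\<lambda>x. x mod m) A"

text \<open>Residue matrices are integer matrices with reduced entries, so one type serves every
  modulus, including products of primes chosen in the course of a proof.\<close>

definition SL_mod :: "nat \<Rightarrow> int \<Rightarrow> int mat set" where
  "SL_mod N m = {A \<in> carrier_mat N N. mat_mod m A = A \<and> [det A = 1] (mod m)}"

definition poly_red :: "int \<Rightarrow> int poly \<Rightarrow> int poly" where
  "poly_red m f = map_poly (\<lambda>c. c mod m) f"

lemma dvd_prod_diff: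
  fixes f g :: "'b \<Rightarrow> 'a :: comm_ring_1"
  assumes "\<And>i. i \<in> I \<Longrightarrow> c dvd f i - g i"
  shows "c dvd prod f I - prod g I"
  using assms
proof (induction I rule: infinite_finite_induct)
  case (insert x I)
  have "prod f (insert x I) - prod g (insert x I) =
    f x * (prod f I - prod g I) + (f x - g x) * prod g I"
    using insert.hyps by (simp add: algebra_simps)
  moreover have "c dvd f x * (prod f I - prod g I)" "c dvd (f x - g x) * prod g I"
    using insert.IH insert.prems by (auto intro: dvd_mult dvd_mult2)
  ultimately show ?case by (metis dvd_add)
qed auto

text \<open>The ring is arbitrary because this serves both integer determinants modulo
  \<open>m\<close> and, with the constant polynomial \<open>[:m:]\<close> as divisor, characteristic
  polynomials.\<close>

lemma det_dvd_diff:
  fixes A B :: "'a :: comm_ring_1 mat"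
  assumes A: "A \<in> carrier_mat n n" and B: "B \<in> carrier_mat n n"
    and c: "\<And>i j. i < n \<Longrightarrow> j < n \<Longrightarrow> c dvd A $$ (i,j) - B $$ (i,j)"
  shows "c dvd det A - det B"
  unfolding det_def'[OF A] det_def'[OF B] sum_subtractf[symmetric] right_diff_distrib[symmetric]
proof (rule dvd_sum, rule dvd_mult, rule dvd_prod_diff)
  fix p i assume "p \<in> {p. p permutes {0..<n}}" "i \<in> {0..<n}"
  then show "c dvd A $$ (i, p i) - B $$ (i, p i)"
    by (intro c) (auto simp: permutes_in_image)
qed

lemma mat_mod_carrier [simp]: "mat_mod m A \<in> carrier_mat n k \<longleftrightarrow> A \<in> carrier_mat n k"
  by (auto simp: mat_mod_def)

lemma dim_mat_mod [simp]: "dim_row (mat_mod m A) = dim_row A" "dim_col (mat_mod m A) = dim_col A"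
  by (auto simp: mat_mod_def)

lemma index_mat_mod [simp]:
  "i < dim_row A \<Longrightarrow> j < dim_col A \<Longrightarrow> mat_mod m A $$ (i,j) = A $$ (i,j) mod m"
  by (auto simp: mat_mod_def)

lemma mat_mod_mat_mod [simp]: "mat_mod m (mat_mod m A) = mat_mod m A"
  by (rule eq_matI) auto

lemma mat_mod_mod_dvd: "m dvd n \<Longrightarrow> mat_mod m (mat_mod n A) = mat_mod m A"
  by (rule eq_matI) (auto simp: mod_mod_cancel)

lemma mat_mod_eq_iff:
  assumes "A \<in> carrier_mat n k" "B \<in> carrier_mat n k"
  shows "mat_mod m A = mat_mod m B \<longleftrightarrow> (\<forall>i<n. \<forall>j<k. [A $$ (i,j) = B $$ (i,j)] (mod m))"
proof
  assume eq: "mat_mod m A = mat_mod m B"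
  show "\<forall>i<n. \<forall>j<k. [A $$ (i,j) = B $$ (i,j)] (mod m)"
  proof (intro allI impI)
    fix i j assume "i < n" "j < k"
    then show "[A $$ (i,j) = B $$ (i,j)] (mod m)"
      using arg_cong[OF eq, of "\<lambda>M. M $$ (i,j)"] assms by (simp add: cong_def)
  qed
next
  assume "\<forall>i<n. \<forall>j<k. [A $$ (i,j) = B $$ (i,j)] (mod m)"
  then show "mat_mod m A = mat_mod m B"
    using assms by (intro eq_matI) (auto simp: cong_def)
qed

lemma mat_mult_index_sum:
  assumes "A \<in> carrier_mat n l" "B \<in> carrier_mat l k" "i < n" "j < k"
  shows "(A * B) $$ (i,j) = (\<Sum>r<l. A $$ (i,r) * B $$ (r,j))"
  using assms by (auto simp: scalar_prod_def atLeast0LessThan intro!: sum.cong)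

lemma mat_mod_mult_cong:
  assumes "A \<in> carrier_mat n l" "A' \<in> carrier_mat n l"
    and "B \<in> carrier_mat l k" "B' \<in> carrier_mat l k"
    and "mat_mod m A = mat_mod m A'" "mat_mod m B = mat_mod m B'"
  shows "mat_mod m (A * B) = mat_mod m (A' * B')"
proof -
  have "[A $$ (i,j) = A' $$ (i,j)] (mod m)" if "i < n" "j < l" for i j
    using assms that mat_mod_eq_iff[of A n l A' m] by auto
  moreover have "[B $$ (i,j) = B' $$ (i,j)] (mod m)" if "i < l" "j < k" for i j
    using assms that mat_mod_eq_iff[of B l k B' m] by auto
  ultimately show ?thesis
    using assms(1-4)
    by (subst mat_mod_eq_iff[of _ n k])
      (auto simp del: index_mult_mat simp add: mat_mult_index_sum[of _ n l _ k]
        intro!: cong_sum cong_mult)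
qed

lemma mat_mod_mult_left [simp]:
  assumes "A \<in> carrier_mat n l" "B \<in> carrier_mat l k"
  shows "mat_mod m (mat_mod m A * B) = mat_mod m (A * B)"
  using assms by (intro mat_mod_mult_cong[of _ n l _ _ k]) auto

lemma mat_mod_mult_right [simp]:
  assumes "A \<in> carrier_mat n l" "B \<in> carrier_mat l k"
  shows "mat_mod m (A * mat_mod m B) = mat_mod m (A * B)"
  using assms by (intro mat_mod_mult_cong[of _ n l _ _ k]) auto

lemma mat_mod_pow_cong:
  assumes "A \<in> carrier_mat n n" "B \<in> carrier_mat n n" "mat_mod m A = mat_mod m B"
  shows "mat_mod m (A ^\<^sub>m k) = mat_mod m (B ^\<^sub>m k)"
proof (induction k)
  case 0
  then show ?case using assms by simp
next
  case (Suc k)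
  then show ?case using assms by (auto intro!: mat_mod_mult_cong[of _ n n _ _ n])
qed

lemma det_mod_cong:
  assumes "A \<in> carrier_mat n n" "B \<in> carrier_mat n n" "mat_mod m A = mat_mod m B"
  shows "[det A = det B] (mod m)"
proof -
  have "m dvd det A - det B"
    using assms mat_mod_eq_iff[of A n n B m] by (intro det_dvd_diff[of _ n]) (auto simp: cong_iff_dvd_diff)
  then show ?thesis by (simp add: cong_iff_dvd_diff)
qed

lemma coeff_poly_red [simp]: "coeff (poly_red m f) i = coeff f i mod m"
  by (simp add: poly_red_def coeff_map_poly)

lemma poly_red_eq_iff: "poly_red m f = poly_red m g \<longleftrightarrow> [:m:] dvd f - g"
  by (auto simp: poly_eq_iff const_poly_dvd_iff mod_eq_dvd_iff)

lemma poly_red_poly_red [simp]: "poly_red m (poly_red m f) = poly_red m f"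
  by (simp add: poly_eq_iff)

lemma poly_red_mult_cong:
  assumes "poly_red m f = poly_red m f'" "poly_red m g = poly_red m g'"
  shows "poly_red m (f * g) = poly_red m (f' * g')"
proof -
  have "f * g - f' * g' = f * (g - g') + (f - f') * g'" by (simp add: algebra_simps)
  then show ?thesis using assms unfolding poly_red_eq_iff
    by (metis dvd_add dvd_mult dvd_mult2)
qed

lemma poly_mod_cong:
  assumes "poly_red m f = poly_red m g"
  shows "[poly f x = poly g x] (mod m)"
proof -
  obtain h where "f - g = [:m:] * h" using assms unfolding poly_red_eq_iff by (elim dvdE)
  then have "poly f x - poly g x = m * poly h x" by (metis poly_diff poly_mult poly_pCons mult_zero_right poly_0 add_0_right)
  then show ?thesis by (simp add: cong_iff_dvd_diff)
qed

lemma degree_poly_red_monic: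
  assumes "lead_coeff f = 1" "m > 1"
  shows "degree (poly_red m f) = degree f" "lead_coeff (poly_red m f) = 1"
proof -
  have "coeff (poly_red m f) (degree f) = 1" using assms by simp
  moreover have "degree (poly_red m f) \<le> degree f"
    by (rule degree_le) (auto simp: coeff_eq_0)
  ultimately show "degree (poly_red m f) = degree f"
    by (metis le_antisym le_degree zero_neq_one)
  then show "lead_coeff (poly_red m f) = 1" using assms by simp
qed

section \<open>Characteristic polynomials modulo an integer\<close>

lemma char_poly_matrix_index:
  assumes "A \<in> carrier_mat n n" "i < n" "j < n"
  shows "char_poly_matrix A $$ (i,j) = (if i = j then [:0,1:] else 0) + [:- (A $$ (i,j)):]"
  using assms by (auto simp: char_poly_matrix_def)

lemma char_poly_mod_cong:
  assumes A: "A \<in> carrier_mat n n" and B: "B \<in> carrier_mat n n" and "mat_mod m A = mat_mod m B"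
  shows "poly_red m (char_poly A) = poly_red m (char_poly B)"
  unfolding poly_red_eq_iff char_poly_def
proof (rule det_dvd_diff[of _ n])
  fix i j assume ij: "i < n" "j < n"
  have "m dvd A $$ (i,j) - B $$ (i,j)"
    using assms ij mat_mod_eq_iff[of A n n B m] by (auto simp: cong_iff_dvd_diff)
  then have "[:m:] dvd [:B $$ (i,j) - A $$ (i,j):]"
    by (auto simp: const_poly_dvd dvd_diff_commute)
  then show "[:m:] dvd char_poly_matrix A $$ (i,j) - char_poly_matrix B $$ (i,j)"
    using A B ij by (simp add: char_poly_matrix_index)
qed (use A B in auto)

text \<open>Modulo \<open>p\<close> the relation gives \<open>(X - A) B = B (X - C)\<close>. Taking
  determinants and cancelling the unit \<open>det B\<close> coefficientwise avoids an inverse of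
  \<open>B\<close>.\<close>

lemma char_poly_mod_similar:
  assumes A: "A \<in> carrier_mat n n" and B: "B \<in> carrier_mat n n" and C: "C \<in> carrier_mat n n"
    and AB: "mat_mod p (A * B) = mat_mod p (B * C)" and cop: "coprime (det B) p"
  shows "poly_red p (char_poly A) = poly_red p (char_poly C)"
proof -
  let ?B = "map_mat (\<lambda>a. [:a:]) B"
  let ?A = "char_poly_matrix A" and ?C = "char_poly_matrix C"
  have carr: "?B \<in> carrier_mat n n" "?A \<in> carrier_mat n n" "?C \<in> carrier_mat n n"
    using A B C by auto
  interpret h: comm_ring_hom "\<lambda>a :: int. [:a:]" by unfold_locales (auto simp: one_pCons)
  have detB: "det ?B = [:det B:]" by (rule h.hom_det)
  have "[:p:] dvd det (?A * ?B) - det (?B * ?C)"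
  proof (rule det_dvd_diff[of _ n])
    fix i j assume ij: "i < n" "j < n"
    have "(?A * ?B) $$ (i,j)
      = (\<Sum>r<n. ((if i = r then [:0,1:] else 0) - [:A $$ (i,r):]) * [:B $$ (r,j):])"
      using B ij by (auto simp: mat_mult_index_sum[OF carr(2,1)] char_poly_matrix_index[OF A]
          simp del: index_mult_mat intro!: sum.cong)
    also have "\<dots> = (\<Sum>r<n. (if i = r then [:0,1:] * [:B $$ (r,j):] else 0))
        - (\<Sum>r<n. [:A $$ (i,r):] * [:B $$ (r,j):])"
      unfolding left_diff_distrib sum_subtractf
      by (intro arg_cong2[of _ _ _ _ "(-)"] sum.cong) auto
    also have "(\<Sum>r<n. (if i = r then [:0,1:] * [:B $$ (r,j):] else 0)) = [:0,1:] * [:B $$ (i,j):]"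
      using ij by simp
    also have "(\<Sum>r<n. [:A $$ (i,r):] * [:B $$ (r,j):]) = [:(A * B) $$ (i,j):]"
      using ij by (simp add: mat_mult_index_sum[OF A B] h.hom_sum mult.commute del: index_mult_mat)
    finally have 1: "(?A * ?B) $$ (i,j) = [:0,1:] * [:B $$ (i,j):] - [:(A * B) $$ (i,j):]" .
    have "(?B * ?C) $$ (i,j)
      = (\<Sum>r<n. [:B $$ (i,r):] * ((if r = j then [:0,1:] else 0) - [:C $$ (r,j):]))"
      using B ij by (auto simp: mat_mult_index_sum[OF carr(1,3)] char_poly_matrix_index[OF C]
          simp del: index_mult_mat intro!: sum.cong)
    also have "\<dots> = (\<Sum>r<n. (if r = j then [:0,1:] * [:B $$ (i,r):] else 0))
        - (\<Sum>r<n. [:B $$ (i,r):] * [:C $$ (r,j):])"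
      unfolding right_diff_distrib sum_subtractf
      by (intro arg_cong2[of _ _ _ _ "(-)"] sum.cong) auto
    also have "(\<Sum>r<n. (if r = j then [:0,1:] * [:B $$ (i,r):] else 0)) = [:0,1:] * [:B $$ (i,j):]"
      using ij by simp
    also have "(\<Sum>r<n. [:B $$ (i,r):] * [:C $$ (r,j):]) = [:(B * C) $$ (i,j):]"
      using ij by (simp add: mat_mult_index_sum[OF B C] h.hom_sum mult.commute del: index_mult_mat)
    finally have 2: "(?B * ?C) $$ (i,j) = [:0,1:] * [:B $$ (i,j):] - [:(B * C) $$ (i,j):]" .
    have "p dvd (B * C) $$ (i,j) - (A * B) $$ (i,j)"
      using AB ij mat_mod_eq_iff[of "A * B" n n "B * C" p] A B C
      by (auto simp: cong_iff_dvd_diff dvd_diff_commute simp del: index_mult_mat)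
    then show "[:p:] dvd (?A * ?B) $$ (i,j) - (?B * ?C) $$ (i,j)"
      unfolding 1 2 by (simp add: const_poly_dvd del: index_mult_mat)
  qed (use carr in auto)
  then have "[:p:] dvd [:det B:] * (char_poly A - char_poly C)"
    unfolding char_poly_def
    by (simp only: det_mult[OF carr(2,1)] det_mult[OF carr(1,3)] detB algebra_simps)
  then have "p dvd det B * coeff (char_poly A - char_poly C) i" for i
    by (simp add: const_poly_dvd_iff)
  then have "p dvd coeff (char_poly A - char_poly C) i" for i
    using cop by (metis coprime_commute coprime_dvd_mult_right_iff)
  then show ?thesis unfolding poly_red_eq_iff const_poly_dvd_iff by blast
qed

subsection \<open>Equidistribution of random walks\<close>

text \<open>The letters permute the finite set, so averaging over the starting points gives exactly
  \<open>card X / card \<Omega>\<close> for every \<open>L\<close>. The spread between the best and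
  the worst starting point shrinks by a fixed factor every \<open>n\<close> steps, once words of one
  common length \<open>n\<close> join all pairs. Inverse letters pad a word by two letters at a
  time, hence the demand for even connecting words.\<close>

lemma equidistribution_even_connected:
  fixes act :: "'t \<Rightarrow> 'x \<Rightarrow> 'x"
  assumes T: "finite T" "T \<noteq> {}" and \<Omega>: "finite \<Omega>"
    and closed: "\<And>t x. t \<in> T \<Longrightarrow> x \<in> \<Omega> \<Longrightarrow> act t x \<in> \<Omega>"
    and inv: "\<And>t. t \<in> T \<Longrightarrow> \<exists>t'\<in>T. \<forall>x\<in>\<Omega>. act t' (act t x) = x"
    and conn: "\<And>x y. x \<in> \<Omega> \<Longrightarrow> y \<in> \<Omega> \<Longrightarrow> \<exists>ws. set ws \<subseteq> T \<and> even (length ws) \<and> foldr act ws x = y"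
    and X: "X \<subseteq> \<Omega>" and x0: "x0 \<in> \<Omega>"
  shows "(\<lambda>L. real (card {ws. set ws \<subseteq> T \<and> length ws = L \<and> foldr act ws x0 \<in> X}) / real (card T) ^ L)
    \<longlonglongrightarrow> real (card X) / real (card \<Omega>)"
proof -
  define W where "W = (\<lambda>n. {ws. set ws \<subseteq> T \<and> length ws = n})"
  define P where "P = (\<lambda>L x. real (card {ws \<in> W L. foldr act ws x \<in> X}) / real (card T) ^ L)"
  have finW: "finite (W n)" for n
    unfolding W_def using finite_lists_length_eq[OF T(1)] by auto
  have cardW: "card (W n) = card T ^ n" for n
    unfolding W_def using card_lists_length_eq[OF T(1)] by auto
  have cT: "card T > 0" using T by (simp add: card_gt_0_iff)
  have fold_closed: "foldr act ws x \<in> \<Omega>" if "set ws \<subseteq> T" "x \<in> \<Omega>" for ws x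
    using that by (induction ws) (auto intro: closed)
  have act_bij: "bij_betw (act t) \<Omega> \<Omega>" if "t \<in> T" for t
  proof -
    have "inj_on (act t) \<Omega>" using inv[OF that] by (metis inj_onI)
    moreover have "act t ` \<Omega> \<subseteq> \<Omega>" using closed that by auto
    ultimately show ?thesis by (simp add: bij_betw_def endo_inj_surj \<Omega>)
  qed
  have fold_bij: "bij_betw (foldr act ws) \<Omega> \<Omega>" if "set ws \<subseteq> T" for ws
    using that
  proof (induction ws)
    case (Cons t ws)
    then have "bij_betw (act t \<circ> foldr act ws) \<Omega> \<Omega>"
      by (intro bij_betw_trans[of _ _ \<Omega>] act_bij) auto
    then show ?case by (simp add: comp_def cong: bij_betw_cong)
  qed (auto simp: bij_betw_def)
  \<comment> \<open>A letter followed by one that undoes it lengthens the word by two and keeps the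
    endpoint.\<close>
  have pad: "\<exists>ws'\<in>W (n + 2 * i). foldr act ws' x = foldr act ws x" if "ws \<in> W n" "x \<in> \<Omega>" for ws n i x
  proof (induction i)
    case 0
    then show ?case using that by auto
  next
    case (Suc i)
    then obtain ws' where ws': "ws' \<in> W (n + 2 * i)" "foldr act ws' x = foldr act ws x" by blast
    obtain t where t: "t \<in> T" using T by blast
    obtain t' where t': "t' \<in> T" "\<forall>x\<in>\<Omega>. act t' (act t x) = x" using inv[OF t] by blast
    have "foldr act ws x \<in> \<Omega>" using fold_closed that by (auto simp: W_def)
    then have "foldr act (t' # t # ws') x = foldr act ws x" using ws' t' by simp
    moreover have "t' # t # ws' \<in> W (n + 2 * Suc i)" using ws' t t' by (auto simp: W_def)
    ultimately show ?case by blast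
  qed
  obtain n where n: "\<And>x y. x \<in> \<Omega> \<Longrightarrow> y \<in> \<Omega> \<Longrightarrow> \<exists>ws\<in>W n. foldr act ws x = y"
  proof -
    obtain l where l: "\<And>x y. x \<in> \<Omega> \<Longrightarrow> y \<in> \<Omega> \<Longrightarrow> set (l x y) \<subseteq> T \<and> even (length (l x y)) \<and> foldr act (l x y) x = y"
      using conn by metis
    \<comment> \<open>The sum over all pairs is even and bounds every single length, so each deficit
      is even and can be padded.\<close>
    define n where "n = (\<Sum>(x,y)\<in>\<Omega> \<times> \<Omega>. length (l x y))"
    have even_n: "even n" unfolding n_def using l by (intro dvd_sum) auto
    show ?thesis
    proof (rule that)
      fix x y assume xy: "x \<in> \<Omega>" "y \<in> \<Omega>"
      have le: "length (l x y) \<le> n" unfolding n_def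
        using xy \<Omega> member_le_sum[of "(x,y)" "\<Omega> \<times> \<Omega>" "\<lambda>(x,y). length (l x y)"] by auto
      have "even (n - length (l x y))" using even_n l[OF xy] by simp
      then obtain i where "n = length (l x y) + 2 * i" using le by (metis dvd_def le_add_diff_inverse)
      then show "\<exists>ws\<in>W n. foldr act ws x = y"
        using pad[of "l x y" "length (l x y)" x i] l[OF xy] xy by (auto simp: W_def)
    qed
  qed
  \<comment> \<open>In \<open>u @ v\<close> the block \<open>v\<close> acts first: the longer walk
    averages the shorter one over the points reached after \<open>k\<close> letters.\<close>
  have P_add: "P (L + k) x = (\<Sum>v\<in>W k. P L (foldr act v x)) / real (card T) ^ k" for L k x
  proof -
    have "bij_betw (\<lambda>(v,u). u @ v) (SIGMA v:W k. {u \<in> W L. foldr act u (foldr act v x) \<in> X})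
        {ws \<in> W (L + k). foldr act ws x \<in> X}"
      by (rule bij_betw_byWitness[where f' = "\<lambda>ws. (drop L ws, take L ws)"])
        (auto simp: W_def dest: in_set_takeD in_set_dropD simp flip: foldr_append)
    from bij_betw_same_card[OF this]
    have "card {ws \<in> W (L + k). foldr act ws x \<in> X}
        = (\<Sum>v\<in>W k. card {u \<in> W L. foldr act u (foldr act v x) \<in> X})"
      using finW by (subst (asm) card_SigmaI) auto
    then show ?thesis
      by (simp add: P_def power_add sum_divide_distrib)
  qed
  \<comment> \<open>Double counting: each word permutes \<open>\<Omega>\<close>, so it reaches
    \<open>X\<close> from exactly \<open>card X\<close> starting points.\<close>
  have P_total: "(\<Sum>x\<in>\<Omega>. P L x) = card X" for L
  proof -
    have "card {x \<in> \<Omega>. foldr act ws x \<in> X} = card X" if "ws \<in> W L" for ws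
    proof (rule bij_betw_same_card[of "foldr act ws"])
      have b: "bij_betw (foldr act ws) \<Omega> \<Omega>" using fold_bij that by (auto simp: W_def)
      have "foldr act ws ` {x \<in> \<Omega>. foldr act ws x \<in> X} = X"
        using b X unfolding bij_betw_def by (auto simp: image_iff)
      then show "bij_betw (foldr act ws) {x \<in> \<Omega>. foldr act ws x \<in> X} X"
        using b by (auto simp: bij_betw_def inj_on_def)
    qed
    then have "(\<Sum>ws\<in>W L. card {x \<in> \<Omega>. foldr act ws x \<in> X}) = card T ^ L * card X"
      using cardW by simp
    moreover have "(\<Sum>x\<in>\<Omega>. card {ws \<in> W L. foldr act ws x \<in> X})
        = (\<Sum>ws\<in>W L. card {x \<in> \<Omega>. foldr act ws x \<in> X})"
      by (rule sum_multicount_gen) (use finW \<Omega> in auto)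
    ultimately have "real (\<Sum>x\<in>\<Omega>. card {ws \<in> W L. foldr act ws x \<in> X}) = real (card T) ^ L * card X"
      by simp
    then show ?thesis using cT by (simp add: P_def flip: sum_divide_distrib)
  qed
  define hi where "hi = (\<lambda>L. Max (P L ` \<Omega>))"
  define lo where "lo = (\<lambda>L. Min (P L ` \<Omega>))"
  have hi: "P L x \<le> hi L" and lo: "lo L \<le> P L x" if "x \<in> \<Omega>" for L x
    using that \<Omega> by (auto simp: hi_def lo_def)
  have hi_ex: "\<exists>x\<in>\<Omega>. hi L = P L x" and lo_ex: "\<exists>x\<in>\<Omega>. lo L = P L x" for L
    using Max_in[of "P L ` \<Omega>"] Min_in[of "P L ` \<Omega>"] x0 \<Omega>
    by (auto simp: hi_def lo_def image_iff simp del: Max_in Min_in)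
  have P_lower: "lo L \<le> P (L + k) x" if "x \<in> \<Omega>" for L k x
  proof -
    have "real (card (W k)) * lo L \<le> (\<Sum>v\<in>W k. P L (foldr act v x))"
      by (rule sum_bounded_below) (use that fold_closed lo in \<open>auto simp: W_def\<close>)
    then show ?thesis using cT by (simp add: P_add cardW field_simps)
  qed
  have P_upper: "P (L + k) x \<le> hi L" if "x \<in> \<Omega>" for L k x
  proof -
    have "(\<Sum>v\<in>W k. P L (foldr act v x)) \<le> real (card (W k)) * hi L"
      by (rule sum_bounded_above) (use that fold_closed hi in \<open>auto simp: W_def\<close>)
    then show ?thesis using cT by (simp add: P_add cardW field_simps)
  qed
  define \<epsilon> where "\<epsilon> = 1 / real (card T) ^ n"
  have \<epsilon>: "\<epsilon> > 0" using cT by (simp add: \<epsilon>_def)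
  \<comment> \<open>Among the words of length \<open>n\<close> at least one leads to a point where
    the minimum is attained. It has weight \<open>\<epsilon>\<close> and pulls the average below the
    maximum.\<close>
  have P_strict: "P (L + n) x \<le> hi L - \<epsilon> * (hi L - lo L)" if x: "x \<in> \<Omega>" for L x
  proof -
    obtain y where y: "y \<in> \<Omega>" "lo L = P L y" using lo_ex by blast
    obtain w where w: "w \<in> W n" "foldr act w x = y" using n[OF x y(1)] by blast
    have "(\<Sum>v\<in>W n. P L (foldr act v x)) = P L y + (\<Sum>v\<in>W n - {w}. P L (foldr act v x))"
      using w finW by (subst sum.remove[of _ w]) auto
    also have "(\<Sum>v\<in>W n - {w}. P L (foldr act v x)) \<le> real (card (W n - {w})) * hi L"
      by (rule sum_bounded_above) (use that fold_closed hi in \<open>auto simp: W_def\<close>)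
    also have "real (card (W n - {w})) = real (card T) ^ n - 1"
      using w finW cT by (simp add: cardW of_nat_diff Suc_leI)
    finally show ?thesis using y cT by (simp add: P_add \<epsilon>_def field_simps)
  qed
  define osc where "osc = (\<lambda>L. hi L - lo L)"
  have osc_nonneg: "osc L \<ge> 0" for L using lo[OF x0, of L] hi[OF x0, of L] by (simp add: osc_def)
  have osc_contract: "osc (L + n) \<le> (1 - \<epsilon>) * osc L" for L
  proof -
    obtain x y where "x \<in> \<Omega>" "hi (L + n) = P (L + n) x" "y \<in> \<Omega>" "lo (L + n) = P (L + n) y"
      using hi_ex lo_ex by metis
    then show ?thesis using P_strict[of x L] P_lower[of y L n] by (simp add: osc_def algebra_simps)
  qed
  have "osc (L + 1) \<le> osc L" for L
  proof -
    obtain x y where "x \<in> \<Omega>" "hi (L + 1) = P (L + 1) x" "y \<in> \<Omega>" "lo (L + 1) = P (L + 1) y"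
      using hi_ex lo_ex by metis
    then show ?thesis using P_upper[of x L 1] P_lower[of y L 1] by (simp add: osc_def)
  qed
  then have "decseq osc" by (intro decseq_SucI) simp
  then obtain l where l: "osc \<longlonglongrightarrow> l" using decseq_convergent[of osc 0] osc_nonneg by metis
  have "l \<le> (1 - \<epsilon>) * l"
    by (rule LIMSEQ_le[OF LIMSEQ_ignore_initial_segment[OF l, of n] tendsto_mult[OF tendsto_const l]])
      (use osc_contract in auto)
  moreover have "l \<ge> 0" using LIMSEQ_le_const[OF l] osc_nonneg by blast
  ultimately have "l = 0" using \<epsilon> by (simp add: algebra_simps mult_le_0_iff)
  \<comment> \<open>The limit value is the mean of \<open>P L\<close> over all starting points, so
    it lies between \<open>lo L\<close> and \<open>hi L\<close>, as does
    \<open>P L x0\<close>.\<close>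
  have close: "\<bar>P L x0 - real (card X) / real (card \<Omega>)\<bar> \<le> osc L" for L
  proof -
    have c\<Omega>: "real (card \<Omega>) > 0" using x0 \<Omega> by (auto simp: card_gt_0_iff)
    have "real (card \<Omega>) * lo L \<le> (\<Sum>x\<in>\<Omega>. P L x)" "(\<Sum>x\<in>\<Omega>. P L x) \<le> real (card \<Omega>) * hi L"
      by (auto intro!: sum_bounded_below sum_bounded_above hi lo)
    then have "lo L \<le> real (card X) / real (card \<Omega>)" "real (card X) / real (card \<Omega>) \<le> hi L"
      using c\<Omega> by (auto simp: P_total field_simps)
    then show ?thesis using hi[OF x0, of L] lo[OF x0, of L] by (auto simp: osc_def)
  qed
  have "(\<lambda>L. P L x0 - real (card X) / real (card \<Omega>)) \<longlonglongrightarrow> 0"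
    by (rule tendsto_0_le[OF l[unfolded \<open>l = 0\<close>], where K = 1]) (use close osc_nonneg in auto)
  then have "(\<lambda>L. P L x0) \<longlonglongrightarrow> real (card X) / real (card \<Omega>)"
    by (simp add: LIM_zero_iff)
  moreover have "P L x0 = real (card {ws. set ws \<subseteq> T \<and> length ws = L \<and> foldr act ws x0 \<in> X}) / real (card T) ^ L" for L
    unfolding P_def W_def by (simp add: conj_assoc)
  ultimately show ?thesis by simp
qed

subsection \<open>Elementary reduction modulo a square-free integer\<close>

text \<open>Without swaps and scalings each step is multiplication by an elementary matrix of
  determinant 1. Entries come from any commutative ring: integers here, polynomials for the
  companion matrix.\<close>

inductive row_equiv :: "'a :: comm_ring_1 mat \<Rightarrow> 'a mat \<Rightarrow> bool" where
  row_equiv_refl: "row_equiv A A"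
| row_equiv_addrow: "row_equiv A B \<Longrightarrow> k \<noteq> l \<Longrightarrow> k < dim_row B \<Longrightarrow> l < dim_row B \<Longrightarrow> row_equiv A (addrow a k l B)"

lemma row_equiv_trans: "row_equiv A B \<Longrightarrow> row_equiv B C \<Longrightarrow> row_equiv A C"
  by (rotate_tac, induction rule: row_equiv.induct) (auto intro: row_equiv_addrow)

lemma row_equiv_det:
  assumes "row_equiv A B" "A \<in> carrier_mat n n"
  shows "B \<in> carrier_mat n n" "det B = det A"
  using assms by (induction rule: row_equiv.induct) (auto simp: det_addrow)

lemma row_equiv_add_rows:
  assumes A: "A \<in> carrier_mat n n" and r: "r < n" and K: "K \<subseteq> {..<n} - {r}"
  shows "row_equiv A (mat n n (\<lambda>(i,j). if i = r then A $$ (r,j) + (\<Sum>k\<in>K. c k * A $$ (k,j)) else A $$ (i,j)))"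
proof -
  have "finite K" using K finite_subset by blast
  then show ?thesis using K
  proof (induction K)
    case empty
    have "mat n n (\<lambda>(i,j). if i = r then A $$ (r,j) + (\<Sum>k\<in>{}. c k * A $$ (k,j)) else A $$ (i,j)) = A"
      using A by (intro eq_matI) auto
    then show ?case by (simp add: row_equiv_refl)
  next
    case (insert k K)
    let ?M = "\<lambda>K. mat n n (\<lambda>(i,j). if i = r then A $$ (r,j) + (\<Sum>k\<in>K. c k * A $$ (k,j)) else A $$ (i,j))"
    have "addrow (c k) r k (?M K) = ?M (insert k K)"
      using insert A r by (intro eq_matI) auto
    moreover have "row_equiv A (addrow (c k) r k (?M K))"
      using insert r by (intro row_equiv_addrow) auto
    ultimately show ?case by simp
  qed
qed

lemma row_equiv_add_to_rows:
  assumes A: "A \<in> carrier_mat n n" and s: "s < n" and K: "K \<subseteq> {..<n} - {s}"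
  shows "row_equiv A (mat n n (\<lambda>(i,j). if i \<in> K then A $$ (i,j) + c i * A $$ (s,j) else A $$ (i,j)))"
proof -
  have "finite K" using K finite_subset by blast
  then show ?thesis using K
  proof (induction K)
    case empty
    have "mat n n (\<lambda>(i,j). if i \<in> {} then A $$ (i,j) + c i * A $$ (s,j) else A $$ (i,j)) = A"
      using A by (intro eq_matI) auto
    then show ?case by (simp add: row_equiv_refl)
  next
    case (insert k K)
    let ?M = "\<lambda>K. mat n n (\<lambda>(i,j). if i \<in> K then A $$ (i,j) + c i * A $$ (s,j) else A $$ (i,j))"
    have "addrow (c k) k s (?M K) = ?M (insert k K)"
      using insert A s by (intro eq_matI) auto
    moreover have "row_equiv A (addrow (c k) k s (?M K))"
      using insert s by (intro row_equiv_addrow) auto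
    ultimately show ?case by simp
  qed
qed

text \<open>The ring of integers modulo \<^term>\<open>m\<close> has stable rank one.\<close>

lemma exists_unit_combination:
  fixes a y c m :: int
  assumes m: "squarefree m" and yc: "[y + c * a = 1] (mod m)"
  shows "\<exists>x. coprime (a + x * y) m"
proof (rule exI, rule ccontr)
  \<comment> \<open>For square-free \<open>m\<close> this is the part of \<open>m\<close> prime to
    \<open>a\<close>. A prime divisor of \<open>m\<close> therefore divides exactly one of
    \<open>a\<close> and \<open>?x\<close>, and if it divides \<open>a\<close> it cannot divide
    \<open>y\<close>; so it never divides \<open>a + ?x * y\<close>.\<close>
  let ?x = "m div gcd m a"
  have m0: "m \<noteq> 0" using m by (metis not_squarefree_0)
  assume "\<not> coprime (a + ?x * y) m"
  then have "\<not> is_unit (gcd (a + ?x * y) m)" "gcd (a + ?x * y) m \<noteq> 0"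
    using m0 by (metis is_unit_gcd, metis gcd_eq_0_iff)
  then obtain q where q: "prime q" "q dvd a + ?x * y" "q dvd m"
    using prime_divisor_exists[of "gcd (a + ?x * y) m"] by (metis gcd_greatest_iff)
  have mx: "m = ?x * gcd m a" by simp
  show False
  proof (cases "q dvd a")
    case True
    then have "q dvd gcd m a" using q by simp
    have "\<not> q dvd y"
    proof
      assume "q dvd y"
      then have "q dvd y + c * a" using True by simp
      moreover have "q dvd y + c * a - 1" using yc q(3) by (meson cong_iff_dvd_diff dvd_trans)
      ultimately have "q dvd (y + c * a) - (y + c * a - 1)" by (rule dvd_diff)
      then have "q dvd 1" by simp
      then show False using q by (simp add: not_prime_unit)
    qed
    moreover have "q dvd ?x * y" using q(2) True by (simp add: dvd_add_right_iff)
    ultimately have "q dvd ?x" using q(1) prime_dvd_mult_iff by blast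
    then have "q * q dvd m" using \<open>q dvd gcd m a\<close> mx by (metis mult_dvd_mono)
    then show False using m q(1) by (metis power2_eq_square squarefreeD not_prime_unit)
  next
    case False
    then have "\<not> q dvd gcd m a" by simp
    then have "q dvd ?x" using mx q by (metis prime_dvd_mult_iff)
    then show False using q(2) False by (simp add: dvd_add_left_iff)
  qed
qed

text \<open>Columns are turned into unit vectors from left to right. Stable rank one makes an entry
  below the diagonal invertible, through which the diagonal entry becomes 1; this entry then clears
  its column. In the last column no row remains below, and the determinant forces the entry.\<close>

lemma row_equiv_one_mod:
  assumes N: "N \<ge> 2" and m: "squarefree (m :: int)"
    and A: "A \<in> carrier_mat N N" and det: "[det A = 1] (mod m)"
  shows "\<exists>B. row_equiv A B \<and> mat_mod m B = mat_mod m (1\<^sub>m N)"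
proof -
  let ?\<delta> = "\<lambda>i k. if i = k then 1 else 0 :: int"
  have "\<exists>B. row_equiv A B \<and> (\<forall>i<N. \<forall>k<j. [B $$ (i,k) = ?\<delta> i k] (mod m))" if "j \<le> N" for j
    using that
  proof (induction j)
    case 0
    then show ?case using row_equiv_refl by auto
  next
    case (Suc j)
    then obtain B where B: "row_equiv A B" "\<And>i k. i < N \<Longrightarrow> k < j \<Longrightarrow> [B $$ (i,k) = ?\<delta> i k] (mod m)"
      by auto
    have j: "j < N" using Suc by simp
    have Bc: "B \<in> carrier_mat N N" and detB: "[det B = 1] (mod m)"
      using row_equiv_det[OF B(1) A] det by auto
    have B0: "[B $$ (i,k) = 0] (mod m)" if "i < N" "k < j" "i \<noteq> k" for i k
      using B(2)[OF that(1,2)] that by simp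
    have "\<exists>C. row_equiv B C \<and> (\<forall>i<N. \<forall>k<j. [C $$ (i,k) = ?\<delta> i k] (mod m)) \<and> [C $$ (j,j) = 1] (mod m)"
    proof (cases "Suc j < N")
      case False
      \<comment> \<open>Modulo \<open>m\<close> the matrix is already upper triangular with ones on
        the diagonal except at the last place, so that entry is the determinant.\<close>
      then have Nj: "N = Suc j" using j by simp
      have "mat_mod m B $$ (i,k) = 0" if "k < i" "i < N" for i k
        using B0[of i k] that Bc Nj by (simp add: cong_def)
      then have "upper_triangular (mat_mod m B)" using Bc by (auto intro!: upper_triangularI)
      then have "det (mat_mod m B) = (\<Prod>i<N. B $$ (i,i) mod m)"
        using Bc by (subst det_upper_triangular[of _ N])
          (auto simp: prod_list_diag_prod atLeast0LessThan intro!: prod.cong)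
      also have "[\<dots> = (\<Prod>i<N. if i = j then B $$ (j,j) else 1)] (mod m)"
      proof (rule cong_prod)
        fix i assume "i \<in> {..<N}"
        then show "[B $$ (i,i) mod m = (if i = j then B $$ (j,j) else 1)] (mod m)"
          using B(2)[of i i] Nj by (auto simp: less_Suc_eq)
      qed
      also have "(\<Prod>i<N. if i = j then B $$ (j,j) else 1) = B $$ (j,j)" using j by simp
      finally have "[B $$ (j,j) = det (mat_mod m B)] (mod m)" by (rule cong_sym)
      also have "[det (mat_mod m B) = det B] (mod m)" using Bc by (intro det_mod_cong[of _ N]) auto
      also have "[det B = 1] (mod m)" by fact
      finally show ?thesis using B(2) row_equiv_refl by blast
    next
      case True
      \<comment> \<open>Row \<open>r\<close> needs only a unit in column \<open>j\<close>; row
        \<open>j\<close> then gets the exact value 1 from it. The coefficients \<open>c\<close> are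
        a row of the adjugate: they pair with column \<open>j\<close> to the determinant and with
        other columns to 0. As the earlier columns are unit vectors, \<open>c\<close> vanishes at
        the finished rows, so these are not disturbed.\<close>
      define r where "r = Suc j"
      define c where "c = (\<lambda>k. adj_mat B $$ (j,k))"
      define a where "a = (\<lambda>k. B $$ (k,j))"
      have adj: "(\<Sum>k<N. c k * B $$ (k,i)) = (if i = j then det B else 0)" if "i < N" for i
        using arg_cong[OF adj_mat(3)[OF Bc], of "\<lambda>M. M $$ (j,i)"] that j
        by (simp add: mat_mult_index_sum[OF adj_mat(1)[OF Bc] Bc] c_def del: index_mult_mat)
      have c0: "[c i = 0] (mod m)" if "i < j" for i
      proof -
        have "[(\<Sum>k<N. c k * B $$ (k,i)) = (\<Sum>k<N. c k * ?\<delta> k i)] (mod m)"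
          using that by (intro cong_sum cong_mult B(2)) auto
        moreover have "(\<Sum>k<N. c k * ?\<delta> k i) = c i"
          using that j by (simp add: if_distrib[of "\<lambda>t. _ * t"] cong: if_cong)
        ultimately show ?thesis using adj[of i] that j by (simp add: cong_sym_eq)
      qed
      define K where "K = {j..<N} - {r}"
      define y where "y = (\<Sum>k\<in>K. c k * a k)"
      have rN: "r < N" using True r_def by simp
      have "[det B = (\<Sum>k<N. c k * a k)] (mod m)" using adj[OF j] by (simp add: a_def)
      also have "(\<Sum>k<N. c k * a k) = (\<Sum>k<j. c k * a k) + (\<Sum>k\<in>{j..<N}. c k * a k)"
        using j by (subst sum.union_disjoint[symmetric]) (auto intro!: sum.cong)
      also have "(\<Sum>k\<in>{j..<N}. c k * a k) = c r * a r + y"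
        unfolding y_def K_def using rN r_def by (subst sum.remove[of _ r]) auto
      also have "[(\<Sum>k<j. c k * a k) + (c r * a r + y) = (\<Sum>k<j. 0 * a k) + (c r * a r + y)] (mod m)"
        by (intro cong_add cong_sum cong_mult cong_refl c0) auto
      finally have "[y + c r * a r = 1] (mod m)" using detB by (simp add: add.commute) (metis cong_sym cong_trans)
      then obtain x where x: "coprime (a r + x * y) m" using exists_unit_combination[OF m] by blast
      then obtain v where v: "[(a r + x * y) * v = 1] (mod m)" using cong_solve_coprime_int by blast
      define B1 where "B1 = mat N N (\<lambda>(i,q). if i = r then B $$ (r,q) + (\<Sum>k\<in>K. (x * c k) * B $$ (k,q)) else B $$ (i,q))"
      \<comment> \<open>\<open>v\<close> inverts the new entry of row \<open>r\<close> in column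
        \<open>j\<close>, so this multiple adds \<open>1 - a j\<close> to the diagonal entry
        \<open>a j\<close>.\<close>
      define C where "C = addrow ((1 - a j) * v) j r B1"
      have "row_equiv B B1" unfolding B1_def
        by (rule row_equiv_add_rows[OF Bc rN]) (auto simp: K_def)
      then have "row_equiv B C" unfolding C_def
        by (intro row_equiv_addrow) (use rN j r_def in \<open>auto simp: B1_def\<close>)
      moreover have B1: "[B1 $$ (i,q) = ?\<delta> i q] (mod m)" if "i < N" "q < j" for i q
      proof (cases "i = r")
        case True
        have "[B $$ (r,q) + (\<Sum>k\<in>K. (x * c k) * B $$ (k,q)) = 0 + (\<Sum>k\<in>K. (x * c k) * 0)] (mod m)"
          using that rN r_def by (intro cong_add cong_sum cong_mult cong_refl B0) (auto simp: K_def)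
        then show ?thesis using True that rN r_def j by (simp add: B1_def)
      next
        case False
        then show ?thesis using that B(2) j by (simp add: B1_def)
      qed
      have "[C $$ (i,q) = ?\<delta> i q] (mod m)" if "i < N" "q < j" for i q
      proof (cases "i = j")
        case True
        have "[(1 - a j) * v * B1 $$ (r,q) + B1 $$ (j,q) = (1 - a j) * v * 0 + 0] (mod m)"
          using that B1[of r q] B1[of j q] rN r_def j by (intro cong_add cong_mult cong_refl) auto
        then show ?thesis using True that j by (simp add: C_def B1_def)
      next
        case False
        then have "C $$ (i,q) = B1 $$ (i,q)" using that j by (simp add: C_def B1_def)
        then show ?thesis using B1[OF that] by simp
      qed
      moreover have "[C $$ (j,j) = 1] (mod m)"
      proof -
        have "B1 $$ (r,j) = a r + x * y"
          using rN j by (simp add: B1_def a_def y_def sum_distrib_left mult.assoc)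
        moreover have "B1 $$ (j,j) = a j" using j r_def by (simp add: B1_def a_def)
        moreover have "C $$ (j,j) = (1 - a j) * v * B1 $$ (r,j) + B1 $$ (j,j)"
          using j by (simp add: C_def B1_def)
        ultimately have "C $$ (j,j) = (1 - a j) * ((a r + x * y) * v) + a j" by (simp add: mult_ac)
        also have "[\<dots> = (1 - a j) * 1 + a j] (mod m)" using v by (intro cong_add cong_mult cong_refl)
        finally show ?thesis by simp
      qed
      ultimately show ?thesis by blast
    qed
    then obtain C where C: "row_equiv B C" "\<And>i k. i < N \<Longrightarrow> k < j \<Longrightarrow> [C $$ (i,k) = ?\<delta> i k] (mod m)"
      "[C $$ (j,j) = 1] (mod m)" by blast
    have Cc: "C \<in> carrier_mat N N" using row_equiv_det[OF C(1) Bc] by simp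
    define D where "D = mat N N (\<lambda>(i,q). if i \<in> {..<N} - {j} then C $$ (i,q) + (- C $$ (i,j)) * C $$ (j,q) else C $$ (i,q))"
    have "row_equiv C D" unfolding D_def by (rule row_equiv_add_to_rows[OF Cc j]) auto
    then have "row_equiv A D" using B(1) C(1) row_equiv_trans by blast
    moreover have "[D $$ (i,q) = ?\<delta> i q] (mod m)" if "i < N" "q < Suc j" for i q
    proof (cases "i = j")
      case True
      then show ?thesis using that C(2)[of j q] C(3) j by (auto simp: D_def less_Suc_eq)
    next
      case False
      then have D: "D $$ (i,q) = C $$ (i,q) + (- C $$ (i,j)) * C $$ (j,q)"
        using that j by (simp add: D_def)
      show ?thesis
      proof (cases "q = j")
        case True
        have "[C $$ (i,j) + (- C $$ (i,j)) * C $$ (j,j) = C $$ (i,j) + (- C $$ (i,j)) * 1] (mod m)"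
          by (intro cong_add cong_mult cong_refl C(3))
        then have "[D $$ (i,q) = C $$ (i,j) + (- C $$ (i,j)) * 1] (mod m)" using D True by simp
        then show ?thesis using False True by simp
      next
        case qj: False
        then have "[D $$ (i,q) = ?\<delta> i q + (- C $$ (i,j)) * 0] (mod m)"
          unfolding D using C(2)[of i q] C(2)[of j q] that j by (intro cong_add cong_mult cong_refl) auto
        then show ?thesis by simp
      qed
    qed
    ultimately show ?case by blast
  qed
  from this[of N] obtain B where B: "row_equiv A B" "\<And>i k. i < N \<Longrightarrow> k < N \<Longrightarrow> [B $$ (i,k) = ?\<delta> i k] (mod m)"
    by auto
  have "mat_mod m B = mat_mod m (1\<^sub>m N)"
    using row_equiv_det[OF B(1) A] B(2) by (subst mat_mod_eq_iff[of _ N N]) auto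
  then show ?thesis using B(1) by blast
qed

subsection \<open>Words in the generators modulo an integer\<close>

lemma word_prod_Nil [simp]: "word_prod N [] = 1\<^sub>m N"
  and word_prod_Cons [simp]: "word_prod N (A # ws) = A * word_prod N ws"
  by (simp_all add: word_prod_def)

lemma SL_int_one [simp]: "1\<^sub>m N \<in> SL_int N"
  by (simp add: SL_int_def)

lemma SL_int_mult [simp]: "A \<in> SL_int N \<Longrightarrow> B \<in> SL_int N \<Longrightarrow> A * B \<in> SL_int N"
  by (auto simp: SL_int_def det_mult)

lemma word_prod_SL: "set ws \<subseteq> SL_int N \<Longrightarrow> word_prod N ws \<in> SL_int N"
  by (induction ws) auto

lemma SL_int_carrier: "A \<in> SL_int N \<Longrightarrow> A \<in> carrier_mat N N"
  by (simp add: SL_int_def)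

lemma word_prod_append:
  "set us \<subseteq> SL_int N \<Longrightarrow> set vs \<subseteq> SL_int N \<Longrightarrow> word_prod N (us @ vs) = word_prod N us * word_prod N vs"
proof (induction us)
  case Nil
  then show ?case using word_prod_SL[of vs N] by (auto simp: SL_int_def)
next
  case (Cons A us)
  then show ?case
    using word_prod_SL[of vs N] word_prod_SL[of us N]
    by (auto simp: SL_int_def intro!: assoc_mult_mat[symmetric])
qed

lemma gen_letters_SL:
  assumes "S \<subseteq> SL_int N"
  shows "gen_letters N S \<subseteq> SL_int N"
proof
  fix B assume "B \<in> gen_letters N S"
  moreover have "det B = 1" if "B \<in> carrier_mat N N" "A \<in> S" "A * B = 1\<^sub>m N" for A
    using that assms det_mult[of A N B] by (auto simp: SL_int_def)
  ultimately show "B \<in> SL_int N" using assms by (auto simp: gen_letters_def SL_int_def)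
qed

lemma SL_int_inverse:
  assumes "A \<in> SL_int N"
  shows "\<exists>B\<in>SL_int N. A * B = 1\<^sub>m N \<and> B * A = 1\<^sub>m N"
proof -
  have A: "A \<in> carrier_mat N N" and d: "det A = 1" using assms by (auto simp: SL_int_def)
  have "A * adj_mat A = 1\<^sub>m N" "adj_mat A * A = 1\<^sub>m N"
    using adj_mat[OF A] d by auto
  moreover have "det (adj_mat A) = 1"
    using det_mult[OF A adj_mat(1)[OF A]] d adj_mat[OF A] by simp
  ultimately show ?thesis using adj_mat(1)[OF A] by (auto simp: SL_int_def)
qed

lemma gen_letters_inverse:
  assumes S: "S \<subseteq> SL_int N" and A: "A \<in> gen_letters N S"
  shows "\<exists>B\<in>gen_letters N S. B * A = 1\<^sub>m N"
proof (cases "A \<in> S")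
  case True
  then obtain B where "B \<in> SL_int N" "A * B = 1\<^sub>m N" "B * A = 1\<^sub>m N"
    using SL_int_inverse S by blast
  then show ?thesis using True by (auto simp: gen_letters_def SL_int_def)
next
  case False
  then show ?thesis using A by (auto simp: gen_letters_def)
qed

lemma finite_gen_letters:
  assumes "finite S" "S \<subseteq> SL_int N"
  shows "finite (gen_letters N S)"
proof -
  have "{B \<in> carrier_mat N N. \<exists>A\<in>S. A * B = 1\<^sub>m N \<and> B * A = 1\<^sub>m N} \<subseteq> adj_mat ` S"
  proof
    fix B assume "B \<in> {B \<in> carrier_mat N N. \<exists>A\<in>S. A * B = 1\<^sub>m N \<and> B * A = 1\<^sub>m N}"
    then obtain A where B: "B \<in> carrier_mat N N" and A: "A \<in> S" "A * B = 1\<^sub>m N" by auto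
    have Ac: "A \<in> carrier_mat N N" and d: "det A = 1" using A assms by (auto simp: SL_int_def)
    have "adj_mat A = adj_mat A * (A * B)" using A adj_mat[OF Ac] by simp
    also have "\<dots> = (adj_mat A * A) * B" using adj_mat(1)[OF Ac] Ac B by (simp add: assoc_mult_mat)
    also have "adj_mat A * A = 1\<^sub>m N" using adj_mat(3)[OF Ac] d by (intro eq_matI) auto
    also have "1\<^sub>m N * B = B" using B by simp
    finally show "B \<in> adj_mat ` S" using A by blast
  qed
  then show ?thesis using assms unfolding gen_letters_def by (meson finite_UnI finite_imageI finite_subset)
qed

lemma gen_letters_nonempty:
  assumes N: "N \<ge> 2" and "generates_SL N S"
  shows "gen_letters N S \<noteq> {}"
proof
  assume "gen_letters N S = {}"
  then have "SL_int N = {1\<^sub>m N}" using assms(2) by (auto simp: generates_SL_def)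
  moreover have "addrow_mat N 1 0 1 \<in> SL_int N" using N by (auto simp: SL_int_def det_addrow_mat)
  ultimately have "addrow_mat N (1 :: int) 0 1 $$ (0, 1) = 1\<^sub>m N $$ (0,1)" by simp
  then show False using N by simp
qed

text \<open>A word for an elementary matrix with half the entry, written twice, has even length and
  represents the wanted elementary matrix modulo the odd \<open>m\<close>. Elementary matrices
  suffice by \<open>row_equiv_one_mod\<close>.\<close>

lemma even_word_mod:
  assumes N: "N \<ge> 2" and gen: "generates_SL N S" and m: "squarefree m" "odd m"
    and A: "A \<in> carrier_mat N N" "[det A = 1] (mod m)"
  shows "\<exists>ws. set ws \<subseteq> gen_letters N S \<and> even (length ws) \<and> mat_mod m (word_prod N ws) = mat_mod m A"
proof -
  define rep where "rep = (\<lambda>B. \<exists>ws. set ws \<subseteq> gen_letters N S \<and> even (length ws) \<and> mat_mod m (word_prod N ws) = mat_mod m B)"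
  have S: "S \<subseteq> SL_int N" and SL: "SL_int N = word_prod N ` {ws. set ws \<subseteq> gen_letters N S}"
    using gen by (auto simp: generates_SL_def)
  note T = gen_letters_SL[OF S]
  have rep_mult: "rep (B * C)" if "rep B" "rep C" "B \<in> carrier_mat N N" "C \<in> carrier_mat N N" for B C
  proof -
    from that obtain us vs where
      "set us \<subseteq> gen_letters N S" "even (length us)" "mat_mod m (word_prod N us) = mat_mod m B"
      "set vs \<subseteq> gen_letters N S" "even (length vs)" "mat_mod m (word_prod N vs) = mat_mod m C"
      unfolding rep_def by blast
    moreover have "mat_mod m (word_prod N us * word_prod N vs) = mat_mod m (B * C)"
      using calculation that T by (intro mat_mod_mult_cong[of _ N N _ _ N]) (auto intro!: SL_int_carrier word_prod_SL)
    ultimately show ?thesis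
      unfolding rep_def using T by (intro exI[of _ "us @ vs"]) (auto simp: word_prod_append)
  qed
  have rep_addrow: "rep (addrow_mat N t k l)" if kl: "k \<noteq> l" "k < N" "l < N" for t k l
  proof -
    define s where "s = (if even t then t div 2 else (t + m) div 2)"
    have s: "[2 * s = t] (mod m)" using m by (auto simp: s_def cong_iff_dvd_diff)
    have "addrow_mat N s k l \<in> SL_int N" using kl by (auto simp: SL_int_def det_addrow_mat)
    then obtain us where us: "set us \<subseteq> gen_letters N S" "word_prod N us = addrow_mat N s k l"
      using SL by (metis (no_types, lifting) imageE mem_Collect_eq)
    have "word_prod N (us @ us) = addrow_mat N s k l * addrow_mat N s k l"
      using us T by (subst word_prod_append) auto
    also have "\<dots> = addrow s k l (addrow_mat N s k l)" using kl by (subst addrow_mat[of _ N N]) auto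
    also have "mat_mod m \<dots> = mat_mod m (addrow_mat N t k l)"
    proof (subst mat_mod_eq_iff[of _ N N])
      have "[s + s = t] (mod m)" using s by (simp only: mult_2)
      then show "\<forall>i<N. \<forall>j<N. [addrow s k l (addrow_mat N s k l) $$ (i,j) = addrow_mat N t k l $$ (i,j)] (mod m)"
        using kl by simp
    qed auto
    finally show ?thesis unfolding rep_def using us by (intro exI[of _ "us @ us"]) auto
  qed
  obtain B where B: "row_equiv A B" "mat_mod m B = mat_mod m (1\<^sub>m N)"
    using row_equiv_one_mod[OF N m(1) A] by blast
  have "rep B" unfolding rep_def using B(2) by (intro exI[of _ "[]"]) auto
  \<comment> \<open>The row operations from \<open>A\<close> to \<open>B\<close> are undone from the
    last to the first, each by adding the opposite multiple.\<close>
  with B(1) have "A \<in> carrier_mat N N \<longrightarrow> rep A"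
  proof (induction rule: row_equiv.induct)
    case (row_equiv_addrow A B k l a)
    show ?case
    proof
      assume A: "A \<in> carrier_mat N N"
      then have B: "B \<in> carrier_mat N N" using row_equiv_det[OF row_equiv_addrow.hyps(1)] by simp
      have "addrow (- a) k l (addrow a k l B) = B"
        using row_equiv_addrow.hyps by (intro eq_matI) auto
      moreover have "addrow (- a) k l (addrow a k l B) = addrow_mat N (- a) k l * addrow a k l B"
        using row_equiv_addrow.hyps B by (intro addrow_mat[of _ N N]) auto
      moreover have "rep (addrow_mat N (- a) k l * addrow a k l B)"
        using row_equiv_addrow.hyps row_equiv_addrow.prems B by (intro rep_mult rep_addrow) auto
      ultimately show "rep A" using row_equiv_addrow.IH A by simp
    qed
  qed auto
  then show ?thesis using A unfolding rep_def by blast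
qed

section \<open>The random walk on the special linear group modulo \<open>m\<close>\<close>

lemma finite_mat_mod_range: "m > 0 \<Longrightarrow> finite {A \<in> carrier_mat N k. mat_mod m A = A}"
proof -
  assume m: "m > 0"
  let ?R = "{..<N} \<times> {..<k}"
  have "{A \<in> carrier_mat N k. mat_mod m A = A} \<subseteq> (\<lambda>f. mat N k f) ` (?R \<rightarrow>\<^sub>E {0..<m})"
  proof
    fix A assume "A \<in> {A \<in> carrier_mat N k. mat_mod m A = A}"
    then have A: "A \<in> carrier_mat N k" "mat_mod m A = A" by auto
    have "A $$ (i,j) \<in> {0..<m}" if "i < N" "j < k" for i j
      using arg_cong[OF A(2), of "\<lambda>M. M $$ (i,j)"] that A(1) m
      by (simp) (metis pos_mod_bound pos_mod_sign)
    then have "restrict (\<lambda>(i,j). A $$ (i,j)) ?R \<in> ?R \<rightarrow>\<^sub>E {0..<m}" by auto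
    moreover have "A = mat N k (restrict (\<lambda>(i,j). A $$ (i,j)) ?R)" using A by (intro eq_matI) auto
    ultimately show "A \<in> (\<lambda>f. mat N k f) ` (?R \<rightarrow>\<^sub>E {0..<m})" by blast
  qed
  moreover have "finite ((\<lambda>f. mat N k f) ` (?R \<rightarrow>\<^sub>E {0..<m}))" by (intro finite_imageI finite_PiE) auto
  ultimately show ?thesis by (rule finite_subset)
qed

lemma finite_SL_mod: "m > 0 \<Longrightarrow> finite (SL_mod N m)"
  by (rule finite_subset[OF _ finite_mat_mod_range[of m N N]]) (auto simp: SL_mod_def)

lemma SL_mod_red:
  assumes "A \<in> carrier_mat N N" "[det A = 1] (mod m)"
  shows "mat_mod m A \<in> SL_mod N m"
  using assms det_mod_cong[of "mat_mod m A" N A m] by (auto simp: SL_mod_def intro: cong_trans)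

lemma random_word_equidistribution:
  assumes N: "N \<ge> 2" and S: "finite S" "generates_SL N S"
    and m: "m > 0" "squarefree m" "odd m" and X: "X \<subseteq> SL_mod N m"
  shows "(\<lambda>L. real (card {ws \<in> words (gen_letters N S) L. mat_mod m (word_prod N ws) \<in> X})
     / real (card (words (gen_letters N S) L))) \<longlonglongrightarrow> real (card X) / real (card (SL_mod N m))"
proof -
  let ?T = "gen_letters N S"
  have SSL: "S \<subseteq> SL_int N" and SL: "SL_int N = word_prod N ` {ws. set ws \<subseteq> ?T}"
    using S by (auto simp: generates_SL_def)
  note T = gen_letters_SL[OF SSL]
  have finT: "finite ?T" by (rule finite_gen_letters) (use S SSL in auto)
  define act where "act = (\<lambda>t x. mat_mod m (t * x))"
  have act_eq: "foldr act ws (mat_mod m x) = mat_mod m (word_prod N ws * x)"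
    if "set ws \<subseteq> ?T" "x \<in> carrier_mat N N" for ws x
    using that
  proof (induction ws)
    case (Cons t ws)
    have "t \<in> carrier_mat N N" "word_prod N ws \<in> carrier_mat N N"
      using Cons.prems T by (auto intro!: SL_int_carrier word_prod_SL)
    then show ?case using Cons
      by (simp add: act_def mat_mod_mult_right[of t N N _ N] assoc_mult_mat[of t N N _ N _ N])
  qed auto
  have det_cong: "[det (A * B) = 1] (mod m)"
    if "A \<in> carrier_mat N N" "B \<in> carrier_mat N N" "[det A = 1] (mod m)" "[det B = 1] (mod m)" for A B
    using cong_mult[OF that(3,4)] that by (simp add: det_mult)
  have Tne: "?T \<noteq> {}" by (rule gen_letters_nonempty[OF N S(2)])
  have "(\<lambda>L. real (card {ws. set ws \<subseteq> ?T \<and> length ws = L \<and> foldr act ws (mat_mod m (1\<^sub>m N)) \<in> X})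
      / real (card ?T) ^ L) \<longlonglongrightarrow> real (card X) / real (card (SL_mod N m))"
  proof (rule equidistribution_even_connected)
    show "finite (SL_mod N m)" using finite_SL_mod m by blast
    show "mat_mod m (1\<^sub>m N) \<in> SL_mod N m" by (rule SL_mod_red) auto
  next
    fix t x assume "t \<in> ?T" "x \<in> SL_mod N m"
    then show "act t x \<in> SL_mod N m"
      using T unfolding act_def by (intro SL_mod_red det_cong) (auto simp: SL_mod_def SL_int_def)
  next
    fix t assume t: "t \<in> ?T"
    then obtain u where u: "u \<in> ?T" "u * t = 1\<^sub>m N" using gen_letters_inverse[OF SSL] by blast
    have c: "t \<in> carrier_mat N N" "u \<in> carrier_mat N N" using t u T by (auto simp: SL_int_def)
    have "act u (act t x) = x" if x: "x \<in> SL_mod N m" for x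
    proof -
      have xc: "x \<in> carrier_mat N N" "mat_mod m x = x" using x by (auto simp: SL_mod_def)
      then have "act u (act t x) = mat_mod m ((u * t) * x)"
        using c by (simp add: act_def mat_mod_mult_right[of u N N _ N] assoc_mult_mat[of u N N _ N _ N])
      then show ?thesis using u xc by simp
    qed
    then show "\<exists>u\<in>?T. \<forall>x\<in>SL_mod N m. act u (act t x) = x" using u by blast
  next
    fix x y assume x: "x \<in> SL_mod N m" and y: "y \<in> SL_mod N m"
    have xc: "x \<in> carrier_mat N N" "[det x = 1] (mod m)" "mat_mod m x = x"
      and yc: "y \<in> carrier_mat N N" "[det y = 1] (mod m)" "mat_mod m y = y"
      using x y by (auto simp: SL_mod_def)
    \<comment> \<open>\<open>det x\<close> is 1 only modulo \<open>m\<close>, so the adjugate stands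
      in for an integer inverse. A word representing \<open>y * adj_mat x\<close> leads from
      \<open>x\<close> to \<open>y\<close>.\<close>
    note ac = adj_mat[OF xc(1)]
    have "det x * det (adj_mat x) = det x ^ N" using det_mult[OF xc(1) ac(1)] ac by simp
    also have "[det x ^ N = 1 ^ N] (mod m)" using xc(2) by (rule cong_pow)
    finally have "[det x * det (adj_mat x) = 1] (mod m)" by simp
    moreover have "[det x * det (adj_mat x) = 1 * det (adj_mat x)] (mod m)"
      using xc(2) by (intro cong_mult cong_refl)
    ultimately have "[det (adj_mat x) = 1] (mod m)" by (metis cong_sym cong_trans mult_1)
    then have "[det (y * adj_mat x) = 1] (mod m)" using yc ac by (intro det_cong)
    then obtain ws where ws: "set ws \<subseteq> ?T" "even (length ws)"
      "mat_mod m (word_prod N ws) = mat_mod m (y * adj_mat x)"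
      using even_word_mod[OF N S(2) m(2,3), of "y * adj_mat x"] yc ac by auto
    have wc: "word_prod N ws \<in> carrier_mat N N" using ws T by (auto intro!: SL_int_carrier word_prod_SL)
    have "foldr act ws x = mat_mod m (word_prod N ws * x)" using act_eq[OF ws(1) xc(1)] xc by simp
    also have "\<dots> = mat_mod m ((y * adj_mat x) * x)"
      using wc ws yc xc ac by (intro mat_mod_mult_cong[of _ N N _ _ N]) auto
    also have "(y * adj_mat x) * x = y * (det x \<cdot>\<^sub>m 1\<^sub>m N)"
      using yc xc ac by (simp add: assoc_mult_mat[of y N N _ N _ N])
    also have "\<dots> = det x \<cdot>\<^sub>m y"
      using yc by (subst mult_smult_distrib[of y N N _ N]) auto
    also have "mat_mod m \<dots> = mat_mod m y"
    proof (subst mat_mod_eq_iff[of _ N N])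
      have "[det x * y $$ (i,j) = 1 * y $$ (i,j)] (mod m)" for i j
        using xc(2) by (intro cong_mult cong_refl)
      then show "\<forall>i<N. \<forall>j<N. [(det x \<cdot>\<^sub>m y) $$ (i,j) = y $$ (i,j)] (mod m)" using yc by simp
    qed (use yc in auto)
    finally have "foldr act ws x = y" using yc by simp
    then show "\<exists>ws. set ws \<subseteq> ?T \<and> even (length ws) \<and> foldr act ws x = y" using ws by blast
  qed (use finT Tne X in auto)
  moreover have "{ws. set ws \<subseteq> ?T \<and> length ws = L \<and> foldr act ws (mat_mod m (1\<^sub>m N)) \<in> X}
      = {ws \<in> words ?T L. mat_mod m (word_prod N ws) \<in> X}" for L
  proof -
    have "foldr act ws (mat_mod m (1\<^sub>m N)) = mat_mod m (word_prod N ws)" if "set ws \<subseteq> ?T" for ws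
    proof -
      have "word_prod N ws \<in> carrier_mat N N" using that T by (intro SL_int_carrier word_prod_SL) auto
      then show ?thesis using act_eq[OF that, of "1\<^sub>m N"] by simp
    qed
    then have "ws \<in> {ws. set ws \<subseteq> ?T \<and> length ws = L \<and> foldr act ws (mat_mod m (1\<^sub>m N)) \<in> X}
        \<longleftrightarrow> ws \<in> {ws \<in> words ?T L. mat_mod m (word_prod N ws) \<in> X}" for ws
      by (cases "set ws \<subseteq> ?T") (simp_all add: words_def)
    then show ?thesis by blast
  qed
  moreover have "card (words ?T L) = card ?T ^ L" for L
    unfolding words_def using card_lists_length_eq[OF finT] by simp
  ultimately show ?thesis by simp
qed

subsection \<open>Independence at distinct primes\<close>

lemma mat_mod_crt:
  assumes A: "A \<in> carrier_mat n k" and B: "B \<in> carrier_mat n k" and m: "coprime m m'"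
  shows "\<exists>C\<in>carrier_mat n k. mat_mod (m * m') C = C \<and> mat_mod m C = mat_mod m A \<and> mat_mod m' C = mat_mod m' B"
proof -
  have "\<exists>x. [x = a] (mod m) \<and> [x = b] (mod m')" for a b
    using binary_chinese_remainder_int[OF m] by blast
  then obtain x where x: "\<And>a b. [x a b = a] (mod m) \<and> [x a b = b] (mod m')" by metis
  define C where "C = mat n k (\<lambda>(i,j). x (A $$ (i,j)) (B $$ (i,j)))"
  have C: "C \<in> carrier_mat n k" by (simp add: C_def)
  have "mat_mod m C = mat_mod m A" "mat_mod m' C = mat_mod m' B"
    using A B x by (subst mat_mod_eq_iff[of _ n k], auto simp: C_def)+
  then show ?thesis
    using C by (intro bexI[of _ "mat_mod (m * m') C"]) (auto simp: mat_mod_mod_dvd)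
qed

text \<open>Entrywise Chinese remaindering is a bijection respecting the determinant condition. The
  two predicates make this a statement of independence; with trivial predicates it yields the
  cardinality for the product modulus.\<close>

lemma card_SL_mod_crt:
  assumes m: "coprime m m'"
  shows "card {A \<in> SL_mod N (m * m'). \<phi> (mat_mod m A) \<and> \<psi> (mat_mod m' A)}
    = card {A \<in> SL_mod N m. \<phi> A} * card {A \<in> SL_mod N m'. \<psi> A}"
proof -
  let ?f = "\<lambda>A. (mat_mod m A, mat_mod m' A)"
  let ?X = "{A \<in> SL_mod N (m * m'). \<phi> (mat_mod m A) \<and> \<psi> (mat_mod m' A)}"
  let ?Y = "{A \<in> SL_mod N m. \<phi> A} \<times> {A \<in> SL_mod N m'. \<psi> A}"
  have "inj_on ?f ?X"
  proof (rule inj_onI)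
    fix A B assume A: "A \<in> ?X" and B: "B \<in> ?X" and eq: "?f A = ?f B"
    have c: "A \<in> carrier_mat N N" "B \<in> carrier_mat N N" using A B by (auto simp: SL_mod_def)
    have "mat_mod (m * m') A = mat_mod (m * m') B"
      using eq m c by (auto simp: mat_mod_eq_iff[of _ N N] intro: coprime_cong_mult)
    then show "A = B" using A B by (auto simp: SL_mod_def)
  qed
  moreover have "?f ` ?X = ?Y"
  proof (rule equalityI; rule subsetI)
    fix z assume "z \<in> ?f ` ?X"
    then obtain A where A: "A \<in> ?X" "z = ?f A" by blast
    then have c: "A \<in> carrier_mat N N" "[det A = 1] (mod m * m')" by (auto simp: SL_mod_def)
    then have "[det A = 1] (mod m)" "[det A = 1] (mod m')"
      by (auto simp: cong_iff_dvd_diff dest: dvd_mult_left dvd_mult_right)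
    then show "z \<in> ?Y" using A c by (auto intro: SL_mod_red)
  next
    fix z assume "z \<in> ?Y"
    then obtain A B where z: "z = (A, B)" "A \<in> SL_mod N m" "B \<in> SL_mod N m'" "\<phi> A" "\<psi> B" by blast
    then have c: "A \<in> carrier_mat N N" "B \<in> carrier_mat N N" "mat_mod m A = A" "mat_mod m' B = B"
      "[det A = 1] (mod m)" "[det B = 1] (mod m')" by (auto simp: SL_mod_def)
    obtain C where C: "C \<in> carrier_mat N N" "mat_mod (m * m') C = C" "mat_mod m C = mat_mod m A" "mat_mod m' C = mat_mod m' B"
      using mat_mod_crt[OF c(1,2) m] by blast
    have "[det C = 1] (mod m)" "[det C = 1] (mod m')"
      using cong_trans[OF det_mod_cong[OF C(1) c(1) C(3)] c(5)]
        cong_trans[OF det_mod_cong[OF C(1) c(2) C(4)] c(6)] by simp_all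
    then have "[det C = 1] (mod m * m')" using m by (rule coprime_cong_mult)
    then show "z \<in> ?f ` ?X" using C c z by (intro image_eqI[of _ _ C]) (auto simp: SL_mod_def)
  qed
  ultimately have "card ?X = card ?Y" using card_image[of ?f ?X] by simp
  then show ?thesis by (simp add: card_cartesian_product)
qed

text \<open>\<open>\<phi>\<close> stands for failure at a prime: by independence the failure
  proportions multiply.\<close>

lemma card_SL_mod_primes_bound:
  fixes c :: real
  assumes "finite P" and P: "\<And>p. p \<in> P \<Longrightarrow> prime p" and "c \<le> 1"
    and \<phi>: "\<And>p. p \<in> P \<Longrightarrow> real (card {A \<in> SL_mod N p. \<phi> p A}) \<le> (1 - c) * real (card (SL_mod N p))"
  shows "real (card {A \<in> SL_mod N (\<Prod>P). \<forall>p\<in>P. \<phi> p (mat_mod p A)}) \<le> (1 - c) ^ card P * real (card (SL_mod N (\<Prod>P)))"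
  using assms
proof (induction P)
  case empty
  then show ?case by simp
next
  case (insert q P)
  let ?m = "\<Prod>P"
  have cop: "coprime q ?m"
    using insert.hyps insert.prems(1) by (intro prod_coprime_right) (metis insert_iff primes_coprime)
  have eq: "mat_mod p (mat_mod ?m A) = mat_mod p A" if "p \<in> P" for p A
    using that insert.hyps by (intro mat_mod_mod_dvd dvd_prodI) auto
  have "{A \<in> SL_mod N (q * ?m). \<forall>p\<in>insert q P. \<phi> p (mat_mod p A)}
      = {A \<in> SL_mod N (q * ?m). \<phi> q (mat_mod q A) \<and> (\<forall>p\<in>P. \<phi> p (mat_mod p (mat_mod ?m A)))}"
    using eq by auto
  then have 1: "card {A \<in> SL_mod N (q * ?m). \<forall>p\<in>insert q P. \<phi> p (mat_mod p A)}
      = card {A \<in> SL_mod N q. \<phi> q A} * card {A \<in> SL_mod N ?m. \<forall>p\<in>P. \<phi> p (mat_mod p A)}"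
    by (simp only: card_SL_mod_crt[OF cop, of N "\<phi> q" "\<lambda>A. \<forall>p\<in>P. \<phi> p (mat_mod p A)"])
  have 2: "card (SL_mod N (q * ?m)) = card (SL_mod N q) * card (SL_mod N ?m)"
    using card_SL_mod_crt[OF cop, of N "\<lambda>_. True" "\<lambda>_. True"] by simp
  have "real (card {A \<in> SL_mod N q. \<phi> q A}) * real (card {A \<in> SL_mod N ?m. \<forall>p\<in>P. \<phi> p (mat_mod p A)})
      \<le> ((1 - c) * real (card (SL_mod N q))) * ((1 - c) ^ card P * real (card (SL_mod N ?m)))"
    using insert by (intro mult_mono) auto
  also have "\<dots> = (1 - c) ^ card (insert q P) * real (card (SL_mod N (q * ?m)))"
    using insert.hyps by (simp add: 2)
  finally show ?case
    using insert.hyps by (simp add: 1 del: insert_iff ball_simps)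
qed

subsection \<open>Matrices with prescribed characteristic polynomial\<close>

text \<open>With the coefficients in the last column, right multiplication by the companion matrix
  shifts the other columns: column \<open>j\<close> of \<open>B * companion f\<close> is column
  \<open>j + 1\<close> of \<open>B\<close>. The counting of conjugating matrices rests on
  this.\<close>

definition companion :: "'a :: comm_ring_1 poly \<Rightarrow> 'a mat" where
  "companion f = mat (degree f) (degree f)
     (\<lambda>(i,j). if Suc j = degree f then - coeff f i else if i = Suc j then 1 else 0)"

lemma companion_carrier [simp]: "companion f \<in> carrier_mat (degree f) (degree f)"
  by (simp add: companion_def)

text \<open>Adding \<open>X^k\<close> times row \<open>k\<close> to row 0 for all
  \<open>k > 0\<close> makes row 0 telescope to zero except for its last entry, which becomes
  \<open>f\<close>. Expansion along this row leaves one triangular minor.\<close>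

lemma char_poly_companion:
  fixes f :: "'a :: comm_ring_1 poly"
  assumes monic: "lead_coeff f = 1"
  shows "char_poly (companion f) = f"
proof (cases "degree f")
  case 0
  then have "f = 1" using monic by (metis degree_eq_zeroE lead_coeff_pCons(2) one_pCons)
  then show ?thesis by (simp add: companion_def char_poly_defs det_def)
next
  case (Suc n)
  define X :: "'a poly" where "X = [:0, 1:]"
  let ?M = "char_poly_matrix (companion f)"
  have M: "?M \<in> carrier_mat (Suc n) (Suc n)"
    using char_poly_matrix_closed[OF companion_carrier, of f] Suc by simp
  have M_index: "?M $$ (i,j) = (if i = j then X else 0) + (if j = n then [:coeff f i:] else if i = Suc j then -1 else 0)"
    if "i \<le> n" "j \<le> n" for i j
    using that Suc
    by (auto simp: char_poly_matrix_def companion_def X_def one_pCons)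
  let ?R = "mat (Suc n) (Suc n) (\<lambda>(i,j). if i = 0 then ?M $$ (0,j) + (\<Sum>k\<in>{1..n}. X ^ k * ?M $$ (k,j)) else ?M $$ (i,j))"
  have "row_equiv ?M ?R"
    by (rule row_equiv_add_rows[OF M]) auto
  from row_equiv_det(2)[OF this M] have det: "det ?M = det ?R" by simp
  have R: "?R \<in> carrier_mat (Suc n) (Suc n)" by simp
  have sum0: "?M $$ (0,j) + (\<Sum>k\<in>{1..n}. X ^ k * ?M $$ (k,j)) = (\<Sum>k\<le>n. X ^ k * ?M $$ (k,j))" for j
    by (simp add: sum.atMost_shift[of _ n] atMost_atLeast0 sum.atLeast_Suc_atMost[of 0 n])
  have R0: "?R $$ (0,j) = (if j = n then f else 0)" if "j \<le> n" for j
  proof (cases "j = n")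
    case True
    have "(\<Sum>k\<le>n. X ^ k * ?M $$ (k,n)) = (\<Sum>k\<le>n. (if k = n then X ^ k * X else 0) + X ^ k * [:coeff f k:])"
      by (intro sum.cong) (auto simp: M_index algebra_simps)
    also have "\<dots> = X ^ Suc n + (\<Sum>k\<le>n. X ^ k * [:coeff f k:])"
      by (simp add: sum.distrib mult.commute)
    also have "\<dots> = (\<Sum>k\<le>Suc n. X ^ k * [:coeff f k:])" using monic Suc by simp
    also have "\<dots> = (\<Sum>k\<le>degree f. monom (coeff f k) k)"
      unfolding Suc by (intro sum.cong) (simp_all add: X_def monom_altdef mult.commute)
    also have "\<dots> = f" by (rule poly_as_sum_of_monoms)
    finally show ?thesis using True sum0[of n] by simp
  next
    case False
    then have j: "j < n" using that by simp
    have "(\<Sum>k\<le>n. X ^ k * ?M $$ (k,j)) = (\<Sum>k\<le>n. (if k = j then X ^ k * X else 0) + (if k = Suc j then - (X ^ k) else 0))"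
      using j by (intro sum.cong) (auto simp: M_index)
    also have "\<dots> = 0" using j by (simp add: sum.distrib mult.commute)
    finally show ?thesis using False j sum0[of j] by simp
  qed
  have "det ?R = (\<Sum>j<Suc n. ?R $$ (0,j) * cofactor ?R 0 j)"
    by (rule laplace_expansion_row[OF R]) simp
  also have "\<dots> = (\<Sum>j<Suc n. if j = n then f * cofactor ?R 0 n else 0)"
    by (intro sum.cong refl) (use R0 in \<open>auto simp del: index_mat\<close>)
  also have "\<dots> = f * cofactor ?R 0 n" by simp
  \<comment> \<open>The minor has the former subdiagonal entries \<open>-1\<close> on its diagonal;
    their product cancels the sign of the position \<open>(0, n)\<close>.\<close>
  also have "cofactor ?R 0 n = 1"
  proof -
    let ?D = "mat_delete ?R 0 n"
    have D: "?D \<in> carrier_mat n n" by (auto simp: mat_delete_def)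
    have D_index: "?D $$ (i,j) = ?M $$ (Suc i, j)" if "i < n" "j < n" for i j
      using that by (simp add: mat_delete_def)
    have "upper_triangular ?D"
      using D by (auto simp: D_index M_index intro!: upper_triangularI)
    then have "det ?D = (\<Prod>i<n. ?D $$ (i,i))"
      using D by (subst det_upper_triangular[of _ n])
        (auto simp: prod_list_diag_prod atLeast0LessThan mat_delete_def intro!: prod.cong)
    also have "\<dots> = (\<Prod>i<n. - 1)" by (intro prod.cong) (auto simp: D_index M_index)
    finally have "det ?D = (- 1) ^ n" by simp
    then show ?thesis by (simp add: cofactor_def flip: power_add mult_2)
  qed
  finally show ?thesis using det by (simp add: char_poly_def)
qed

lemma coeff_0_char_poly:
  fixes A :: "'a :: comm_ring_1 mat"
  assumes A: "A \<in> carrier_mat n n"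
  shows "coeff (char_poly A) 0 = (- 1) ^ n * det A"
proof -
  have "poly (char_poly A) 0 = det (- 1 \<cdot>\<^sub>m A)"
    unfolding char_poly_def
    by (rule poly_det_cong[of _ n]) (use A in \<open>auto simp: char_poly_matrix_index[OF A]\<close>)
  then show ?thesis using A by (simp add: poly_0_coeff_0)
qed

section \<open>Counting matrices with characteristic polynomial in a given set\<close>

definition GL_mod :: "nat \<Rightarrow> int \<Rightarrow> int mat set" where
  "GL_mod N p = {B \<in> carrier_mat N N. mat_mod p B = B \<and> coprime (det B) p}"

lemma finite_GL_mod: "p > 0 \<Longrightarrow> finite (GL_mod N p)"
  by (rule finite_subset[OF _ finite_mat_mod_range[of p N N]]) (auto simp: GL_mod_def)

text \<open>Scaling row 0 of a matrix of determinant 1 by a unit \<open>c\<close> produces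
  determinant \<open>c\<close>, so \<open>c\<close> and then the matrix can be recovered.\<close>

lemma card_GL_mod_ge:
  assumes p: "prime p" and N: "N > 0"
  shows "nat (p - 1) * card (SL_mod N p) \<le> card (GL_mod N p)"
proof -
  let ?f = "\<lambda>(c,A). mat_mod p (multrow 0 c A)"
  have p1: "p > 1" using p by (simp add: prime_gt_1_int)
  have det: "[det (?f (c,A)) = c] (mod p)" if "A \<in> SL_mod N p" for c A
  proof -
    have A: "A \<in> carrier_mat N N" "[det A = 1] (mod p)" using that by (auto simp: SL_mod_def)
    have "[det (mat_mod p (multrow 0 c A)) = det (multrow 0 c A)] (mod p)"
      using A by (intro det_mod_cong[of _ N]) auto
    also have "det (multrow 0 c A) = c * det A" using A N by (simp add: det_multrow)
    also have "[c * det A = c * 1] (mod p)" using A by (intro cong_mult cong_refl)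
    finally show ?thesis by simp
  qed
  have "inj_on ?f ({1..<p} \<times> SL_mod N p)"
  proof (rule inj_onI, clarify)
    fix c A d B assume c: "c \<in> {1..<p}" and d: "d \<in> {1..<p}"
      and A: "A \<in> SL_mod N p" and B: "B \<in> SL_mod N p"
      and eq: "mat_mod p (multrow 0 c A) = mat_mod p (multrow 0 d B)"
    have AB: "A \<in> carrier_mat N N" "mat_mod p A = A" "B \<in> carrier_mat N N" "mat_mod p B = B"
      using A B by (auto simp: SL_mod_def)
    have "[c = d] (mod p)" using cong_trans[OF cong_sym[OF det[OF A, of c]], of d] det[OF B, of d] eq by simp
    then have cd: "c = d" using c d by (auto simp: cong_def)
    have cop: "coprime c p" using c p by (metis atLeastLessThan_iff coprime_commute prime_imp_coprime_int zdvd_not_zless zero_less_one_class.zero_less_one order_less_le_trans)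
    have "[A $$ (i,j) = B $$ (i,j)] (mod p)" if ij: "i < N" "j < N" for i j
    proof -
      have "[multrow 0 c A $$ (i,j) = multrow 0 d B $$ (i,j)] (mod p)"
        using eq AB ij mat_mod_eq_iff[of "multrow 0 c A" N N "multrow 0 d B" p] by auto
      then show ?thesis using AB ij cd cop by (auto split: if_splits simp: cong_mult_lcancel)
    qed
    then have "mat_mod p A = mat_mod p B" using AB(1,3) by (subst mat_mod_eq_iff[of _ N N]) auto
    then have "A = B" using AB by metis
    then show "c = d \<and> A = B" using cd by simp
  qed
  moreover have "?f ` ({1..<p} \<times> SL_mod N p) \<subseteq> GL_mod N p"
  proof clarify
    fix c A assume c: "c \<in> {1..<p}" and A: "A \<in> SL_mod N p"
    have cop: "coprime c p" using c p by (metis atLeastLessThan_iff coprime_commute prime_imp_coprime_int zdvd_not_zless zero_less_one_class.zero_less_one order_less_le_trans)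
    then have "coprime (det (?f (c,A))) p" using det[OF A, of c] by (metis cong_imp_coprime cong_sym)
    then show "mat_mod p (multrow 0 c A) \<in> GL_mod N p" using A by (auto simp: GL_mod_def SL_mod_def)
  qed
  ultimately have "card ({1..<p} \<times> SL_mod N p) \<le> card (GL_mod N p)"
    using finite_GL_mod[of p N] p1 by (intro card_inj_on_le) auto
  then show ?thesis by (simp add: card_cartesian_product)
qed

text \<open>The relation says that \<open>A\<close> maps column \<open>j\<close> of \<open>B\<close>
  to column \<open>j + 1\<close>, so all columns arise from the first one by powers of
  \<open>A\<close>.\<close>

lemma mat_mod_companion_conj_unique:
  assumes A: "A \<in> carrier_mat (degree f) (degree f)"
    and B: "B \<in> carrier_mat (degree f) (degree f)" "B' \<in> carrier_mat (degree f) (degree f)"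
    and AB: "mat_mod p (A * B) = mat_mod p (B * companion f)"
      "mat_mod p (A * B') = mat_mod p (B' * companion f)"
    and col: "\<And>i. i < degree f \<Longrightarrow> [B $$ (i,0) = B' $$ (i,0)] (mod p)"
  shows "mat_mod p B = mat_mod p B'"
proof -
  let ?n = "degree f"
  have shift: "(B * companion f) $$ (i,j) = B $$ (i, Suc j)"
    if "B \<in> carrier_mat ?n ?n" "i < ?n" "Suc j < ?n" for B :: "int mat" and i j
  proof -
    have "(B * companion f) $$ (i,j) = (\<Sum>r<?n. B $$ (i,r) * companion f $$ (r,j))"
      using that by (intro mat_mult_index_sum[where k = ?n]) auto
    also have "\<dots> = (\<Sum>r<?n. if r = Suc j then B $$ (i,r) else 0)"
      using that by (intro sum.cong) (auto simp: companion_def)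
    finally show ?thesis using that by simp
  qed
  have "\<forall>i<?n. [B $$ (i,j) = B' $$ (i,j)] (mod p)" if "j < ?n" for j
    using that
  proof (induction j)
    case 0
    then show ?case using col by simp
  next
    case (Suc j)
    show ?case
    proof (intro allI impI)
      fix i assume i: "i < ?n"
      have 1: "[(A * B) $$ (i,j) = (A * B') $$ (i,j)] (mod p)"
        unfolding mat_mult_index_sum[OF A B(1) i Suc_lessD[OF Suc.prems]]
          mat_mult_index_sum[OF A B(2) i Suc_lessD[OF Suc.prems]]
        using Suc by (intro cong_sum cong_mult cong_refl) auto
      have 2: "[(A * B) $$ (i,j) = B $$ (i,Suc j)] (mod p)"
        using AB(1) A B i Suc.prems shift[OF B(1) i Suc.prems]
          mat_mod_eq_iff[of "A * B" ?n ?n "B * companion f" p]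
        by (auto simp del: index_mult_mat) (metis Suc_lessD)
      have 3: "[(A * B') $$ (i,j) = B' $$ (i,Suc j)] (mod p)"
        using AB(2) A B i Suc.prems shift[OF B(2) i Suc.prems]
          mat_mod_eq_iff[of "A * B'" ?n ?n "B' * companion f" p]
        by (auto simp del: index_mult_mat) (metis Suc_lessD)
      show "[B $$ (i,Suc j) = B' $$ (i,Suc j)] (mod p)"
        using cong_trans[OF cong_trans[OF cong_sym[OF 2] 1] 3] .
    qed
  qed
  then show ?thesis using B by (subst mat_mod_eq_iff[of _ ?n ?n]) auto
qed

text \<open>\<open>A\<close> is the companion matrix conjugated by \<open>B\<close>, the inverse
  being the adjugate times an inverse of \<open>det B\<close> modulo \<open>p\<close>. The condition
  on the constant coefficient is what makes its determinant 1.\<close>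

lemma exists_companion_conj:
  assumes B: "B \<in> GL_mod N p" and f: "degree f = N" "lead_coeff f = 1" "poly_red p f = f" "[coeff f 0 = (-1) ^ N] (mod p)"
  shows "\<exists>A\<in>SL_mod N p. mat_mod p (A * B) = mat_mod p (B * companion f) \<and> poly_red p (char_poly A) = f"
proof -
  have Bc: "B \<in> carrier_mat N N" and cop: "coprime (det B) p" using B by (auto simp: GL_mod_def)
  obtain v where v: "[det B * v = 1] (mod p)" using cong_solve_coprime_int[OF cop] by blast
  define B' where "B' = v \<cdot>\<^sub>m adj_mat B"
  have Cc: "companion f \<in> carrier_mat N N" using companion_carrier[of f] f by simp
  note adj = adj_mat[OF Bc]
  have B'c: "B' \<in> carrier_mat N N" using adj by (simp add: B'_def)
  have B'B: "B' * B = (v * det B) \<cdot>\<^sub>m 1\<^sub>m N" "B * B' = (v * det B) \<cdot>\<^sub>m 1\<^sub>m N"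
    using adj Bc by (auto simp: B'_def mult_smult_distrib[of _ N N] mult_smult_assoc_mat[of _ N N] intro!: eq_matI)
  define A where "A = mat_mod p (B * companion f * B')"
  have Ac: "A \<in> carrier_mat N N" using Bc Cc B'c by (simp add: A_def)
  have "[det A = det (B * companion f * B')] (mod p)"
    unfolding A_def using Bc Cc B'c by (intro det_mod_cong[of _ N]) auto
  also have "det (B * companion f * B') = det (companion f) * det (B * B')"
    using Bc Cc B'c by (simp add: det_mult[of _ N])
  also have "\<dots> = det (companion f) * (det B * v) ^ N" by (simp add: B'B mult.commute)
  also have "[\<dots> = det (companion f) * 1 ^ N] (mod p)" using v by (intro cong_mult cong_pow cong_refl)
  also have "det (companion f) * 1 ^ N = (-1) ^ N * coeff f 0"
    using coeff_0_char_poly[OF Cc] char_poly_companion[OF f(2)] by (simp flip: power_add mult.assoc mult_2)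
  also have "[\<dots> = (-1) ^ N * (-1) ^ N] (mod p)" using f by (intro cong_mult cong_refl)
  finally have "[det A = 1] (mod p)" by (simp flip: power_add mult_2)
  then have "A \<in> SL_mod N p" using Ac by (auto simp: SL_mod_def A_def)
  moreover have AB: "mat_mod p (A * B) = mat_mod p (B * companion f)"
  proof -
    have "mat_mod p (A * B) = mat_mod p (B * companion f * B' * B)"
      unfolding A_def using Bc Cc B'c by (intro mat_mod_mult_left[of _ N N _ N]) auto
    also have "B * companion f * B' * B = B * companion f * (B' * B)"
      using Bc Cc B'c by (intro assoc_mult_mat[of _ N N _ N _ N]) auto
    also have "mat_mod p \<dots> = mat_mod p (B * companion f * 1\<^sub>m N)"
    proof (rule mat_mod_mult_cong[of _ N N _ _ N])
      show "mat_mod p (B' * B) = mat_mod p (1\<^sub>m N)"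
        unfolding B'B using v by (subst mat_mod_eq_iff[of _ N N]) (auto simp: mult.commute)
    qed (use Bc Cc B'c in auto)
    finally show ?thesis using Bc Cc by simp
  qed
  moreover have "poly_red p (char_poly A) = f"
    using char_poly_mod_similar[OF Ac Bc Cc AB cop] f char_poly_companion[OF f(2)] by simp
  ultimately show ?thesis by blast
qed

text \<open>Send \<open>(f, B)\<close> to the conjugate \<open>A\<close> of the companion matrix
  together with the first column of \<open>B\<close>. \<open>A\<close> determines \<open>f\<close>,
  and then the column determines \<open>B\<close>, so the map is injective, with at most
  \<open>p^N\<close> columns for each \<open>A\<close>. This bounds the matrices from below without
  computing sizes of conjugacy classes.\<close>

lemma card_char_poly_fibre:
  assumes p: "prime p" and N: "N > 0" and F: "finite F"
    "\<And>f. f \<in> F \<Longrightarrow> degree f = N \<and> lead_coeff f = 1 \<and> poly_red p f = f \<and> [coeff f 0 = (-1) ^ N] (mod p)"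
  shows "card F * card (GL_mod N p) \<le> card {A \<in> SL_mod N p. poly_red p (char_poly A) \<in> F} * nat p ^ N"
proof -
  have p1: "p > 1" using p by (simp add: prime_gt_1_int)
  have "\<exists>A. A \<in> SL_mod N p \<and> mat_mod p (A * B) = mat_mod p (B * companion f) \<and> poly_red p (char_poly A) = f"
    if "f \<in> F" "B \<in> GL_mod N p" for f B
    using exists_companion_conj[OF that(2)] F(2)[OF that(1)] by blast
  then obtain \<alpha> where \<alpha>: "\<And>f B. f \<in> F \<Longrightarrow> B \<in> GL_mod N p \<Longrightarrow>
      \<alpha> f B \<in> SL_mod N p \<and> mat_mod p (\<alpha> f B * B) = mat_mod p (B * companion f) \<and> poly_red p (char_poly (\<alpha> f B)) = f"
    by metis
  let ?col = "\<lambda>B. \<lambda>i\<in>{..<N}. B $$ (i,0)"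
  let ?Y = "{A \<in> SL_mod N p. poly_red p (char_poly A) \<in> F} \<times> ({..<N} \<rightarrow>\<^sub>E {0..<p})"
  have "inj_on (\<lambda>(f,B). (\<alpha> f B, ?col B)) (F \<times> GL_mod N p)"
  proof (rule inj_onI, clarify)
    fix f B g B'
    assume f: "f \<in> F" and g: "g \<in> F" and B: "B \<in> GL_mod N p" and B': "B' \<in> GL_mod N p"
      and eq: "\<alpha> f B = \<alpha> g B'" and col: "?col B = ?col B'"
    have fg: "f = g" using \<alpha>[OF f B] \<alpha>[OF g B'] eq by simp
    have "mat_mod p B = mat_mod p B'"
    proof (rule mat_mod_companion_conj_unique[where A = "\<alpha> f B" and f = f])
      fix i assume "i < degree f"
      then have "i < N" using F(2)[OF f] by simp
      then show "[B $$ (i,0) = B' $$ (i,0)] (mod p)"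
        using fun_cong[OF col, of i] by simp
    qed (use \<alpha>[OF f B] \<alpha>[OF g B'] eq fg F(2)[OF f] B B' in \<open>auto simp: SL_mod_def GL_mod_def\<close>)
    then show "f = g \<and> B = B'" using fg B B' by (simp add: GL_mod_def)
  qed
  moreover have "(\<lambda>(f,B). (\<alpha> f B, ?col B)) ` (F \<times> GL_mod N p) \<subseteq> ?Y"
  proof clarify
    fix f B assume f: "f \<in> F" and B: "B \<in> GL_mod N p"
    have "B $$ (i,0) \<in> {0..<p}" if "i < N" for i
    proof -
      have eq: "B $$ (i,0) = B $$ (i,0) mod p"
        using B that N index_mat_mod[of i B 0 p] by (auto simp: GL_mod_def)
      show ?thesis using p1 by (subst eq) simp
    qed
    then show "\<alpha> f B \<in> {A \<in> SL_mod N p. poly_red p (char_poly A) \<in> F} \<and> ?col B \<in> {..<N} \<rightarrow>\<^sub>E {0..<p}"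
      using \<alpha>[OF f B] f by auto
  qed
  moreover have "finite ?Y" using finite_SL_mod[of p N] p1 by (auto intro!: finite_PiE)
  ultimately have "card (F \<times> GL_mod N p) \<le> card ?Y" by (intro card_inj_on_le)
  then show ?thesis by (simp add: card_cartesian_product card_PiE)
qed

subsection \<open>Polynomials without factors of a given degree\<close>

definition monic_mod :: "int \<Rightarrow> nat \<Rightarrow> int poly set" where
  "monic_mod p n = {f. degree f = n \<and> lead_coeff f = 1 \<and> poly_red p f = f}"

text \<open>By \<open>coeff_0_char_poly\<close> the congruence expresses determinant 1.\<close>

definition SL_polys :: "nat \<Rightarrow> int \<Rightarrow> int poly set" where
  "SL_polys N p = {f \<in> monic_mod p N. [coeff f 0 = (-1) ^ N] (mod p)}"

definition factorable :: "nat \<Rightarrow> nat \<Rightarrow> int \<Rightarrow> int poly set" where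
  "factorable N d p = {f. \<exists>g\<in>monic_mod p d. \<exists>h\<in>monic_mod p (N - d). f = poly_red p (g * h)}"

text \<open>Distinctness is imposed on the \<open>K\<close>-th powers because these will be roots
  modulo \<open>p\<close> of factors of the characteristic polynomial of the \<open>K\<close>-th
  power.\<close>

definition split_polys :: "nat \<Rightarrow> nat \<Rightarrow> int \<Rightarrow> int poly set" where
  "split_polys N K p = {f. \<exists>a. f = poly_red p (\<Prod>i<N. [:- a i, 1:]) \<and> [(\<Prod>i<N. a i) = 1] (mod p)
     \<and> (\<forall>i<N. \<forall>j<N. [a i ^ K = a j ^ K] (mod p) \<longrightarrow> i = j)}"

lemma coeff_monic_mod:
  assumes "f \<in> monic_mod p n"
  shows "coeff f n = 1" "n < i \<Longrightarrow> coeff f i = 0" "coeff f i mod p = coeff f i"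
  using assms by (auto simp: monic_mod_def coeff_eq_0 poly_eq_iff)

lemma poly_red_monic_mod: "lead_coeff f = 1 \<Longrightarrow> p > 1 \<Longrightarrow> poly_red p f \<in> monic_mod p (degree f)"
  using degree_poly_red_monic[of f p] by (simp add: monic_mod_def)

lemma finite_monic_mod:
  assumes "p > 0"
  shows "finite (monic_mod p n)"
proof -
  have "inj_on (\<lambda>f. \<lambda>i\<in>{..n}. coeff f i) (monic_mod p n)"
  proof (rule inj_onI)
    fix f g assume f: "f \<in> monic_mod p n" and g: "g \<in> monic_mod p n"
      and eq: "(\<lambda>i\<in>{..n}. coeff f i) = (\<lambda>i\<in>{..n}. coeff g i)"
    have "coeff f i = coeff g i" for i
      using fun_cong[OF eq, of i] coeff_monic_mod(2)[OF f, of i] coeff_monic_mod(2)[OF g, of i]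
      by (cases "i \<le> n") auto
    then show "f = g" by (simp add: poly_eq_iff)
  qed
  moreover have "(\<lambda>f. \<lambda>i\<in>{..n}. coeff f i) ` monic_mod p n \<subseteq> {..n} \<rightarrow>\<^sub>E {0..<p}"
  proof -
    have "coeff f i \<in> {0..<p}" if "f \<in> monic_mod p n" for f i
      using coeff_monic_mod(3)[OF that, of i] assms pos_mod_bound[of p "coeff f i"] pos_mod_sign[of p "coeff f i"]
      by simp
    then show ?thesis by (auto split: if_splits)
  qed
  moreover have "finite ({..n} \<rightarrow>\<^sub>E {0..<p})" by (intro finite_PiE) auto
  ultimately show ?thesis by (metis finite_imageD finite_subset)
qed

lemma finite_SL_polys: "p > 0 \<Longrightarrow> finite (SL_polys N p)"
  by (rule finite_subset[OF _ finite_monic_mod[of p N]]) (auto simp: SL_polys_def)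

text \<open>There are at most as many pairs \<open>(g, h)\<close> as possible products, since \<open>h(0)\<close> is determined by
  \<open>g(0)\<close>; the remaining coefficients are stored next to each other in one polynomial.\<close>

lemma card_factor_pairs_le:
  assumes p: "prime p" and d: "1 \<le> d" "d < N"
  shows "card {(g,h). g \<in> monic_mod p d \<and> h \<in> monic_mod p (N - d) \<and> [coeff g 0 * coeff h 0 = (-1) ^ N] (mod p)}
    \<le> card (SL_polys N p)"
proof -
  let ?P = "{(g,h). g \<in> monic_mod p d \<and> h \<in> monic_mod p (N - d) \<and> [coeff g 0 * coeff h 0 = (-1) ^ N] (mod p)}"
  have p1: "p > 1" using p by (simp add: prime_gt_1_int)
  \<comment> \<open>A monic polynomial of degree \<open>N\<close> with fixed constant term has
    \<open>N - 1\<close> free slots. The \<open>d\<close> lower coefficients of \<open>g\<close>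
    take slots \<open>1\<close> to \<open>d\<close>, and coefficients \<open>1\<close> to
    \<open>N - d - 1\<close> of \<open>h\<close> take the rest.\<close>
  define c where "c = (\<lambda>(g,h) i. if i = 0 then (-1) ^ N mod p else if i \<le> d then coeff g (i - 1)
    else if i < N then coeff h (i - d) else if i = N then 1 else 0)"
  define \<Phi> where "\<Phi> = (\<lambda>z. Poly (map (c z) [0..<Suc N]))"
  have coeff_\<Phi>: "coeff (\<Phi> z) i = c z i" for z i
    using d by (cases z) (auto simp: \<Phi>_def c_def nth_default_def simp del: upt_Suc)
  have "inj_on \<Phi> ?P"
  proof (rule inj_onI, clarify)
    fix g h g' h'
    assume g: "g \<in> monic_mod p d" and h: "h \<in> monic_mod p (N - d)" and gh: "[coeff g 0 * coeff h 0 = (-1) ^ N] (mod p)"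
      and g': "g' \<in> monic_mod p d" and h': "h' \<in> monic_mod p (N - d)" and gh': "[coeff g' 0 * coeff h' 0 = (-1) ^ N] (mod p)"
      and eq: "\<Phi> (g,h) = \<Phi> (g',h')"
    have c: "c (g,h) i = c (g',h') i" for i using arg_cong[OF eq, of "\<lambda>f. coeff f i"] by (simp add: coeff_\<Phi>)
    have "coeff g i = coeff g' i" for i
    proof -
      consider "i < d" | "i = d" | "i > d" by linarith
      then show ?thesis using c[of "Suc i"] coeff_monic_mod[OF g] coeff_monic_mod[OF g']
        by cases (auto simp: c_def)
    qed
    then have gg: "g = g'" by (simp add: poly_eq_iff)
    have "coeff h i = coeff h' i" for i
    proof -
      consider "i = 0" | "0 < i" "i < N - d" | "i = N - d" | "i > N - d" by linarith
      then show ?thesis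
      proof cases
        case 1
        have "coprime ((-1) ^ N) p" by (simp add: coprime_power_left_iff)
        then have "coprime (coeff g 0 * coeff h 0) p" using gh by (metis cong_imp_coprime cong_sym)
        then have "coprime (coeff g 0) p" by simp
        moreover have "[coeff g 0 * coeff h 0 = coeff g 0 * coeff h' 0] (mod p)"
          using gh gh' unfolding gg by (metis cong_sym cong_trans)
        ultimately have "[coeff h 0 = coeff h' 0] (mod p)" by (simp add: cong_mult_lcancel)
        then show ?thesis using 1 coeff_monic_mod(3)[OF h, of 0] coeff_monic_mod(3)[OF h', of 0]
          by (simp add: cong_def)
      qed (use c[of "i + d"] coeff_monic_mod[OF h] coeff_monic_mod[OF h'] d in \<open>auto simp: c_def less_diff_conv\<close>)
    qed
    then show "g = g' \<and> h = h'" using gg by (simp add: poly_eq_iff)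
  qed
  moreover have "\<Phi> ` ?P \<subseteq> SL_polys N p"
  proof clarify
    fix g h assume g: "g \<in> monic_mod p d" and h: "h \<in> monic_mod p (N - d)"
    let ?f = "\<Phi> (g,h)"
    have cN: "coeff ?f N = 1" using d by (simp add: coeff_\<Phi> c_def)
    have "coeff ?f i = 0" if "i > N" for i using d that by (simp add: coeff_\<Phi> c_def)
    then have "degree ?f \<le> N" by (intro degree_le) auto
    then have deg: "degree ?f = N" using cN by (metis le_antisym le_degree zero_neq_one)
    have "coeff ?f i mod p = coeff ?f i" for i
      using coeff_monic_mod(3)[OF g] coeff_monic_mod(3)[OF h] p1 by (auto simp: coeff_\<Phi> c_def)
    moreover have "[coeff ?f 0 = (-1) ^ N] (mod p)" by (simp add: coeff_\<Phi> c_def)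
    ultimately show "?f \<in> SL_polys N p" using deg cN by (simp add: SL_polys_def monic_mod_def poly_eq_iff)
  qed
  ultimately show ?thesis using finite_SL_polys[of p N] p1 by (intro card_inj_on_le) auto
qed

text \<open>On average a polynomial has at most one factor of degree \<open>d\<close>, so polynomials with two such
  factors have to be compensated by polynomials with none.\<close>

lemma card_not_factorable_ge:
  assumes p: "prime p" and d: "1 \<le> d" "d < N" and F: "F \<subseteq> SL_polys N p"
    and two: "\<And>f. f \<in> F \<Longrightarrow> \<exists>g\<in>monic_mod p d. \<exists>h\<in>monic_mod p (N - d). \<exists>g'\<in>monic_mod p d. \<exists>h'\<in>monic_mod p (N - d).
      f = poly_red p (g * h) \<and> f = poly_red p (g' * h') \<and> g \<noteq> g'"
  shows "card F \<le> card (SL_polys N p - factorable N d p)"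
proof -
  define P where "P = {(g,h). g \<in> monic_mod p d \<and> h \<in> monic_mod p (N - d) \<and> [coeff g 0 * coeff h 0 = (-1) ^ N] (mod p)}"
  define \<mu> where "\<mu> = (\<lambda>(g,h). poly_red p (g * h))"
  have p1: "p > 1" using p by (simp add: prime_gt_1_int)
  have finS: "finite (SL_polys N p)" using finite_SL_polys p1 by simp
  have finP: "finite P" unfolding P_def
    by (rule finite_subset[of _ "monic_mod p d \<times> monic_mod p (N - d)"]) (use finite_monic_mod p1 in auto)
  define R where "R = SL_polys N p \<inter> factorable N d p"
  have inP: "(g,h) \<in> P" if "g \<in> monic_mod p d" "h \<in> monic_mod p (N - d)" "poly_red p (g * h) \<in> SL_polys N p" for g h
  proof -
    have "[coeff (poly_red p (g * h)) 0 = (-1) ^ N] (mod p)" using that by (simp add: SL_polys_def)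
    then show ?thesis using that by (simp add: P_def coeff_mult)
  qed
  have "\<exists>z\<in>P. \<mu> z = f" if f: "f \<in> R" for f
  proof -
    obtain g h where "g \<in> monic_mod p d" "h \<in> monic_mod p (N - d)" "f = poly_red p (g * h)" "f \<in> SL_polys N p"
      using f unfolding R_def factorable_def by blast
    then show ?thesis using inP[of g h] by (intro bexI[of _ "(g,h)"]) (simp_all add: \<mu>_def)
  qed
  \<comment> \<open>\<open>\<sigma>\<close> selects one factorisation of each factorable polynomial
    and \<open>\<tau>\<close> a different one for members of \<open>F\<close>. Their images are
    disjoint in \<open>P\<close>, so the factorable polynomials plus \<open>F\<close> number at most
    \<open>card P\<close>.\<close>
  then obtain \<sigma> where \<sigma>: "\<And>f. f \<in> R \<Longrightarrow> \<sigma> f \<in> P \<and> \<mu> (\<sigma> f) = f" by metis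
  have "\<exists>z\<in>P. \<mu> z = f \<and> z \<noteq> \<sigma> f" if f: "f \<in> F" for f
  proof -
    obtain g h g' h' where gh: "g \<in> monic_mod p d" "h \<in> monic_mod p (N - d)" "g' \<in> monic_mod p d" "h' \<in> monic_mod p (N - d)"
      "f = poly_red p (g * h)" "f = poly_red p (g' * h')" "g \<noteq> g'" using two[OF f] by blast
    have P: "(g,h) \<in> P" "(g',h') \<in> P" using F f inP[OF gh(1,2)] inP[OF gh(3,4)] gh(5,6) by auto
    have \<mu>: "\<mu> (g,h) = f" "\<mu> (g',h') = f" using gh by (simp_all add: \<mu>_def)
    have "(g,h) \<noteq> (g',h')" using gh(7) by simp
    then show ?thesis using P \<mu> by metis
  qed
  then obtain \<tau> where \<tau>: "\<And>f. f \<in> F \<Longrightarrow> \<tau> f \<in> P \<and> \<mu> (\<tau> f) = f \<and> \<tau> f \<noteq> \<sigma> f" by metis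
  have FR: "F \<subseteq> R"
  proof
    fix f assume f: "f \<in> F"
    then show "f \<in> R" using two[OF f] F unfolding R_def factorable_def by blast
  qed
  have inj\<sigma>: "inj_on \<sigma> R" using \<sigma> by (intro inj_on_inverseI[of _ \<mu>]) simp
  have inj\<tau>: "inj_on \<tau> F" using \<tau> by (intro inj_on_inverseI[of _ \<mu>]) simp
  have disj: "\<sigma> ` R \<inter> \<tau> ` F = {}"
  proof (rule ccontr)
    assume "\<sigma> ` R \<inter> \<tau> ` F \<noteq> {}"
    then obtain f f' where f: "f \<in> R" "f' \<in> F" "\<sigma> f = \<tau> f'" by blast
    then have "f = f'" using \<sigma>[OF f(1)] \<tau>[OF f(2)] by simp
    then show False using \<tau>[OF f(2)] f(3) by simp
  qed
  have fin: "finite R" "finite F" using finS F finite_subset by (auto simp: R_def)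
  have "card R + card F = card (\<sigma> ` R \<union> \<tau> ` F)"
    using disj fin by (simp add: card_Un_disjoint card_image inj\<sigma> inj\<tau>)
  also have "\<dots> \<le> card P" using \<sigma> \<tau> finP by (intro card_mono) auto
  also have "\<dots> \<le> card (SL_polys N p)" unfolding P_def by (rule card_factor_pairs_le[OF p d])
  also have "\<dots> = card R + card (SL_polys N p - factorable N d p)"
  proof -
    have "SL_polys N p = R \<union> (SL_polys N p - factorable N d p)" by (auto simp: R_def)
    then have "card (SL_polys N p) = card (R \<union> (SL_polys N p - factorable N d p))" by simp
    also have "\<dots> = card R + card (SL_polys N p - factorable N d p)"
      using finS by (intro card_Un_disjoint) (auto simp: R_def)
    finally show ?thesis .
  qed
  finally show ?thesis by simp
qed

section \<open>Completely split polynomials and their number\<close>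

lemma degree_prod_linear:
  fixes a :: "'b \<Rightarrow> 'a :: idom"
  shows "degree (\<Prod>i\<in>I. [:- a i, 1:]) = card I" "lead_coeff (\<Prod>i\<in>I. [:- a i, 1:]) = 1"
proof -
  show "degree (\<Prod>i\<in>I. [:- a i, 1:]) = card I" by (simp add: degree_prod_eq_sum_degree)
  show "lead_coeff (\<Prod>i\<in>I. [:- a i, 1:]) = 1" by (simp only: lead_coeff_prod) simp
qed

lemma poly_red_prod_linear_monic_mod:
  "finite I \<Longrightarrow> p > 1 \<Longrightarrow> poly_red p (\<Prod>i\<in>I. [:- a i, 1:]) \<in> monic_mod p (card I)"
  using poly_red_monic_mod[of "\<Prod>i\<in>I. [:- a i, 1:]" p] degree_prod_linear[of a I] by simp

lemma split_polys_SL: "p > 1 \<Longrightarrow> split_polys N K p \<subseteq> SL_polys N p"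
proof
  fix f assume p: "p > 1" and "f \<in> split_polys N K p"
  then obtain a where a: "f = poly_red p (\<Prod>i<N. [:- a i, 1:])" "[(\<Prod>i<N. a i) = 1] (mod p)"
    by (auto simp: split_polys_def)
  have "[poly f 0 = poly (\<Prod>i<N. [:- a i, 1:]) 0] (mod p)" unfolding a(1) by (rule poly_mod_cong) simp
  then have "[coeff f 0 = (\<Prod>i<N. - a i)] (mod p)" by (simp add: poly_prod flip: poly_0_coeff_0)
  also have "(\<Prod>i<N. - a i) = (-1) ^ N * (\<Prod>i<N. a i)" by (subst prod_uminus) simp
  also have "[\<dots> = (-1) ^ N * 1] (mod p)" using a(2) by (intro cong_mult cong_refl)
  finally show "f \<in> SL_polys N p"
    using poly_red_prod_linear_monic_mod[of "{..<N}" p a] p a(1) by (simp add: SL_polys_def)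
qed

text \<open>The roots with indices \<open>0\<close> to \<open>d - 1\<close> and those with indices
  \<open>1\<close> to \<open>d\<close> give two factors of degree \<open>d\<close>. Only the first
  vanishes at \<open>a 0\<close> modulo \<open>p\<close>.\<close>

lemma card_split_polys_le_not_factorable:
  assumes p: "prime p" and d: "1 \<le> d" "d < N"
  shows "card (split_polys N K p) \<le> card (SL_polys N p - factorable N d p)"
proof (rule card_not_factorable_ge[OF p d])
  have p1: "p > 1" using p by (simp add: prime_gt_1_int)
  then show "split_polys N K p \<subseteq> SL_polys N p" by (rule split_polys_SL)
  fix f assume "f \<in> split_polys N K p"
  then obtain a where f: "f = poly_red p (\<Prod>i<N. [:- a i, 1:])"
    and a: "\<And>i j. i < N \<Longrightarrow> j < N \<Longrightarrow> [a i ^ K = a j ^ K] (mod p) \<Longrightarrow> i = j"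
    by (auto simp: split_polys_def)
  let ?G = "\<lambda>I. poly_red p (\<Prod>i\<in>I. [:- a i, 1:])"
  have mult: "f = poly_red p (?G I * ?G ({..<N} - I))" if I: "I \<subseteq> {..<N}" for I
  proof -
    have "(\<Prod>i<N. [:- a i, 1:]) = (\<Prod>i\<in>I. [:- a i, 1:]) * (\<Prod>i\<in>{..<N} - I. [:- a i, 1:])"
      using I by (metis finite_lessThan mult.commute prod.subset_diff)
    then show ?thesis unfolding f by (auto intro: poly_red_mult_cong)
  qed
  have ne: "?G {..<d} \<noteq> ?G {1..d}"
  proof
    assume eq: "?G {..<d} = ?G {1..d}"
    have "poly (\<Prod>i<d. [:- a i, 1:]) (a 0) = 0" using d by (auto simp: poly_prod)
    then have "p dvd poly (\<Prod>i\<in>{1..d}. [:- a i, 1:]) (a 0)"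
      using poly_mod_cong[OF eq, of "a 0"] by (simp add: cong_iff_dvd_diff)
    then obtain i where i: "i \<in> {1..d}" "p dvd a 0 - a i"
      using p by (auto simp: poly_prod prime_dvd_prod_iff)
    then have "[a 0 = a i] (mod p)" by (simp add: cong_iff_dvd_diff)
    then have "[a 0 ^ K = a i ^ K] (mod p)" by (rule cong_pow)
    then show False using a[of 0 i] i d by auto
  qed
  have G: "?G I \<in> monic_mod p d" "?G ({..<N} - I) \<in> monic_mod p (N - d)" if "I \<subseteq> {..<N}" "card I = d" for I
  proof -
    have "finite I" using that finite_subset by blast
    moreover have "card ({..<N} - I) = N - d" using that by (simp add: card_Diff_subset finite_subset)
    ultimately show "?G I \<in> monic_mod p d" "?G ({..<N} - I) \<in> monic_mod p (N - d)"
      using poly_red_prod_linear_monic_mod[of I p a] poly_red_prod_linear_monic_mod[of "{..<N} - I" p a] p1 that by auto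
  qed
  have sub: "{..<d} \<subseteq> {..<N}" "{1..d} \<subseteq> {..<N}" and card: "card {..<d} = d" "card {1..d} = d"
    using d by auto
  show "\<exists>g\<in>monic_mod p d. \<exists>h\<in>monic_mod p (N - d). \<exists>g'\<in>monic_mod p d. \<exists>h'\<in>monic_mod p (N - d).
      f = poly_red p (g * h) \<and> f = poly_red p (g' * h') \<and> g \<noteq> g'"
    using G[OF sub(1) card(1)] G[OF sub(2) card(2)] mult[OF sub(1)] mult[OF sub(2)] ne by blast
qed

text \<open>The roots are powers of a primitive root. For \<open>i > 0\<close> the exponent moves
  freely in the window from \<open>i * h\<close> to \<open>(i + 1) * h\<close>, giving
  \<open>h ^ (N - 1)\<close> choices; exponent 0 is adjusted so that all exponents sum to
  \<open>p - 1\<close> and the roots multiply to 1. Disjoint windows allow the choice to be read off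
  from the unordered roots.\<close>

lemma card_split_polys_ge:
  assumes p: "prime p" and N: "N \<ge> 2" and K: "K > 0"
  shows "((p - 1) div (2 * N\<^sup>2 * K)) ^ (N - 1) \<le> card (split_polys N K (int p))"
proof -
  \<comment> \<open>Exponents outside position 0, and their sum, stay below \<open>N^2 * h\<close>.
    The divisor keeps \<open>K\<close> times this within half of \<open>p - 1\<close>, so
    multiplication by \<open>K\<close> causes no wrap-around.\<close>
  define h where "h = (p - 1) div (2 * N\<^sup>2 * K)"
  have p1: "p > 1" using p prime_gt_1_nat by blast
  obtain g where g: "residue_primroot p g" using prime_primitive_root_exists[OF p1 p] by blast
  have cop: "coprime p g" and ord: "ord p g = p - 1"
    using g p by (auto simp: residue_primroot_def totient_prime)
  have g_cong: "[int g ^ i = int g ^ j] (mod int p) \<longleftrightarrow> [i = j] (mod (p - 1))" for i j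
    using order_divides_expdiff[OF cop, of i j] ord by (simp flip: of_nat_power add: cong_int_iff)
  have hM: "2 * N\<^sup>2 * K * h \<le> p - 1" by (simp add: h_def)
  show ?thesis
  proof (cases "h = 0")
    case True
    then have "h ^ (N - 1) = 0" using N by (simp add: power_0_left)
    then show ?thesis unfolding h_def by linarith
  next
    case False
    then have h: "h > 0" by simp
    let ?X = "{1..<N} \<rightarrow>\<^sub>E {..<h}"
    define e where "e = (\<lambda>x i. if i = 0 then (p - 1) - (\<Sum>j=1..<N. j * h + x j) else i * h + x i)"
    define s where "s = (\<lambda>x. \<Sum>j=1..<N. j * h + x j)"
    define f where "f = (\<lambda>x. poly_red (int p) (\<Prod>i<N. [:- (int g ^ e x i), 1:]))"
    have e0: "e x 0 = (p - 1) - s x" for x by (simp add: e_def s_def)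
    have e_pos: "i * h \<le> e x i" "e x i < Suc i * h" "e x i < N * h" if "x \<in> ?X" "i \<in> {1..<N}" for x i
    proof -
      have "x i < h" using that by auto
      then show 1: "i * h \<le> e x i" "e x i < Suc i * h" using that by (auto simp: e_def)
      have "Suc i * h \<le> N * h" using that by (intro mult_right_mono) auto
      then show "e x i < N * h" using 1 by simp
    qed
    have s_le: "s x \<le> (N - 1) * (N * h)" if "x \<in> ?X" for x
    proof -
      have "s x \<le> (\<Sum>j=1..<N. N * h)" unfolding s_def
      proof (rule sum_mono)
        fix j assume j: "j \<in> {1..<N}"
        then show "j * h + x j \<le> N * h" using e_pos(3)[OF that j] by (simp add: e_def)
      qed
      then show ?thesis by simp
    qed
    have big: "s x + N * h \<le> N * N * h" "N * N * h * K * 2 \<le> p - 1" "N * N * h * 2 \<le> p - 1" if "x \<in> ?X" for x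
    proof -
      have "(N - 1) * (N * h) + N * h = N * N * h" using N by (cases N) (auto simp: algebra_simps)
      then show "s x + N * h \<le> N * N * h" using s_le[OF that] by linarith
      show 1: "N * N * h * K * 2 \<le> p - 1" using hM by (simp add: power2_eq_square mult_ac)
      have "N * N * h * 2 \<le> N * N * h * 2 * K" using K by simp
      also have "\<dots> = N * N * h * K * 2" by simp
      finally show "N * N * h * 2 \<le> p - 1" using 1 by linarith
    qed
    have s_pos: "s x > 0" for x
    proof -
      have "1 * h + x 1 \<le> s x" unfolding s_def using N
        by (intro member_le_sum[where f = "\<lambda>j. j * h + x j"]) auto
      then show ?thesis using h by simp
    qed
    have e_lt: "e x i < p - 1" if "x \<in> ?X" "i < N" for x i
    proof (cases "i = 0")
      case True
      then show ?thesis using e0[of x] s_pos[of x] big[OF that(1)] by simp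
    next
      case False
      then show ?thesis using e_pos(3)[OF that(1), of i] that(2) big[OF that(1)] by auto
    qed
    have dist: "i = j" if x: "x \<in> ?X" and y: "y \<in> ?X" and i: "i \<in> {1..<N}" and j: "j \<in> {1..<N}" and eq: "e x i = e y j" for x y i j
    proof (rule ccontr)
      assume "i \<noteq> j"
      then consider "Suc i \<le> j" | "Suc j \<le> i" by linarith
      then show False
      proof cases
        case 1
        then have "Suc i * h \<le> j * h" by (rule mult_right_mono) simp
        then show False using e_pos[OF x i] e_pos[OF y j] eq by simp
      next
        case 2
        then have "Suc j * h \<le> i * h" by (rule mult_right_mono) simp
        then show False using e_pos[OF x i] e_pos[OF y j] eq by simp
      qed
    qed
    \<comment> \<open>Exponent 0 is congruent to \<open>- s x\<close>. Equality would make
      \<open>p - 1\<close> divide \<open>K * (e x j + s x)\<close>, which is positive but too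
      small.\<close>
    have no0: "\<not> [K * e x 0 = K * e x j] (mod (p - 1))" if x: "x \<in> ?X" and j: "j \<in> {1..<N}" for x j
    proof
      assume "[K * e x 0 = K * e x j] (mod (p - 1))"
      then have "[K * e x 0 + K * s x = K * e x j + K * s x] (mod (p - 1))" by (intro cong_add cong_refl)
      moreover have "e x 0 + s x = p - 1" using big[OF x] e0[of x] by simp
      then have "K * e x 0 + K * s x = K * (p - 1)" by (simp only: distrib_left[symmetric])
      ultimately have "[0 = K * (e x j + s x)] (mod (p - 1))"
        by (simp add: distrib_left cong_def)
      then have "p - 1 dvd K * (e x j + s x)" by (metis cong_0_iff cong_sym)
      moreover have "K * (e x j + s x) > 0" using K s_pos[of x] by simp
      ultimately have "p - 1 \<le> K * (e x j + s x)" by (rule dvd_imp_le)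
      also have "\<dots> < K * (N * N * h)"
        using K big(1)[OF x] e_pos(3)[OF x j] by simp
      also have "\<dots> \<le> p - 1" using big(2)[OF x] by (simp add: mult_ac)
      finally show False by simp
    qed
    have sep: "i = j" if x: "x \<in> ?X" and i: "i < N" and j: "j < N"
      and c: "[(int g ^ e x i) ^ K = (int g ^ e x j) ^ K] (mod int p)" for x i j
    proof -
      have c': "[K * e x i = K * e x j] (mod (p - 1))"
        using c by (simp add: g_cong mult.commute flip: power_mult)
      show ?thesis
      proof (cases "i = 0 \<or> j = 0")
        case True
        show ?thesis
        proof (rule ccontr)
          assume "i \<noteq> j"
          then show False using True c' cong_sym[OF c'] no0[OF x, of i] no0[OF x, of j] i j by auto
        qed
      next
        case False
        \<comment> \<open>Below the modulus \<open>p - 1\<close> congruent exponents are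
          equal.\<close>
        have "K * e x k < p - 1" if "k \<in> {1..<N}" for k
        proof -
          have "K * e x k < K * (N * h)" using K e_pos(3)[OF x that] by simp
          also have "K * (N * h) \<le> K * (N * h) * (N * 2)" using N by simp
          also have "\<dots> \<le> p - 1" using big(2)[OF x] by (simp add: mult_ac)
          finally show ?thesis .
        qed
        then have "K * e x i = K * e x j" using c' False i j by (simp add: cong_def)
        then have "e x i = e x j" using K by simp
        then show ?thesis using dist[OF x x, of i j] False i j by simp
      qed
    qed
    have "f ` ?X \<subseteq> split_polys N K (int p)"
    proof
      fix q assume "q \<in> f ` ?X"
      then obtain x where x: "x \<in> ?X" "q = f x" by blast
      have "(\<Sum>i<N. e x i) = e x 0 + (\<Sum>i=1..<N. e x i)"
        using N by (subst lessThan_atLeast0, subst sum.atLeast_Suc_lessThan) auto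
      also have "(\<Sum>i=1..<N. e x i) = s x" unfolding s_def by (intro sum.cong) (auto simp: e_def)
      also have "e x 0 + s x = p - 1" using e0[of x] big[OF x(1)] by simp
      finally have "(\<Prod>i<N. int g ^ e x i) = int g ^ (p - 1)" by (simp flip: power_sum)
      moreover have "[int g ^ (p - 1) = int g ^ 0] (mod int p)" by (subst g_cong) (simp add: cong_def)
      ultimately show "q \<in> split_polys N K (int p)"
        unfolding split_polys_def x(2) f_def using sep[OF x(1)] by auto
    qed
    moreover have "inj_on f ?X"
    proof (rule inj_onI)
      fix x y assume x: "x \<in> ?X" and y: "y \<in> ?X" and eq: "f x = f y"
      show "x = y"
      proof (rule PiE_ext[OF x y])
        fix i assume i: "i \<in> {1..<N}"
        let ?a = "int g ^ e x i"
        have "poly (\<Prod>i<N. [:- (int g ^ e x i), 1:]) ?a = 0" using i by (auto simp: poly_prod)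
        then have "int p dvd poly (\<Prod>i<N. [:- (int g ^ e y i), 1:]) ?a"
          using poly_mod_cong[OF eq[unfolded f_def], of ?a] by (simp add: cong_iff_dvd_diff)
        then obtain j where j: "j < N" "int p dvd ?a - int g ^ e y j"
          using p by (auto simp: poly_prod prime_dvd_prod_iff)
        then have "[?a = int g ^ e y j] (mod int p)" by (simp add: cong_iff_dvd_diff)
        then have "[e x i = e y j] (mod (p - 1))" by (simp only: g_cong)
        then have eq: "e x i = e y j"
          using e_lt[OF x, of i] e_lt[OF y, of j] i j by (simp add: cong_def)
        \<comment> \<open>The adjusted exponent lies above all windows, so it cannot match an
          exponent from a window.\<close>
        have "j \<noteq> 0"
        proof
          assume "j = 0"
          then have "(p - 1) - s y < N * h" using eq e0[of y] e_pos(3)[OF x i] by simp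
          then show False using big[OF y] by linarith
        qed
        then have "j \<in> {1..<N}" using j by simp
        then have "i = j" using dist[OF x y i _ eq] by simp
        then show "x i = y i" using eq i by (simp add: e_def)
      qed
    qed
    moreover have "finite (split_polys N K (int p))"
      using split_polys_SL[of "int p" N K] finite_SL_polys[of "int p" N] p1 finite_subset by auto
    ultimately have "card ?X \<le> card (split_polys N K (int p))" by (intro card_inj_on_le)
    then show ?thesis by (simp add: card_PiE h_def)
  qed
qed

subsection \<open>Centralisers of powers\<close>

lemma pow_mat_Suc_left:
  assumes "A \<in> carrier_mat n n"
  shows "A ^\<^sub>m Suc k = A * A ^\<^sub>m k"
proof (induction k)
  case (Suc k)
  have "A ^\<^sub>m Suc (Suc k) = A * A ^\<^sub>m k * A" using Suc by simp
  also have "\<dots> = A * (A ^\<^sub>m k * A)" using assms by (intro assoc_mult_mat[of _ n n _ n _ n]) auto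
  finally show ?case by simp
qed (use assms in auto)

lemma pow_mat_add:
  assumes "A \<in> carrier_mat n n"
  shows "A ^\<^sub>m (k + l) = A ^\<^sub>m k * A ^\<^sub>m l"
proof (induction l)
  case (Suc l)
  have "A ^\<^sub>m (k + Suc l) = A ^\<^sub>m k * A ^\<^sub>m l * A" using Suc by simp
  also have "\<dots> = A ^\<^sub>m k * (A ^\<^sub>m l * A)" using assms by (intro assoc_mult_mat[of _ n n _ n _ n]) auto
  finally show ?case by simp
qed (use assms in auto)

lemma pow_mat_mult:
  assumes "A \<in> carrier_mat n n"
  shows "A ^\<^sub>m (k * l) = (A ^\<^sub>m k) ^\<^sub>m l"
proof (induction l)
  case (Suc l)
  have "A ^\<^sub>m (k * Suc l) = A ^\<^sub>m (k * l + k)" by (simp add: add.commute)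
  then show ?case using Suc by (simp add: pow_mat_add[OF assms])
qed (use assms in auto)

lemma pow_mat_one: "1\<^sub>m n ^\<^sub>m k = 1\<^sub>m n"
  by (induction k) auto

lemma pow_mat_inverse:
  assumes "A \<in> carrier_mat n n" "B \<in> carrier_mat n n" "A * B = 1\<^sub>m n"
  shows "A ^\<^sub>m k * B ^\<^sub>m k = 1\<^sub>m n"
proof (induction k)
  case (Suc k)
  have "A ^\<^sub>m Suc k * B ^\<^sub>m Suc k = (A ^\<^sub>m k * A) * (B * B ^\<^sub>m k)"
    unfolding pow_mat_Suc_left[OF assms(2)] by simp
  also have "\<dots> = A ^\<^sub>m k * (A * (B * B ^\<^sub>m k))"
    using assms by (intro assoc_mult_mat[of _ n n _ n _ n]) auto
  also have "A * (B * B ^\<^sub>m k) = (A * B) * B ^\<^sub>m k"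
    using assms by (intro assoc_mult_mat[symmetric, of _ n n _ n _ n]) auto
  finally show ?case using assms Suc by simp
qed (use assms in auto)

lemma SL_int_pow: "A \<in> SL_int N \<Longrightarrow> A ^\<^sub>m k \<in> SL_int N"
  by (induction k) (auto simp: SL_int_def det_mult[of _ N])

text \<open>By pigeonhole every matrix has a period at most the number of residue matrices. The
  factorial of that number is a multiple of all these periods, so \<open>K\<close> is uniform in
  \<open>A\<close>.\<close>

lemma exists_exponent_mod:
  assumes m: "m > (0 :: int)"
  shows "\<exists>K>0. \<forall>A\<in>SL_int N. mat_mod m (A ^\<^sub>m K) = mat_mod m (1\<^sub>m N)"
proof -
  define Q where "Q = {A \<in> carrier_mat N N. mat_mod m A = A}"
  define n where "n = card Q"
  have finQ: "finite Q" unfolding Q_def by (rule finite_mat_mod_range[OF m])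
  have "mat_mod m (A ^\<^sub>m fact n) = mat_mod m (1\<^sub>m N)" if A: "A \<in> SL_int N" for A
  proof -
    have Ac: "A \<in> carrier_mat N N" using A by (rule SL_int_carrier)
    obtain B where B: "B \<in> SL_int N" "A * B = 1\<^sub>m N" "B * A = 1\<^sub>m N" using SL_int_inverse[OF A] by blast
    have Bc: "B \<in> carrier_mat N N" using B by (intro SL_int_carrier)
    have "\<not> inj_on (\<lambda>i. mat_mod m (A ^\<^sub>m i)) {..n}"
    proof
      assume "inj_on (\<lambda>i. mat_mod m (A ^\<^sub>m i)) {..n}"
      moreover have "(\<lambda>i. mat_mod m (A ^\<^sub>m i)) ` {..n} \<subseteq> Q" using Ac by (auto simp: Q_def)
      ultimately have "card {..n} \<le> card Q" using finQ by (intro card_inj_on_le)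
      then show False by (simp add: n_def)
    qed
    then obtain i j where ij: "i \<le> n" "j \<le> n" "i < j" "mat_mod m (A ^\<^sub>m i) = mat_mod m (A ^\<^sub>m j)"
      unfolding inj_on_def by (metis atMost_iff linorder_neqE_nat)
    define r where "r = j - i"
    have r: "0 < r" "r \<le> n" using ij by (auto simp: r_def)
    have "mat_mod m (B ^\<^sub>m i * A ^\<^sub>m i) = mat_mod m (B ^\<^sub>m i * A ^\<^sub>m j)"
      using Ac Bc ij by (intro mat_mod_mult_cong[of _ N N _ _ N]) auto
    moreover have "B ^\<^sub>m i * A ^\<^sub>m j = A ^\<^sub>m r"
    proof -
      have "A ^\<^sub>m j = A ^\<^sub>m i * A ^\<^sub>m r" using pow_mat_add[OF Ac, of i r] ij by (simp add: r_def)
      then have "B ^\<^sub>m i * A ^\<^sub>m j = (B ^\<^sub>m i * A ^\<^sub>m i) * A ^\<^sub>m r"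
        using Ac Bc by (simp add: assoc_mult_mat[of _ N N _ N _ N])
      then show ?thesis using pow_mat_inverse[OF Bc Ac B(3)] Ac by simp
    qed
    ultimately have "mat_mod m (A ^\<^sub>m r) = mat_mod m (1\<^sub>m N)"
      using pow_mat_inverse[OF Bc Ac B(3)] by simp
    then have "mat_mod m ((A ^\<^sub>m r) ^\<^sub>m (fact n div r)) = mat_mod m (1\<^sub>m N ^\<^sub>m (fact n div r))"
      using Ac by (intro mat_mod_pow_cong[of _ N]) auto
    moreover have "r dvd fact n" using r by (simp add: dvd_fact)
    ultimately show ?thesis using pow_mat_mult[OF Ac, of r "fact n div r"] by (simp add: pow_mat_one)
  qed
  then show ?thesis by (intro exI[of _ "fact n"]) auto
qed

text \<open>Conjugation by \<open>v\<close> is trivial modulo \<open>l\<close>. If \<open>Y = v X v\<^sup>-\<^sup>1 - X\<close> is divisible by \<open>l\<^sup>a\<close>, then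
  so are its conjugates, which sum to \<open>v\<^sup>k X v\<^sup>-\<^sup>k - X = 0\<close>; modulo \<open>l\<^sup>a\<^sup>+\<^sup>1\<close> this sum is \<open>k Y\<close>.\<close>

lemma commutes_if_pow_commutes_mod:
  assumes v: "v \<in> SL_int N" and X: "X \<in> carrier_mat N N"
    and v1: "mat_mod l v = mat_mod l (1\<^sub>m N)" and l: "prime l" and k: "\<not> l dvd int k"
    and comm: "v ^\<^sub>m k * X = X * v ^\<^sub>m k"
  shows "v * X = X * v"
proof -
  have vc: "v \<in> carrier_mat N N" using v by (rule SL_int_carrier)
  obtain u where u: "u \<in> SL_int N" "v * u = 1\<^sub>m N" "u * v = 1\<^sub>m N" using SL_int_inverse[OF v] by blast
  have uc: "u \<in> carrier_mat N N" using u by (intro SL_int_carrier)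
  define \<phi> where "\<phi> = (\<lambda>i Z. v ^\<^sub>m i * Z * u ^\<^sub>m i)"
  have \<phi>c: "\<phi> i Z \<in> carrier_mat N N" if "Z \<in> carrier_mat N N" for i Z
    unfolding \<phi>_def using vc uc that by (intro mult_carrier_mat[of _ N N _ N] pow_carrier_mat)
  note dim = \<phi>c[THEN carrier_matD(1)] \<phi>c[THEN carrier_matD(2)]
  define Y where "Y = \<phi> 1 X - X"
  have Yc: "Y \<in> carrier_mat N N" unfolding Y_def by (rule minus_carrier_mat[OF X])
  have \<phi>_Y: "\<phi> i Y = \<phi> (Suc i) X - \<phi> i X" for i
  proof -
    have "\<phi> i Y = (v ^\<^sub>m i * \<phi> 1 X - v ^\<^sub>m i * X) * u ^\<^sub>m i"
      unfolding \<phi>_def Y_def using vc uc X by (subst mult_minus_distrib_mat[of _ N N _ N]) (auto simp: \<phi>_def)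
    also have "\<dots> = v ^\<^sub>m i * \<phi> 1 X * u ^\<^sub>m i - \<phi> i X"
      unfolding \<phi>_def using vc uc X by (subst minus_mult_distrib_mat[of _ N N _ _ N]) auto
    also have "v ^\<^sub>m i * \<phi> 1 X * u ^\<^sub>m i = (v ^\<^sub>m i * v) * X * (u * u ^\<^sub>m i)"
      using vc uc X by (simp add: \<phi>_def assoc_mult_mat[of _ N N _ N _ N])
    also have "\<dots> = \<phi> (Suc i) X"
      unfolding \<phi>_def pow_mat_Suc_left[OF uc] by simp
    finally show ?thesis .
  qed
  have \<phi>_mod: "mat_mod l (\<phi> i Z) = mat_mod l Z" if Z: "Z \<in> carrier_mat N N" for i Z
  proof -
    have "mat_mod l (v ^\<^sub>m i) = mat_mod l (1\<^sub>m N)"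
      using mat_mod_pow_cong[OF vc _ v1, of i] by (simp add: pow_mat_one)
    moreover have "mat_mod l (u ^\<^sub>m i) = mat_mod l (1\<^sub>m N)"
    proof -
      have "mat_mod l (u * v) = mat_mod l (u * 1\<^sub>m N)"
        using uc vc v1 by (intro mat_mod_mult_cong[of _ N N _ _ N]) auto
      then have "mat_mod l u = mat_mod l (1\<^sub>m N)" using u uc by simp
      then show ?thesis using mat_mod_pow_cong[OF uc, of "1\<^sub>m N" l i] by (simp add: pow_mat_one)
    qed
    ultimately have "mat_mod l (\<phi> i Z) = mat_mod l (1\<^sub>m N * Z * 1\<^sub>m N)"
      unfolding \<phi>_def using vc uc Z by (intro mat_mod_mult_cong[of _ N N _ _ N]) auto
    then show ?thesis using Z by simp
  qed
  have \<phi>k: "\<phi> k X = X"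
  proof -
    have "\<phi> k X = X * (v ^\<^sub>m k * u ^\<^sub>m k)"
      unfolding \<phi>_def comm using X vc uc by (intro assoc_mult_mat[of _ N N _ N _ N]) auto
    then show ?thesis using pow_mat_inverse[OF vc uc u(2)] X by simp
  qed
  have sum0: "(\<Sum>i<k. \<phi> i Y $$ (r,c)) = 0" if rc: "r < N" "c < N" for r c
  proof -
    have "\<phi> i Y $$ (r,c) = \<phi> (Suc i) X $$ (r,c) - \<phi> i X $$ (r,c)" for i
      using \<phi>_Y[of i] dim[OF X] rc by simp
    then have "(\<Sum>i<k. \<phi> i Y $$ (r,c)) = \<phi> k X $$ (r,c) - \<phi> 0 X $$ (r,c)"
      by (simp add: sum_lessThan_telescope[of "\<lambda>i. \<phi> i X $$ (r,c)"])
    also have "\<phi> 0 X = X" using X vc uc by (simp add: \<phi>_def)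
    finally show ?thesis using \<phi>k by simp
  qed
  have div: "\<forall>r<N. \<forall>c<N. l ^ a dvd Y $$ (r,c)" for a
  proof (induction a)
    case (Suc a)
    define Z where "Z = map_mat (\<lambda>y. y div l ^ a) Y"
    have Zc: "Z \<in> carrier_mat N N" using Yc by (simp add: Z_def)
    have YZ: "Y = l ^ a \<cdot>\<^sub>m Z" using Suc Yc by (intro eq_matI) (auto simp: Z_def)
    show ?case
    proof (intro allI impI)
      fix r c assume rc: "r < N" "c < N"
      have "\<phi> i Y = l ^ a \<cdot>\<^sub>m \<phi> i Z" for i
        unfolding \<phi>_def YZ using vc uc Zc
        by (subst mult_smult_distrib[of _ N N _ N]) (auto intro!: mult_smult_assoc_mat[of _ N N _ N])
      then have "l ^ a * (\<Sum>i<k. \<phi> i Z $$ (r,c)) = 0"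
        using sum0[OF rc] dim[OF Zc] rc by (simp add: sum_distrib_left)
      then have "(\<Sum>i<k. \<phi> i Z $$ (r,c)) = 0" using l by auto
      moreover have "[(\<Sum>i<k. \<phi> i Z $$ (r,c)) = (\<Sum>i<k. Z $$ (r,c))] (mod l)"
        using \<phi>_mod[OF Zc] \<phi>c[OF Zc] Zc rc by (intro cong_sum) (simp add: mat_mod_eq_iff[of _ N N])
      ultimately have "l dvd int k * Z $$ (r,c)" by (simp add: cong_iff_dvd_diff)
      then have "l dvd Z $$ (r,c)" using l k by (simp add: prime_dvd_mult_iff)
      then show "l ^ Suc a dvd Y $$ (r,c)" using YZ Zc rc by (simp add: mult.commute mult_dvd_mono)
    qed
  qed simp
  \<comment> \<open>A nonzero entry \<open>y\<close> would be divisible by \<open>l\<close> to the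
    power \<open>\<bar>y\<bar>\<close>, which exceeds \<open>\<bar>y\<bar>\<close>.\<close>
  have "Y $$ (r,c) = 0" if rc: "r < N" "c < N" for r c
  proof (rule ccontr)
    let ?y = "Y $$ (r,c)"
    assume "?y \<noteq> 0"
    then have "l ^ nat \<bar>?y\<bar> \<le> \<bar>?y\<bar>" using div[of "nat \<bar>?y\<bar>"] rc by (metis dvd_imp_le_int abs_of_nonneg l prime_ge_0_int zero_le_power)
    moreover have "int n < l ^ n" for n
    proof -
      have "int n < 2 ^ n" by (metis of_nat_less_two_power)
      also have "(2 :: int) ^ n \<le> l ^ n" using l by (intro power_mono) (auto simp: prime_ge_2_int)
      finally show ?thesis .
    qed
    ultimately show False by (metis abs_ge_zero int_nat_eq not_less)
  qed
  then have "\<phi> 1 X = X"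
    using Yc \<phi>c[OF X, of 1] X by (intro eq_matI) (auto simp: Y_def simp del: One_nat_def)
  then have "v * X * u = X" using vc uc by (simp add: \<phi>_def)
  then have "X * v = v * X * u * v" by simp
  also have "\<dots> = v * X * (u * v)" using vc uc X by (intro assoc_mult_mat[of _ N N _ N _ N]) auto
  finally show ?thesis using u vc X by simp
qed

text \<open>A single prime \<open>l\<close> only removes exponents not divisible by
  \<open>l\<close>. Writing \<open>k = 3^s * r\<close>, the prime 3 removes \<open>r\<close> and the
  prime 5 then removes \<open>3^s\<close>; hence the modulus 15.\<close>

lemma commutes_if_pow_commutes:
  assumes v: "v \<in> SL_int N" and X: "X \<in> carrier_mat N N"
    and v1: "mat_mod 15 v = mat_mod 15 (1\<^sub>m N)" and k: "k > 0"
    and comm: "v ^\<^sub>m k * X = X * v ^\<^sub>m k"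
  shows "v * X = X * v"
proof -
  have vc: "v \<in> carrier_mat N N" using v by (rule SL_int_carrier)
  have mod: "mat_mod l (v ^\<^sub>m i) = mat_mod l (1\<^sub>m N)" if "l dvd 15" for l i
  proof -
    have "mat_mod l v = mat_mod l (1\<^sub>m N)"
      using arg_cong[OF v1, of "mat_mod l"] that by (simp add: mat_mod_mod_dvd)
    then show ?thesis using mat_mod_pow_cong[OF vc, of "1\<^sub>m N" l i] by (simp add: pow_mat_one)
  qed
  define s where "s = multiplicity 3 k"
  obtain r where r: "k = 3 ^ s * r" "\<not> 3 dvd r"
    using k multiplicity_decompose'[of k 3] unfolding s_def by auto
  have "(v ^\<^sub>m 3 ^ s) ^\<^sub>m r * X = X * (v ^\<^sub>m 3 ^ s) ^\<^sub>m r"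
    using comm pow_mat_mult[OF vc, of "3 ^ s" r] r by simp
  then have "v ^\<^sub>m 3 ^ s * X = X * v ^\<^sub>m 3 ^ s"
  proof (rule commutes_if_pow_commutes_mod[OF SL_int_pow[OF v] X, rotated -1])
    show "mat_mod 3 (v ^\<^sub>m 3 ^ s) = mat_mod 3 (1\<^sub>m N)" by (rule mod) simp
    show "\<not> (3 :: int) dvd int r" using r(2) by presburger
  qed simp
  then show ?thesis
  proof (rule commutes_if_pow_commutes_mod[OF v X, rotated -1])
    show "mat_mod 5 v = mat_mod 5 (1\<^sub>m N)" using mod[of 5 1] vc by simp
    show "\<not> (5 :: int) dvd int (3 ^ s)"
    proof
      assume "(5 :: int) dvd int (3 ^ s)"
      then have "(5 :: int) dvd 3" using prime_dvd_power[of "5 :: int" 3 s] by simp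
      then show False by simp
    qed
  qed simp
qed

subsection \<open>Irreducible integer polynomials and complex roots\<close>

abbreviation cpoly :: "int poly \<Rightarrow> complex poly" where "cpoly \<equiv> map_poly of_int"
abbreviation cmat :: "int mat \<Rightarrow> complex mat" where "cmat \<equiv> map_mat of_int"

text \<open>A nonzero integer polynomial \<open>m\<close> of least degree vanishing at
  \<open>z\<close> divides, up to constants, every integer polynomial vanishing there. As
  \<open>f\<close> is a prime element of positive degree, it divides no nonzero constant; so it
  divides \<open>m\<close>, and then \<open>h\<close>.\<close>

lemma irreducible_int_poly_common_root:
  fixes f h :: "int poly"
  assumes f: "irreducible f" and root: "poly (cpoly f) z = 0" "poly (cpoly h) z = 0"
  shows "f dvd h"
proof (cases "h = 0")
  case False
  have f0: "f \<noteq> 0" using f by auto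
  have deg_pos: "degree q > 0" if "q \<noteq> 0" "poly (cpoly q) z = 0" for q
  proof (rule ccontr)
    assume "\<not> degree q > 0"
    then obtain c where "q = [:c:]" by (metis degree_eq_zeroE neq0_conv)
    then show False using that by simp
  qed
  have prime: "prime_elem f" using f by (rule irreducible_imp_prime_elem)
  define P where "P = (\<lambda>q. q \<noteq> 0 \<and> poly (cpoly q) z = 0)"
  define m where "m = arg_min degree P"
  have m: "P m" "\<And>q. P q \<Longrightarrow> degree m \<le> degree q"
    using arg_min_natI[of P f degree] arg_min_nat_le[of P _ degree] f0 root by (auto simp: m_def P_def)
  have dvd: "f dvd g" if fg: "f dvd r * g" and r: "r \<noteq> 0" "degree r = 0" for r g
  proof -
    have "\<not> f dvd r"
      using deg_pos[OF f0 root(1)] r divides_degree[of f r] by auto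
    then show ?thesis using prime_elem_dvd_mult_iff[OF prime] fg by blast
  qed
  \<comment> \<open>Pseudo-division stays inside the integers at the price of the constant
    \<open>c\<close>; minimality of the degree kills the remainder.\<close>
  have pdiv: "\<exists>c q. c \<noteq> 0 \<and> Polynomial.smult c g = m * q" if g: "poly (cpoly g) z = 0" for g
  proof -
    have m0: "m \<noteq> 0" using m(1) by (simp add: P_def)
    obtain c q where cq: "c \<noteq> 0" "Polynomial.smult c g = m * q + pseudo_mod g m"
      using pseudo_mod(1)[OF m0, of g] by auto
    have "[:c:] * g = m * q + pseudo_mod g m" using cq(2) by simp
    then have "poly (cpoly ([:c:] * g)) z = poly (cpoly (m * q + pseudo_mod g m)) z" by (simp only:)
    then have root: "poly (cpoly (pseudo_mod g m)) z = 0"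
      unfolding of_int_poly_hom.hom_add of_int_poly_hom.hom_mult
      using g m(1) by (simp add: P_def)
    have "pseudo_mod g m = 0"
    proof (rule ccontr)
      assume "pseudo_mod g m \<noteq> 0"
      then have "P (pseudo_mod g m)" using root by (simp add: P_def)
      then have "degree m \<le> degree (pseudo_mod g m)" by (rule m(2))
      then show False using pseudo_mod(2)[OF m0, of g] \<open>pseudo_mod g m \<noteq> 0\<close> by linarith
    qed
    then show ?thesis using cq by auto
  qed
  obtain c q where cq: "c \<noteq> 0" "Polynomial.smult c f = m * q" using pdiv[OF root(1)] by blast
  have "f dvd m"
  proof -
    have "f dvd m * q" unfolding cq(2)[symmetric] by (rule dvd_smult) simp
    then consider "f dvd m" | "f dvd q" using prime_elem_dvd_mult_iff[OF prime] by blast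
    then show ?thesis
    proof cases
      case 2
      \<comment> \<open>Cancelling \<open>f\<close> would make \<open>m\<close> a divisor of a
        constant, but it has a root.\<close>
      then obtain q' where q': "q = f * q'" by blast
      have "f * [:c:] = f * (m * q')" using cq(2) q' by (simp add: mult_ac)
      then have "[:c:] = m * q'" using f0 mult_left_cancel by blast
      then have "degree [:c:] = degree m + degree q'" using cq(1)
        by (metis degree_mult_eq mult_eq_0_iff pCons_eq_0_iff)
      then have "degree m = 0" by simp
      then show ?thesis using deg_pos[of m] m(1) by (simp add: P_def)
    qed
  qed
  moreover obtain c' q' where c': "c' \<noteq> 0" "Polynomial.smult c' h = m * q'" using pdiv[OF root(2)] by blast
  ultimately have "f dvd [:c':] * h" by simp
  then show ?thesis by (rule dvd) (use c' in auto)
qed auto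

text \<open>Substituting \<open>X^k\<close> turns a factor of the characteristic polynomial of a
  \<open>k\<close>-th power into a polynomial with roots among the eigenvalues of the original
  matrix, where divisibility by its characteristic polynomial can be used.\<close>

lemma poly_pcompose_monom:
  fixes g :: "'a :: comm_semiring_1 poly"
  shows "poly (pcompose g (monom 1 k)) x = poly g (x ^ k)"
  by (simp add: poly_pcompose poly_monom)

lemma cpoly_pcompose_monom_root:
  "poly (cpoly (pcompose g (monom 1 k))) z = poly (cpoly g) (z ^ k)"
proof -
  have "cpoly (pcompose g (monom 1 k)) = pcompose (cpoly g) (monom 1 k)"
    by (simp add: of_int_hom.map_poly_pcompose)
  then show ?thesis by (simp add: poly_pcompose poly_monom)
qed

lemma irreducible_monic_intI:
  fixes f :: "int poly"
  assumes monic: "lead_coeff f = 1" and deg: "degree f > 0"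
    and no: "\<And>g h. f = g * h \<Longrightarrow> lead_coeff g = 1 \<Longrightarrow> lead_coeff h = 1 \<Longrightarrow> degree g > 0 \<Longrightarrow> degree h > 0 \<Longrightarrow> False"
  shows "irreducible f"
proof (rule irreducibleI)
  show "f \<noteq> 0" using deg by auto
  show "\<not> is_unit f" using deg by (auto simp: is_unit_poly_iff)
next
  fix a b assume ab: "f = a * b"
  have lc: "lead_coeff a * lead_coeff b = 1" using monic ab by (simp add: lead_coeff_mult)
  then consider "lead_coeff a = 1" "lead_coeff b = 1" | "lead_coeff a = -1" "lead_coeff b = -1"
    by (auto simp: zmult_eq_1_iff)
  then obtain g h where gh: "f = g * h" "lead_coeff g = 1" "lead_coeff h = 1"
    "degree g = degree a" "degree h = degree b"
  proof cases
    case 1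
    then show ?thesis using that ab by blast
  next
    case 2
    then show ?thesis using that[of "- a" "- b"] ab by simp
  qed
  then consider "degree a = 0" | "degree b = 0" using no[OF gh(1-3)] by auto
  then show "is_unit a \<or> is_unit b"
  proof cases
    case 1
    then obtain c where "a = [:c:]" by (metis degree_eq_zeroE)
    then have "is_unit a" using lc by (auto simp: is_unit_const_poly_iff zmult_eq_1_iff)
    then show ?thesis ..
  next
    case 2
    then obtain c where "b = [:c:]" by (metis degree_eq_zeroE)
    then have "is_unit b" using lc by (auto simp: is_unit_const_poly_iff zmult_eq_1_iff)
    then show ?thesis ..
  qed
qed

lemma irreducible_int_poly_simple_root:
  fixes f :: "int poly"
  assumes f: "irreducible f" and "degree f > 0" and root: "poly (cpoly f) z = 0"
  shows "poly (pderiv (cpoly f)) z \<noteq> 0"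
proof
  assume "poly (pderiv (cpoly f)) z = 0"
  moreover have "pderiv (cpoly f) = cpoly (pderiv f)"
    by (simp add: of_int_hom.map_poly_pderiv)
  ultimately have "f dvd pderiv f" using irreducible_int_poly_common_root[OF f root, of "pderiv f"] by simp
  moreover have "pderiv f \<noteq> 0" using assms(2) by (simp add: pderiv_eq_0_iff)
  ultimately have "degree f \<le> degree (pderiv f)" by (rule dvd_imp_degree_le)
  then show False using assms(2) by (simp add: degree_pderiv)
qed

section \<open>Eigenvalues and eigenvectors of powers\<close>

lemma upper_triangular_pow:
  fixes A :: "'a :: comm_ring_1 mat"
  assumes A: "A \<in> carrier_mat n n" "upper_triangular A"
  shows "upper_triangular (A ^\<^sub>m k) \<and> (\<forall>i<n. (A ^\<^sub>m k) $$ (i,i) = (A $$ (i,i)) ^ k)"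
proof (induction k)
  case 0
  then show ?case using A by auto
next
  case (Suc k)
  let ?B = "A ^\<^sub>m k"
  have B: "?B \<in> carrier_mat n n" using A by simp
  have entry: "(?B * A) $$ (i,j) = (\<Sum>r<n. ?B $$ (i,r) * A $$ (r,j))" if "i < n" "j < n" for i j
    by (rule mat_mult_index_sum[OF B A(1) that])
  have z: "?B $$ (i,r) * A $$ (r,j) = 0" if "i < n" "r < n" "j < n" "r < i \<or> j < r" for i j r
  proof (cases "r < i")
    case True
    then have "?B $$ (i,r) = 0" using Suc B that by (auto simp: upper_triangular_def)
    then show ?thesis by simp
  next
    case False
    then have "A $$ (r,j) = 0" using A that by (auto simp: upper_triangular_def)
    then show ?thesis by simp
  qed
  have 1: "(?B * A) $$ (i,j) = 0" if "j < i" "i < n" for i j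
    using that by (subst entry) (auto intro!: sum.neutral z)
  have 2: "(?B * A) $$ (i,i) = ?B $$ (i,i) * A $$ (i,i)" if "i < n" for i
  proof -
    have "(?B * A) $$ (i,i) = (\<Sum>r<n. if r = i then ?B $$ (i,i) * A $$ (i,i) else 0)"
      unfolding entry[OF that that]
      using z that by (intro sum.cong) (auto simp: neq_iff)
    then show ?thesis using that by simp
  qed
  have "upper_triangular (?B * A)"
    using B by (intro upper_triangularI 1) auto
  then show ?case using 2 Suc by (simp add: mult.commute del: index_mult_mat)
qed

text \<open>One triangularisation serves all exponents, so the labelling \<open>d\<close> of the
  eigenvalues is the same for every \<open>k\<close>.\<close>

lemma char_poly_pow_factored:
  fixes A :: "complex mat"
  assumes A: "A \<in> carrier_mat n n"
  obtains d where "\<And>k. char_poly (A ^\<^sub>m k) = (\<Prod>i<n. [:- (d i ^ k), 1:])"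
proof -
  obtain es where "char_poly A = (\<Prod>a\<leftarrow>es. [:- a, 1:])" using char_poly_factorized[OF A] by blast
  then obtain B where B: "B \<in> carrier_mat n n" "upper_triangular B" "similar_mat A B"
    using schur_decomposition_exists[OF A] by blast
  obtain P Q where PQ: "similar_mat_wit A B P Q" using B(3) by (auto simp: similar_mat_def)
  have "char_poly (A ^\<^sub>m k) = (\<Prod>i<n. [:- (B $$ (i,i) ^ k), 1:])" for k
  proof -
    have "similar_mat (A ^\<^sub>m k) (B ^\<^sub>m k)"
      using similar_mat_wit_pow[OF PQ, of k] by (auto simp: similar_mat_def)
    then have "char_poly (A ^\<^sub>m k) = char_poly (B ^\<^sub>m k)" by (rule char_poly_similar)
    also have "\<dots> = (\<Prod>a\<leftarrow>diag_mat (B ^\<^sub>m k). [:- a, 1:])"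
      using upper_triangular_pow[OF B(1,2), of k] B by (intro char_poly_upper_triangular[of _ n]) auto
    also have "\<dots> = (\<Prod>i<n. [:- ((B ^\<^sub>m k) $$ (i,i)), 1:])"
      using B by (simp add: diag_mat_def o_def atLeast0LessThan[symmetric] flip: prod.distinct_set_conv_list)
    also have "\<dots> = (\<Prod>i<n. [:- (B $$ (i,i) ^ k), 1:])"
      using upper_triangular_pow[OF B(1,2), of k] by (intro prod.cong) auto
    finally show ?thesis .
  qed
  then show ?thesis by (rule that)
qed

lemma pow_mat_mult_eigenvector:
  fixes A :: "complex mat"
  assumes A: "A \<in> carrier_mat n n" and u: "u \<in> carrier_vec n" "A *\<^sub>v u = c \<cdot>\<^sub>v u"
  shows "A ^\<^sub>m k *\<^sub>v u = c ^ k \<cdot>\<^sub>v u"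
proof (induction k)
  case 0
  then show ?case using u A by auto
next
  case (Suc k)
  have "A ^\<^sub>m Suc k *\<^sub>v u = A ^\<^sub>m k *\<^sub>v (A *\<^sub>v u)" using A u by (simp add: assoc_mult_mat_vec[of _ n n _ n])
  also have "\<dots> = c \<cdot>\<^sub>v (A ^\<^sub>m k *\<^sub>v u)" using A u by (simp add: mult_mat_vec[of _ n n])
  finally show ?case using Suc u by (simp add: smult_smult_assoc mult.commute)
qed

lemma transpose_pow_mat:
  fixes A :: "'a :: comm_semiring_1 mat"
  assumes A: "A \<in> carrier_mat n n"
  shows "(A ^\<^sub>m k)\<^sup>T = A\<^sup>T ^\<^sub>m k"
proof (induction k)
  case 0
  then show ?case using A by auto
next
  case (Suc k)
  have "(A ^\<^sub>m k * A)\<^sup>T = A\<^sup>T * (A ^\<^sub>m k)\<^sup>T" using A by (intro transpose_mult[of _ n n _ n]) auto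
  also have "\<dots> = A\<^sup>T ^\<^sub>m Suc k" using Suc pow_mat_Suc_left[of "A\<^sup>T" n k] A by simp
  finally show ?case by simp
qed

text \<open>The complex numbers form a rational vector space, and a linear functional can be
  prescribed on the independent set \<open>{c}\<close>. Compatibility with integer factors lets it
  commute with multiplication by integer matrices.\<close>

lemma exists_additive_functional:
  fixes c :: complex
  assumes "c \<noteq> 0"
  obtains \<phi> :: "complex \<Rightarrow> rat" where "\<phi> c \<noteq> 0" "\<And>x y. \<phi> (x + y) = \<phi> x + \<phi> y" "\<And>n x. \<phi> (of_int n * x) = of_int n * \<phi> x"
proof -
  interpret vs: vector_space_pair "\<lambda>(q :: rat) (z :: complex). of_rat q * z" "\<lambda>(q :: rat) (x :: rat). q * x"
    by unfold_locales (auto simp: algebra_simps of_rat_add of_rat_mult)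
  have "vs.vs1.independent {c}" using assms by (simp add: vs.vs1.dependent_single)
  then obtain \<phi> where \<phi>: "Vector_Spaces.linear (\<lambda>(q :: rat) (z :: complex). of_rat q * z) (\<lambda>(q :: rat) (x :: rat). q * x) \<phi>" "\<forall>x\<in>{c}. \<phi> x = 1"
    using vs.linear_independent_extend[of "{c}" "\<lambda>_. 1"] by blast
  interpret l: Vector_Spaces.linear "\<lambda>(q :: rat) (z :: complex). of_rat q * z" "\<lambda>(q :: rat) (x :: rat). q * x" \<phi> by fact
  show ?thesis
  proof (rule that)
    show "\<phi> c \<noteq> 0" using \<phi>(2) by simp
    show "\<phi> (x + y) = \<phi> x + \<phi> y" for x y by (rule l.add)
    show "\<phi> (of_int n * x) = of_int n * \<phi> x" for n x using l.scale[of "of_int n" x] by simp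
  qed
qed

subsection \<open>Irreducibility of all powers\<close>

lemma common_denominator:
  fixes f :: "'b \<Rightarrow> rat"
  assumes "finite I"
  shows "\<exists>D > (0 :: int). \<forall>i\<in>I. \<exists>z :: int. of_int D * f i = of_int z"
  using assms
proof (induction I)
  case (insert x I)
  then obtain D where D: "D > 0" "\<forall>i\<in>I. \<exists>z :: int. of_int D * f i = of_int z" by blast
  obtain a b where ab: "quotient_of (f x) = (a, b)" by (cases "quotient_of (f x)")
  then have b: "b > 0" and fx: "f x = of_int a / of_int b"
    using quotient_of_denom_pos quotient_of_div by auto
  have "\<exists>z :: int. of_int (b * D) * f i = of_int z" if i: "i \<in> insert x I" for i
  proof -
    consider "i = x" | "i \<in> I" using i by blast
    then show ?thesis
    proof cases
      case 1
      then have "of_int (b * D) * f i = (of_int (D * a) :: rat)" using b fx by simp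
      then show ?thesis ..
    next
      case 2
      then obtain z where "of_int D * f i = (of_int z :: rat)" using D by blast
      then have "of_int (b * D) * f i = (of_int (b * z) :: rat)" by (simp add: mult.assoc)
      then show ?thesis ..
    qed
  qed
  then show ?case using b D by (intro exI[of _ "b * D"]) simp
qed (auto intro: exI[of _ 1])

text \<open>If \<open>u\<close> is a right eigenvector for \<open>\<alpha>\<close> and \<open>y\<close> a left eigenvector for \<open>\<beta>\<close>, the matrix
  \<open>u y\<^sup>T\<close> commutes with \<open>A\<^sup>k\<close> iff \<open>\<alpha>\<^sup>k = \<beta>\<^sup>k\<close>. A rational functional applied to its entries makes it
  an integer matrix.\<close>

lemma eigenvalue_pow_eq:
  assumes A: "A \<in> SL_int N" and K: "mat_mod 15 (A ^\<^sub>m K) = mat_mod 15 (1\<^sub>m N)"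
    and roots: "poly (cpoly (char_poly A)) \<alpha> = 0" "poly (cpoly (char_poly A)) \<beta> = 0"
    and k: "k > 0" "\<alpha> ^ k = \<beta> ^ k"
  shows "\<alpha> ^ K = \<beta> ^ K"
proof (rule ccontr)
  assume ne: "\<alpha> ^ K \<noteq> \<beta> ^ K"
  have Ac: "A \<in> carrier_mat N N" using A by (rule SL_int_carrier)
  have Cc: "cmat A \<in> carrier_mat N N" "(cmat A)\<^sup>T \<in> carrier_mat N N" using Ac by auto
  have cp: "char_poly (cmat A) = cpoly (char_poly A)" by (rule of_int_hom.char_poly_hom[OF Ac])
  have "eigenvalue (cmat A) \<alpha>" using eigenvalue_root_char_poly[OF Cc(1)] roots cp by simp
  then obtain u where u: "u \<in> carrier_vec N" "u \<noteq> 0\<^sub>v N" "cmat A *\<^sub>v u = \<alpha> \<cdot>\<^sub>v u"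
    using Ac by (auto simp: eigenvalue_def eigenvector_def)
  have "eigenvalue ((cmat A)\<^sup>T) \<beta>"
    using eigenvalue_root_char_poly[OF Cc(2)] char_poly_transpose_mat[OF Cc(1)] roots cp by simp
  then obtain y where y: "y \<in> carrier_vec N" "y \<noteq> 0\<^sub>v N" "(cmat A)\<^sup>T *\<^sub>v y = \<beta> \<cdot>\<^sub>v y"
    using Ac by (auto simp: eigenvalue_def eigenvector_def)
  have pow: "cmat A ^\<^sub>m j = cmat (A ^\<^sub>m j)" for j by (rule of_int_hom.mat_hom_pow[OF Ac, symmetric])
  have hu: "(\<Sum>r<N. of_int ((A ^\<^sub>m j) $$ (i,r)) * u $ r) = \<alpha> ^ j * u $ i" if "i < N" for i j
  proof -
    have "(cmat (A ^\<^sub>m j) *\<^sub>v u) $ i = (\<alpha> ^ j \<cdot>\<^sub>v u) $ i"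
      using pow_mat_mult_eigenvector[OF Cc(1) u(1,3), of j] by (simp add: pow)
    then show ?thesis using that Ac u by (simp add: scalar_prod_def atLeast0LessThan)
  qed
  have hy: "(\<Sum>r<N. y $ r * of_int ((A ^\<^sub>m j) $$ (r,i))) = \<beta> ^ j * y $ i" if "i < N" for i j
  proof -
    have "((cmat (A ^\<^sub>m j))\<^sup>T *\<^sub>v y) $ i = (\<beta> ^ j \<cdot>\<^sub>v y) $ i"
      using pow_mat_mult_eigenvector[OF Cc(2) y(1,3), of j] by (simp add: transpose_pow_mat[OF Cc(1), symmetric] pow)
    then show ?thesis using that Ac y by (simp add: scalar_prod_def atLeast0LessThan mult.commute)
  qed
  obtain a where a: "a < N" "u $ a \<noteq> 0" using u by (metis carrier_vecD eq_vecI index_zero_vec)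
  obtain b where b: "b < N" "y $ b \<noteq> 0" using y by (metis carrier_vecD eq_vecI index_zero_vec)
  \<comment> \<open>This is the entry at \<open>(a, b)\<close> of the commutator of the
    \<open>K\<close>-th power with the rank one matrix. A functional that is nonzero on it preserves
    the failure to commute.\<close>
  define c where "c = (\<alpha> ^ K - \<beta> ^ K) * (u $ a * y $ b)"
  have "c \<noteq> 0" using a b ne by (simp add: c_def)
  then obtain \<phi> :: "complex \<Rightarrow> rat" where \<phi>: "\<phi> c \<noteq> 0" "\<And>x y. \<phi> (x + y) = \<phi> x + \<phi> y" "\<And>n x. \<phi> (of_int n * x) = of_int n * \<phi> x"
    using exists_additive_functional by metis
  have \<phi>0: "\<phi> 0 = 0" using \<phi>(2)[of 0 0] by simp
  have \<phi>_sum: "\<phi> (sum f I) = (\<Sum>i\<in>I. \<phi> (f i))" for f :: "nat \<Rightarrow> complex" and I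
    by (induction I rule: infinite_finite_induct) (auto simp: \<phi>0 \<phi>(2))
  obtain D :: int where D: "D > 0" "\<forall>z\<in>{..<N} \<times> {..<N}. \<exists>w :: int. of_int D * \<phi> (u $ fst z * y $ snd z) = of_int w"
    using common_denominator[of "{..<N} \<times> {..<N}" "\<lambda>z. \<phi> (u $ fst z * y $ snd z)"] by auto
  then obtain w where w: "\<And>z. z \<in> {..<N} \<times> {..<N} \<Longrightarrow> of_int (w z) = of_int D * \<phi> (u $ fst z * y $ snd z)" by metis
  \<comment> \<open>\<open>X\<close> is the rank one matrix after \<open>\<phi>\<close> has been
    applied entrywise and the denominators have been cleared by \<open>D\<close>.\<close>
  define X where "X = mat N N w"
  have Xc: "X \<in> carrier_mat N N" by (simp add: X_def)
  have X: "of_int (X $$ (i,j)) = of_int D * \<phi> (u $ i * y $ j)" if "i < N" "j < N" for i j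
    using w[of "(i,j)"] that by (simp add: X_def)
  have left: "of_int ((A ^\<^sub>m j * X) $$ (i,l)) = of_int D * \<phi> (\<alpha> ^ j * (u $ i * y $ l))" if il: "i < N" "l < N" for i j l
  proof -
    have "of_int ((A ^\<^sub>m j * X) $$ (i,l)) = (\<Sum>r<N. of_int ((A ^\<^sub>m j) $$ (i,r)) * of_int (X $$ (r,l)) :: rat)"
      using Ac Xc il by (subst mat_mult_index_sum[of _ N N _ N]) auto
    also have "\<dots> = (\<Sum>r<N. of_int D * \<phi> (of_int ((A ^\<^sub>m j) $$ (i,r)) * (u $ r * y $ l)))"
      using il by (intro sum.cong) (auto simp: X \<phi>(3))
    also have "\<dots> = of_int D * \<phi> ((\<Sum>r<N. of_int ((A ^\<^sub>m j) $$ (i,r)) * u $ r) * y $ l)"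
      by (simp add: \<phi>_sum sum_distrib_left sum_distrib_right mult.assoc)
    also have "(\<Sum>r<N. of_int ((A ^\<^sub>m j) $$ (i,r)) * u $ r) * y $ l = \<alpha> ^ j * (u $ i * y $ l)"
      unfolding hu[OF il(1)] by (simp add: mult.assoc)
    finally show ?thesis .
  qed
  have right: "of_int ((X * A ^\<^sub>m j) $$ (i,l)) = of_int D * \<phi> (\<beta> ^ j * (u $ i * y $ l))" if il: "i < N" "l < N" for i j l
  proof -
    have "of_int ((X * A ^\<^sub>m j) $$ (i,l)) = (\<Sum>r<N. of_int ((A ^\<^sub>m j) $$ (r,l)) * of_int (X $$ (i,r)) :: rat)"
      using Ac Xc il by (subst mat_mult_index_sum[of _ N N _ N]) (auto simp: mult.commute)
    also have "\<dots> = (\<Sum>r<N. of_int D * \<phi> (of_int ((A ^\<^sub>m j) $$ (r,l)) * (u $ i * y $ r)))"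
      using il by (intro sum.cong) (auto simp: X \<phi>(3))
    also have "\<dots> = of_int D * \<phi> (u $ i * (\<Sum>r<N. y $ r * of_int ((A ^\<^sub>m j) $$ (r,l))))"
      by (simp add: \<phi>_sum sum_distrib_left mult_ac)
    also have "u $ i * (\<Sum>r<N. y $ r * of_int ((A ^\<^sub>m j) $$ (r,l))) = \<beta> ^ j * (u $ i * y $ l)"
      unfolding hy[OF il(2)] by (simp add: mult_ac)
    finally show ?thesis .
  qed
  have eq: "A ^\<^sub>m j * X = X * A ^\<^sub>m j" if "\<alpha> ^ j = \<beta> ^ j" for j
  proof (rule eq_matI)
    have c: "A ^\<^sub>m j * X \<in> carrier_mat N N" "X * A ^\<^sub>m j \<in> carrier_mat N N"
      using Ac Xc by (auto intro!: mult_carrier_mat[of _ N N _ N])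
    fix i l assume "i < dim_row (X * A ^\<^sub>m j)" "l < dim_col (X * A ^\<^sub>m j)"
    then have "i < N" "l < N" unfolding carrier_matD[OF c(2)] by auto
    then have "(of_int ((A ^\<^sub>m j * X) $$ (i,l)) :: rat) = of_int ((X * A ^\<^sub>m j) $$ (i,l))"
      by (simp only: left right that)
    then show "(A ^\<^sub>m j * X) $$ (i,l) = (X * A ^\<^sub>m j) $$ (i,l)" by (simp only: of_int_eq_iff)
  qed (use Ac Xc in auto)
  \<comment> \<open>Passing to exponent \<open>K * k\<close> expresses commutation in terms of
    powers of \<open>A^K\<close>, which is trivial modulo 15.\<close>
  have "\<alpha> ^ (K * k) = \<beta> ^ (K * k)" using k(2) by (metis mult.commute power_mult)
  then have "(A ^\<^sub>m K) ^\<^sub>m k * X = X * (A ^\<^sub>m K) ^\<^sub>m k"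
    using eq[of "K * k"] by (simp add: pow_mat_mult[OF Ac])
  then have "A ^\<^sub>m K * X = X * A ^\<^sub>m K"
    by (rule commutes_if_pow_commutes[OF SL_int_pow[OF A] Xc K k(1)])
  then have "of_int D * \<phi> (\<alpha> ^ K * (u $ a * y $ b)) = of_int D * \<phi> (\<beta> ^ K * (u $ a * y $ b))"
    by (simp only: left[OF a(1) b(1), symmetric] right[OF a(1) b(1), symmetric])
  then have "\<phi> (\<alpha> ^ K * (u $ a * y $ b)) = \<phi> (\<beta> ^ K * (u $ a * y $ b))" using D(1) by simp
  moreover have "\<phi> (\<alpha> ^ K * (u $ a * y $ b)) = \<phi> c + \<phi> (\<beta> ^ K * (u $ a * y $ b))"
    using \<phi>(2)[of c "\<beta> ^ K * (u $ a * y $ b)"] by (simp add: c_def algebra_simps)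
  ultimately show False using \<phi>(1) by simp
qed

lemma char_poly_SL_pow_factored:
  assumes A: "A \<in> SL_int N"
  obtains d where "\<And>k. cpoly (char_poly (A ^\<^sub>m k)) = (\<Prod>i<N. [:- (d i ^ k), 1:])"
proof -
  have Ac: "A \<in> carrier_mat N N" using A by (rule SL_int_carrier)
  then have Cc: "cmat A \<in> carrier_mat N N" by simp
  obtain d where d: "\<And>k. char_poly (cmat A ^\<^sub>m k) = (\<Prod>i<N. [:- (d i ^ k), 1:])"
    using char_poly_pow_factored[OF Cc] by blast
  have "cpoly (char_poly (A ^\<^sub>m k)) = char_poly (cmat A ^\<^sub>m k)" for k
  proof -
    have "char_poly (cmat (A ^\<^sub>m k)) = cpoly (char_poly (A ^\<^sub>m k))"
      using Ac by (intro of_int_hom.char_poly_hom[of _ N]) simp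
    moreover have "cmat (A ^\<^sub>m k) = cmat A ^\<^sub>m k" by (rule of_int_hom.mat_hom_pow[OF Ac])
    ultimately show ?thesis by simp
  qed
  then show ?thesis using d that by simp
qed

lemma irreducible_prod_linear_inj:
  fixes f :: "int poly"
  assumes f: "irreducible f" and deg: "degree f > 0" and fac: "cpoly f = (\<Prod>i<(N :: nat). [:- d i, 1:])"
  shows "inj_on d {..<N}"
proof (rule inj_onI, rule ccontr)
  fix i j assume ij: "i \<in> {..<N}" "j \<in> {..<N}" "d i = d j" "i \<noteq> j"
  define q where "q = (\<Prod>l\<in>{..<N} - {i} - {j}. [:- d l, 1:])"
  have "(\<Prod>i<N. [:- d i, 1:]) = [:- d i, 1:] * (\<Prod>l\<in>{..<N} - {i}. [:- d l, 1:])"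
    using ij by (intro prod.remove) auto
  also have "(\<Prod>l\<in>{..<N} - {i}. [:- d l, 1:]) = [:- d j, 1:] * q"
    unfolding q_def using ij by (intro prod.remove) auto
  finally have eq: "cpoly f = [:- d i, 1:] * ([:- d i, 1:] * q)" using fac ij(3) by simp
  have "poly (cpoly f) (d i) = 0" unfolding eq poly_mult by simp
  moreover have "poly (pderiv (cpoly f)) (d i) = 0" unfolding eq pderiv_mult poly_add poly_mult by simp
  ultimately show False using irreducible_int_poly_simple_root[OF f deg] by blast
qed

text \<open>Irreducibility for \<open>A\<close> and \<open>A^K\<close> makes the \<open>K\<close>-th
  powers of the eigenvalues distinct, hence also their \<open>k\<close>-th powers by
  \<open>eigenvalue_pow_eq\<close>. If a factor \<open>g\<close> for \<open>A^k\<close> vanishes at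
  one of these, then \<open>char_poly A\<close> divides \<open>g(X^k)\<close>, so \<open>g\<close>
  vanishes at all \<open>N\<close> of them and has full degree.\<close>

lemma irreducible_char_poly_pow_all:
  assumes A: "A \<in> SL_int N" and K: "mat_mod 15 (A ^\<^sub>m K) = mat_mod 15 (1\<^sub>m N)" and N: "N > 0"
    and irr: "irreducible (char_poly A)" "irreducible (char_poly (A ^\<^sub>m K))" and k: "k > 0"
  shows "irreducible (char_poly (A ^\<^sub>m k))"
proof -
  have deg: "degree (char_poly (A ^\<^sub>m j)) = N" "lead_coeff (char_poly (A ^\<^sub>m j)) = 1" for j
    using degree_monic_char_poly[of "A ^\<^sub>m j" N] SL_int_carrier[OF A] by auto
  have A1: "A ^\<^sub>m 1 = A" using SL_int_carrier[OF A] by simp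
  obtain d where d: "\<And>j. cpoly (char_poly (A ^\<^sub>m j)) = (\<Prod>i<N. [:- (d i ^ j), 1:])"
    using char_poly_SL_pow_factored[OF A] by blast
  have root: "poly (cpoly (char_poly (A ^\<^sub>m j))) (d i ^ j) = 0" if "i < N" for i j
    unfolding d using that by (auto simp: poly_prod)
  have injd: "inj_on d {..<N}"
    using irreducible_prod_linear_inj[OF irr(1), where N = N and d = d] d[of 1] deg[of 1] N A1 by simp
  have injK: "inj_on (\<lambda>i. d i ^ K) {..<N}"
    using irreducible_prod_linear_inj[OF irr(2), where N = N and d = "\<lambda>i. d i ^ K"] d[of K] deg[of K] N by simp
  have injk: "inj_on (\<lambda>i. d i ^ k) {..<N}"
  proof (rule inj_onI)
    fix i j assume ij: "i \<in> {..<N}" "j \<in> {..<N}" "d i ^ k = d j ^ k"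
    have "d i ^ K = d j ^ K"
      using eigenvalue_pow_eq[OF A K _ _ k ij(3)] root[of i 1] root[of j 1] ij A1 by simp
    then show "i = j" using injK ij by (auto dest: inj_onD)
  qed
  have bad: False if gh: "char_poly (A ^\<^sub>m k) = g * h" "lead_coeff g = 1" "degree h > 0"
    and g: "poly (cpoly g) (d 0 ^ k) = 0" for g h
  proof -
    have "g * h \<noteq> 0" using deg(2)[of k] gh(1) by auto
    then have "degree g + degree h = N" using deg(1)[of k] gh(1) by (simp add: degree_mult_eq)
    then have degg: "degree g < N" using gh(3) by simp
    have "char_poly A dvd pcompose g (monom 1 k)"
      by (rule irreducible_int_poly_common_root[OF irr(1), of "d 0"])
        (use root[of 0 1] g N A1 in \<open>simp_all add: cpoly_pcompose_monom_root\<close>)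
    then obtain q where q: "pcompose g (monom 1 k) = char_poly A * q" by (elim dvdE)
    have groot: "poly (cpoly g) (d i ^ k) = 0" if "i < N" for i
    proof -
      have "poly (cpoly (pcompose g (monom 1 k))) (d i) = 0"
        unfolding q of_int_poly_hom.hom_mult using root[OF that, of 1] A1 by simp
      then show ?thesis by (simp add: cpoly_pcompose_monom_root)
    qed
    have g0: "cpoly g \<noteq> 0" using gh(2) by auto
    have "card ((\<lambda>i. d i ^ k) ` {..<N}) \<le> card {x. poly (cpoly g) x = 0}"
      using groot poly_roots_finite[OF g0] by (intro card_mono) auto
    also have "\<dots> \<le> degree (cpoly g)" using g0 by (rule card_poly_roots_bound)
    finally show False using degg injk by (simp add: card_image)
  qed
  show ?thesis
  proof (rule irreducible_monic_intI)
    show "lead_coeff (char_poly (A ^\<^sub>m k)) = 1" "degree (char_poly (A ^\<^sub>m k)) > 0" using deg N by simp_all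
    fix g h assume gh: "char_poly (A ^\<^sub>m k) = g * h" "lead_coeff g = 1" "lead_coeff h = 1" "degree g > 0" "degree h > 0"
    have "poly (cpoly g) (d 0 ^ k) * poly (cpoly h) (d 0 ^ k) = 0"
      using root[of 0 k] N by (simp add: gh(1) of_int_poly_hom.hom_mult)
    then consider "poly (cpoly g) (d 0 ^ k) = 0" | "poly (cpoly h) (d 0 ^ k) = 0" by auto
    then show False
    proof cases
      case 1
      then show ?thesis using bad[of g h] gh by simp
    next
      case 2
      then show ?thesis using bad[of h g] gh by (simp add: mult.commute)
    qed
  qed
qed

subsection \<open>Local criteria and the limit\<close>

text \<open>Reduction keeps the degrees of monic factors, so an integer factorisation survives
  modulo every \<open>p > 1\<close>. Each degree can thus be excluded by a modulus of its
  own.\<close>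

lemma irreducible_if_not_factorable:
  assumes f: "lead_coeff f = 1" "degree f = N" "N > 0"
    and no: "\<And>d. 1 \<le> d \<Longrightarrow> d < N \<Longrightarrow> \<exists>p>1. poly_red p f \<notin> factorable N d p"
  shows "irreducible f"
proof (rule irreducible_monic_intI)
  fix g h assume gh: "f = g * h" "lead_coeff g = 1" "lead_coeff h = 1" "degree g > 0" "degree h > 0"
  then have "g \<noteq> 0" "h \<noteq> 0" by auto
  then have N: "N = degree g + degree h" using gh f by (simp add: degree_mult_eq)
  then obtain p where p: "p > 1" "poly_red p f \<notin> factorable N (degree g) p" using no[of "degree g"] gh by auto
  have "poly_red p f = poly_red p (poly_red p g * poly_red p h)"
    unfolding gh(1) by (rule poly_red_mult_cong) simp_all
  moreover have "poly_red p g \<in> monic_mod p (degree g)" "poly_red p h \<in> monic_mod p (N - degree g)"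
    using poly_red_monic_mod[OF gh(2) p(1)] poly_red_monic_mod[OF gh(3) p(1)] N by simp_all
  ultimately have "poly_red p f \<in> factorable N (degree g) p" unfolding factorable_def by blast
  then show False using p by simp
qed (use f in auto)

text \<open>Lagrange's bound over the field of \<open>p\<close> elements, phrased for integer
  polynomials: linear factors are split off by synthetic division, leaving remainders divisible by
  \<open>p\<close>.\<close>

lemma card_roots_mod_prime_le_degree:
  fixes g :: "int poly"
  assumes p: "prime p" and "finite I" and "lead_coeff g = 1"
    and "\<And>i. i \<in> I \<Longrightarrow> p dvd poly g (b i)"
    and "\<And>i j. i \<in> I \<Longrightarrow> j \<in> I \<Longrightarrow> [b i = b j] (mod p) \<Longrightarrow> i = j"
  shows "card I \<le> degree g"
  using assms(2-)
proof (induction "degree g" arbitrary: g I)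
  case 0
  then have "g = 1" by (metis degree_eq_zeroE lead_coeff_pCons(2) one_pCons)
  then have "I = {}" using 0 p by (auto simp: not_prime_unit)
  then show ?case by simp
next
  case (Suc n)
  show ?case
  proof (cases "I = {}")
    case False
    then obtain i where i: "i \<in> I" by blast
    define q where "q = synthetic_div g (b i)"
    have g: "g = [:- b i, 1:] * q + [:poly g (b i):]" using synthetic_div_correct'[of "b i" g] by (simp add: q_def)
    have dq: "degree q = n" using Suc.hyps(2) by (simp add: q_def degree_synthetic_div)
    have "coeff g (Suc n) = coeff ([:- b i, 1:] * q) (Suc n)" using arg_cong[OF g, of "\<lambda>f. coeff f (Suc n)"] by simp
    also have "\<dots> = coeff q n" using dq by (simp add: coeff_eq_0)
    finally have lq: "lead_coeff q = 1" using Suc.prems(2) Suc.hyps(2) dq by simp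
    have "card (I - {i}) \<le> degree q"
    proof (rule Suc.hyps(1))
      fix j assume j: "j \<in> I - {i}"
      have "poly g (b j) = (b j - b i) * poly q (b j) + poly g (b i)"
        using arg_cong[OF g, of "\<lambda>f. poly f (b j)"] by (simp add: algebra_simps)
      then have "(b j - b i) * poly q (b j) = poly g (b j) - poly g (b i)" by linarith
      then have "p dvd (b j - b i) * poly q (b j)" using Suc.prems(3)[of j] Suc.prems(3)[OF i] j by simp
      moreover have "\<not> p dvd b j - b i" using Suc.prems(4)[of j i] i j by (auto simp: cong_iff_dvd_diff)
      ultimately show "p dvd poly q (b j)" using p by (simp add: prime_dvd_mult_iff)
    qed (use Suc.prems dq lq in auto)
    then show ?thesis using dq Suc.hyps(2) Suc.prems(1) i by (simp add: card_Diff_singleton)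
  qed simp
qed

text \<open>If a factor \<open>g\<close> for \<open>A^K\<close> vanishes at the \<open>K\<close>-th
  power of one eigenvalue, then \<open>char_poly A\<close> divides \<open>g(X^K)\<close>. So
  \<open>g\<close> vanishes modulo \<open>p\<close> at the \<open>N\<close> incongruent numbers
  \<open>a i ^ K\<close> and has full degree.\<close>

lemma irreducible_char_poly_pow_split:
  assumes A: "A \<in> SL_int N" and N: "N > 0" and irr: "irreducible (char_poly A)" and p: "prime p"
    and split: "poly_red p (char_poly A) \<in> split_polys N K p"
  shows "irreducible (char_poly (A ^\<^sub>m K))"
proof -
  have deg: "degree (char_poly (A ^\<^sub>m j)) = N" "lead_coeff (char_poly (A ^\<^sub>m j)) = 1" for j
    using degree_monic_char_poly[of "A ^\<^sub>m j" N] SL_int_carrier[OF A] by auto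
  have A1: "A ^\<^sub>m 1 = A" using SL_int_carrier[OF A] by simp
  obtain a where a: "poly_red p (char_poly A) = poly_red p (\<Prod>i<N. [:- a i, 1:])"
    "\<And>i j. i < N \<Longrightarrow> j < N \<Longrightarrow> [a i ^ K = a j ^ K] (mod p) \<Longrightarrow> i = j"
    using split by (auto simp: split_polys_def)
  have a_root: "p dvd poly (char_poly A) (a i)" if "i < N" for i
  proof -
    have "poly (\<Prod>i<N. [:- a i, 1:]) (a i) = 0" using that by (auto simp: poly_prod)
    then show ?thesis using poly_mod_cong[OF a(1), of "a i"] by (simp add: cong_iff_dvd_diff)
  qed
  obtain d where d: "\<And>j. cpoly (char_poly (A ^\<^sub>m j)) = (\<Prod>i<N. [:- (d i ^ j), 1:])"
    using char_poly_SL_pow_factored[OF A] by blast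
  have root: "poly (cpoly (char_poly (A ^\<^sub>m j))) (d 0 ^ j) = 0" for j
    unfolding d using N by (auto simp: poly_prod)
  have bad: False if gh: "char_poly (A ^\<^sub>m K) = g * h" "lead_coeff g = 1" "degree h > 0"
    and g: "poly (cpoly g) (d 0 ^ K) = 0" for g h
  proof -
    have "g * h \<noteq> 0" using deg(2)[of K] gh(1) by auto
    then have "degree g + degree h = N" using deg(1)[of K] gh(1) by (simp add: degree_mult_eq)
    then have degg: "degree g < N" using gh(3) by simp
    have "char_poly A dvd pcompose g (monom 1 K)"
      by (rule irreducible_int_poly_common_root[OF irr, of "d 0"])
        (use root[of 1] g A1 in \<open>simp_all add: cpoly_pcompose_monom_root\<close>)
    then obtain q where q: "pcompose g (monom 1 K) = char_poly A * q" by (elim dvdE)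
    have "card {..<N} \<le> degree g"
    proof (rule card_roots_mod_prime_le_degree[OF p _ gh(2), where b = "\<lambda>i. a i ^ K"])
      fix i assume "i \<in> {..<N}"
      then have "p dvd poly (pcompose g (monom 1 K)) (a i)" unfolding q poly_mult using a_root by simp
      then show "p dvd poly g (a i ^ K)" by (simp add: poly_pcompose_monom)
    qed (use a(2) in auto)
    then show False using degg by simp
  qed
  show ?thesis
  proof (rule irreducible_monic_intI)
    show "lead_coeff (char_poly (A ^\<^sub>m K)) = 1" "degree (char_poly (A ^\<^sub>m K)) > 0" using deg N by simp_all
    fix g h assume gh: "char_poly (A ^\<^sub>m K) = g * h" "lead_coeff g = 1" "lead_coeff h = 1" "degree g > 0" "degree h > 0"
    have "poly (cpoly g) (d 0 ^ K) * poly (cpoly h) (d 0 ^ K) = 0"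
      using root[of K] by (simp add: gh(1) of_int_poly_hom.hom_mult)
    then consider "poly (cpoly g) (d 0 ^ K) = 0" | "poly (cpoly h) (d 0 ^ K) = 0" by auto
    then show False
    proof cases
      case 1
      then show ?thesis using bad[of g h] gh by simp
    next
      case 2
      then show ?thesis using bad[of h g] gh by (simp add: mult.commute)
    qed
  qed
qed

text \<open>The bound on \<open>p\<close> gives \<open>(p - 1) div D \<ge> p / (2 * D)\<close>, and
  \<open>p - 1 \<ge> p / 2\<close> yields the last factor 1/2 of \<open>c\<close>. The powers of
  \<open>p\<close> then cancel against \<open>p^N\<close> in \<open>card_char_poly_fibre\<close>, so
  \<open>c\<close> is the same for all these primes.\<close>

lemma card_SL_mod_char_poly_ge:
  fixes p D :: nat
  assumes p: "prime p" "p \<ge> 2 * D + 2" and D: "D > 0" and N: "N \<ge> 2"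
    and F: "F \<subseteq> SL_polys N (int p)" "((p - 1) div D) ^ (N - 1) \<le> card F"
  defines "c \<equiv> (1 / (2 * real D)) ^ (N - 1) / 2"
  shows "real (card {A \<in> SL_mod N (int p). poly_red (int p) (char_poly A) \<notin> F})
    \<le> (1 - c) * real (card (SL_mod N (int p)))"
proof -
  let ?S = "SL_mod N (int p)"
  let ?G = "{A \<in> ?S. poly_red (int p) (char_poly A) \<in> F}"
  have p1: "p > 1" using p by simp
  have finF: "finite F" using F(1) finite_SL_polys[of "int p" N] p1 finite_subset by auto
  have pi: "prime (int p)" using p by simp
  have finS: "finite ?S" using finite_SL_mod p1 by simp
  define h where "h = (p - 1) div D"
  have "real p / (2 * real D) \<le> real h"
  proof -
    have "p - 1 < D * (h + 1)" unfolding h_def using D by (metis Suc_eq_plus1 dividend_less_div_times mult.commute mult_Suc_right add.commute)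
    then have "real (p - 1) < real (D * (h + 1))" by (simp only: of_nat_less_iff)
    then have "real p - 1 < real D * (real h + 1)" using p1 by (simp add: of_nat_diff algebra_simps)
    moreover have "real p \<ge> 2 * real D + 2" using p(2) by linarith
    ultimately have "real p \<le> real h * (2 * real D)" by (simp add: algebra_simps)
    then show ?thesis using D by (simp add: divide_le_eq)
  qed
  then have "(real p / (2 * real D)) ^ (N - 1) \<le> real h ^ (N - 1)" by (intro power_mono) auto
  also have "\<dots> \<le> real (card F)" using F(2) by (simp add: h_def flip: of_nat_power)
  finally have cF: "(real p / (2 * real D)) ^ (N - 1) \<le> real (card F)" .
  have GL: "real (p - 1) * real (card ?S) \<le> real (card (GL_mod N (int p)))"
  proof -
    have "nat (int p - 1) = p - 1" by linarith
    then show ?thesis using card_GL_mod_ge[OF pi, of N] N by (simp flip: of_nat_mult)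
  qed
  have "real (card F) * real (card (GL_mod N (int p))) \<le> real (card ?G) * real p ^ N"
    using card_char_poly_fibre[OF pi _ finF, of N] F(1) N
    by (auto simp: SL_polys_def monic_mod_def simp flip: of_nat_mult of_nat_power)
  moreover have "(real p / (2 * real D)) ^ (N - 1) * (real p / 2 * real (card ?S)) \<le> real (card F) * real (card (GL_mod N (int p)))"
  proof (rule mult_mono[OF cF])
    have "real p / 2 \<le> real (p - 1)" using p1 by (simp add: of_nat_diff)
    then show "real p / 2 * real (card ?S) \<le> real (card (GL_mod N (int p)))"
      using GL by (meson mult_right_mono of_nat_0_le_iff order_trans)
  qed auto
  moreover have "(real p / (2 * real D)) ^ (N - 1) * (real p / 2 * real (card ?S)) = (c * real (card ?S)) * real p ^ N"
  proof -
    have "real p ^ N = real p ^ (N - 1) * real p" using N by (metis Suc_diff_1 less_le_trans pos2 power_Suc2)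
    then show ?thesis by (simp add: c_def power_divide)
  qed
  ultimately have "(c * real (card ?S)) * real p ^ N \<le> real (card ?G) * real p ^ N" by linarith
  then have "c * real (card ?S) \<le> real (card ?G)" using p1 by simp
  moreover have "card {A \<in> ?S. poly_red (int p) (char_poly A) \<notin> F} + card ?G = card ?S"
    using finS by (subst card_Un_disjoint[symmetric]) (auto intro: arg_cong[where f = card])
  ultimately show ?thesis by (simp add: algebra_simps flip: of_nat_add)
qed

theorem theorem8p2:
  fixes N :: nat and S :: "int mat set"
  assumes "N \<ge> 2" and "finite S" and "generates_SL N S"
  shows "(\<lambda>L. real (card {ws \<in> words (gen_letters N S) L.
                 \<forall>k\<ge>1. irreducible (char_poly (word_prod N ws ^\<^sub>m k))})
           / real (card (words (gen_letters N S) L)))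
         \<longlonglongrightarrow> 1"
proof -
  let ?T = "gen_letters N S"
  let ?good = "\<lambda>ws. \<forall>k\<ge>1. irreducible (char_poly (word_prod N ws ^\<^sub>m k))"
  have SSL: "S \<subseteq> SL_int N" using assms(3) unfolding generates_SL_def by blast
  have finT: "finite ?T" by (rule finite_gen_letters[OF assms(2) SSL])
  have cardW: "card (words ?T L) > 0" and finW: "finite (words ?T L)" for L
    using card_lists_length_eq[OF finT, of L] finite_lists_length_eq[OF finT, of L] gen_letters_nonempty[OF assms(1,3)] finT
    by (auto simp: words_def card_gt_0_iff)
  obtain K where K: "K > 0" "\<And>A. A \<in> SL_int N \<Longrightarrow> mat_mod 15 (A ^\<^sub>m K) = mat_mod 15 (1\<^sub>m N)"
    using exists_exponent_mod[of 15 N] by auto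
  define D where "D = 2 * N\<^sup>2 * K"
  define c where "c = (1 / (2 * real D)) ^ (N - 1) / 2"
  have D: "D > 0" using K assms(1) by (simp add: D_def)
  have c: "c > 0" "c \<le> 1"
  proof -
    show "c > 0" using D by (simp add: c_def)
    have "(1 / (2 * real D)) ^ (N - 1) \<le> 1" using D by (intro power_le_one) auto
    then show "c \<le> 1" by (simp add: c_def)
  qed
  \<comment> \<open>Factor degrees run from 1 to \<open>N - 1\<close>, so index 0 is free for the
    splitting event.\<close>
  define F where "F = (\<lambda>e p. if e = 0 then split_polys N K p else SL_polys N p - factorable N e p)"
  define bad where "bad = (\<lambda>e p A. poly_red p (char_poly A) \<notin> F e p)"
  have bound: "real (card {A \<in> SL_mod N (int p). bad e (int p) A}) \<le> (1 - c) * real (card (SL_mod N (int p)))"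
    if p: "prime p" "p \<ge> 2 * D + 2" and e: "e < N" for p e
  proof -
    have pi: "prime (int p)" "int p > 1" using p prime_gt_1_nat by auto
    have split: "((p - 1) div D) ^ (N - 1) \<le> card (split_polys N K (int p))"
      unfolding D_def by (rule card_split_polys_ge[OF p(1) assms(1) K(1)])
    have "F e (int p) \<subseteq> SL_polys N (int p)" using split_polys_SL[OF pi(2)] by (auto simp: F_def)
    moreover have "((p - 1) div D) ^ (N - 1) \<le> card (F e (int p))"
      using split card_split_polys_le_not_factorable[OF pi(1), of e N K] e by (auto simp: F_def)
    ultimately show ?thesis
      unfolding bad_def c_def by (rule card_SL_mod_char_poly_ge[OF p D assms(1)])
  qed
  show ?thesis
  proof (rule LIMSEQ_I)
    fix \<epsilon> :: real assume \<epsilon>: "\<epsilon> > 0"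
    \<comment> \<open>\<open>r\<close> will be the number of primes: each of the \<open>N\<close>
      events fails at all of them with limiting proportion at most
      \<open>(1 - c) ^ r\<close>.\<close>
    have "(\<lambda>r. real N * (1 - c) ^ r) \<longlonglongrightarrow> real N * 0"
      using c by (intro tendsto_mult tendsto_const LIMSEQ_realpow_zero) auto
    then have "\<forall>\<^sub>F r in sequentially. real N * (1 - c) ^ r < \<epsilon>" using \<epsilon> by (intro order_tendstoD(2)) auto
    then obtain r where r: "real N * (1 - c) ^ r < \<epsilon>" by (auto simp: eventually_sequentially)
    \<comment> \<open>The lower bound on the primes serves the density estimate and also excludes 2,
      so that \<open>m\<close> is odd.\<close>
    have "infinite ({p :: nat. prime p} - {..<2 * D + 2})" using primes_infinite by (simp add: Diff_infinite_finite)
    then obtain P where P: "P \<subseteq> {p :: nat. prime p} - {..<2 * D + 2}" "finite P" "card P = r"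
      using infinite_arbitrarily_large by blast
    have Pp: "prime p" "p \<ge> 2 * D + 2" if "p \<in> P" for p using that P(1) by auto
    define m where "m = \<Prod>(int ` P)"
    have cop: "coprime p q" if "p \<in> int ` P" "q \<in> int ` P" "p \<noteq> q" for p q
      using that Pp by (auto intro!: primes_coprime)
    have m: "m > 0" "squarefree m" "odd m"
    proof -
      show "m > 0" unfolding m_def using Pp by (intro prod_pos) (auto simp: prime_gt_0_nat)
      show "squarefree m" unfolding m_def
        using Pp cop by (intro squarefree_prod_coprime) (auto intro!: squarefree_prime)
      show "odd m" unfolding m_def
      proof (subst prime_dvd_prod_iff)
        have "odd p" if "p \<in> P" for p
          using Pp[OF that] D primes_dvd_imp_eq[of 2 p] by auto
        then show "\<not> (\<exists>p\<in>int ` P. even p)" by auto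
      qed (use P in auto)
    qed
    define X where "X = (\<lambda>e. {A \<in> SL_mod N m. \<forall>p\<in>int ` P. bad e p (mat_mod p A)})"
    have cardS: "card (SL_mod N m) > 0"
      using SL_mod_red[of "1\<^sub>m N" N m] finite_SL_mod[OF m(1)] by (auto simp: card_gt_0_iff)
    have cardX: "real (card (X e)) / real (card (SL_mod N m)) \<le> (1 - c) ^ r" if e: "e < N" for e
    proof -
      have "real (card (X e)) \<le> (1 - c) ^ card (int ` P) * real (card (SL_mod N m))"
        unfolding X_def m_def using P Pp c e bound by (intro card_SL_mod_primes_bound) auto
      moreover have "card (int ` P) = r" using P(3) by (simp add: card_image)
      ultimately show ?thesis using cardS by (simp add: divide_le_eq)
    qed
    let ?pr = "\<lambda>e L. real (card {ws \<in> words ?T L. mat_mod m (word_prod N ws) \<in> X e}) / real (card (words ?T L))"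
    have "(\<lambda>L. \<Sum>e<N. ?pr e L) \<longlonglongrightarrow> (\<Sum>e<N. real (card (X e)) / real (card (SL_mod N m)))"
      by (intro tendsto_sum random_word_equidistribution assms m) (auto simp: X_def)
    moreover have "(\<Sum>e<N. real (card (X e)) / real (card (SL_mod N m))) < \<epsilon>"
    proof -
      have "(\<Sum>e<N. real (card (X e)) / real (card (SL_mod N m))) \<le> (\<Sum>e<N. (1 - c) ^ r)"
        by (intro sum_mono cardX) simp
      then show ?thesis using r by simp
    qed
    ultimately have "\<forall>\<^sub>F L in sequentially. (\<Sum>e<N. ?pr e L) < \<epsilon>" by (rule order_tendstoD(2))
    then obtain L0 where L0: "\<And>L. L \<ge> L0 \<Longrightarrow> (\<Sum>e<N. ?pr e L) < \<epsilon>" by (auto simp: eventually_sequentially)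
    \<comment> \<open>A word outside every \<open>X e\<close> realises each event at some prime of
      \<open>P\<close>: the events \<open>e > 0\<close> give irreducibility for the word itself,
      event 0 for its \<open>K\<close>-th power, and the two together for all powers.\<close>
    have cover: "\<exists>e<N. mat_mod m (word_prod N ws) \<in> X e" if ws: "ws \<in> words ?T L" "\<not> ?good ws" for ws L
    proof (rule ccontr)
      assume no: "\<not> (\<exists>e<N. mat_mod m (word_prod N ws) \<in> X e)"
      let ?w = "word_prod N ws"
      have w: "?w \<in> SL_int N" using ws(1) gen_letters_SL[OF SSL] by (intro word_prod_SL) (auto simp: words_def)
      have wc: "?w \<in> carrier_mat N N" "det ?w = 1" using w by (auto simp: SL_int_def)
      have "mat_mod m ?w \<in> SL_mod N m" using wc by (intro SL_mod_red) auto
      have ex: "\<exists>p\<in>P. poly_red (int p) (char_poly ?w) \<in> F e (int p)" if e: "e < N" for e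
      proof -
        obtain p where p: "p \<in> P" "\<not> bad e (int p) (mat_mod (int p) (mat_mod m ?w))"
          using no e \<open>mat_mod m ?w \<in> SL_mod N m\<close> by (auto simp: X_def)
        have "int p dvd m" unfolding m_def using p P by (intro dvd_prodI) auto
        then have "mat_mod (int p) (mat_mod m ?w) = mat_mod (int p) ?w" by (rule mat_mod_mod_dvd)
        moreover have "poly_red (int p) (char_poly (mat_mod (int p) ?w)) = poly_red (int p) (char_poly ?w)"
          using wc by (intro char_poly_mod_cong[of _ N]) auto
        ultimately show ?thesis using p by (auto simp: bad_def)
      qed
      have irr: "irreducible (char_poly ?w)"
      proof (rule irreducible_if_not_factorable)
        show "lead_coeff (char_poly ?w) = 1" "degree (char_poly ?w) = N" "N > 0"
          using degree_monic_char_poly[OF wc(1)] assms(1) by auto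
        fix d assume d: "1 \<le> d" "d < N"
        then obtain p where "p \<in> P" "poly_red (int p) (char_poly ?w) \<in> F d (int p)" using ex by blast
        then show "\<exists>p>1. poly_red p (char_poly ?w) \<notin> factorable N d p"
          using d Pp[of p] prime_gt_1_nat[of p] by (intro exI[of _ "int p"]) (auto simp: F_def)
      qed
      obtain p where p: "p \<in> P" "poly_red (int p) (char_poly ?w) \<in> F 0 (int p)" using ex[of 0] assms(1) by auto
      have "irreducible (char_poly (?w ^\<^sub>m K))"
        by (rule irreducible_char_poly_pow_split[OF w _ irr, of "int p"])
          (use p Pp[OF p(1)] assms(1) in \<open>auto simp: F_def\<close>)
      then have "?good ws"
        using irreducible_char_poly_pow_all[OF w K(2)[OF w] _ irr] assms(1) by auto
      then show False using ws by simp
    qed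
    show "\<exists>L0. \<forall>L\<ge>L0. norm (real (card {ws \<in> words ?T L. ?good ws}) / real (card (words ?T L)) - 1) < \<epsilon>"
    proof (intro exI allI impI)
      fix L assume L: "L \<ge> L0"
      let ?W = "words ?T L"
      have "card {ws \<in> ?W. ?good ws} + card {ws \<in> ?W. \<not> ?good ws} = card ?W"
        using finW by (subst card_Un_disjoint[symmetric]) (auto intro: arg_cong[where f = card])
      then have eq: "real (card {ws \<in> ?W. ?good ws}) + real (card {ws \<in> ?W. \<not> ?good ws}) = real (card ?W)"
        by (simp flip: of_nat_add)
      have "{ws \<in> ?W. \<not> ?good ws} \<subseteq> (\<Union>e<N. {ws \<in> ?W. mat_mod m (word_prod N ws) \<in> X e})"
        using cover by blast
      then have "card {ws \<in> ?W. \<not> ?good ws} \<le> card (\<Union>e<N. {ws \<in> ?W. mat_mod m (word_prod N ws) \<in> X e})"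
        using finW by (intro card_mono) auto
      also have "\<dots> \<le> (\<Sum>e<N. card {ws \<in> ?W. mat_mod m (word_prod N ws) \<in> X e})" by (rule card_UN_le) simp
      finally have "real (card {ws \<in> ?W. \<not> ?good ws}) \<le> real (\<Sum>e<N. card {ws \<in> ?W. mat_mod m (word_prod N ws) \<in> X e})"
        by (simp only: of_nat_le_iff)
      then have "real (card {ws \<in> ?W. \<not> ?good ws}) / real (card ?W) \<le> (\<Sum>e<N. ?pr e L)"
        by (simp add: sum_divide_distrib[symmetric] divide_right_mono)
      also have "\<dots> < \<epsilon>" using L by (rule L0)
      finally have "real (card {ws \<in> ?W. \<not> ?good ws}) / real (card ?W) < \<epsilon>" .
      moreover have quot: "a / w - 1 = - (b / w)" if "a + b = w" "w > 0" for a b w :: real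
      proof -
        have a: "a = w - b" using that by simp
        show ?thesis unfolding a diff_divide_distrib using that(2) by simp
      qed
      have "real (card {ws \<in> ?W. ?good ws}) / real (card ?W) - 1 = - (real (card {ws \<in> ?W. \<not> ?good ws}) / real (card ?W))"
        by (rule quot[OF eq]) (use cardW[of L] in simp)
      ultimately show "norm (real (card {ws \<in> ?W. ?good ws}) / real (card ?W) - 1) < \<epsilon>" by simp
    qed
  qed
qed

end
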